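(* There exists a numerical constant $c$ such that for any integer $k\ge2$, any integers $p\ge q\ge 1$ and any real $p\times q$ matrix $\mathbf A$, $$\mathrm{Var}(U_k)\le c^k\Big[(pq)^k+p\,\|\mathbf A\|_{4k-4}^{4k-4}+\|\mathbf A\|_{4k-2}^{4k-2}+p^kk^{3k}+k^{6k}\Big].$$
   Context: $\mathbf Y=\mathbf A+\mathbf E$, where $\mathbf A$ is a deterministic real $p\times q$ matrix and $\mathbf E$ is a $p\times q$ random matrix with independent standard normal entries. With $\sigma_1(\mathbf A)\ge\dots\ge\sigma_q(\mathbf A)\ge0$ the singular values, $\|\mathbf A\|_s^s=\sum_{i=1}^q\sigma_i^s(\mathbf A)$ (Schatten norms). Hermite polynomials: with $\phi(y)=e^{-y^2/2}(2\pi)^{-1/2}$, $H_r$ is the degree-$r$ polynomial defined by $\frac{d^r}{dy^r}\phi(y)=(-1)^rH_r(y)\phi(y)$ ($H_0=1$). For sequences $i=(i_1,\dots,i_k)\in\{1,\dots,p\}^k$ and $j=(j_1,\dots,j_k)\in\{1,\dots,q\}^k$, with the convention $j_{k+1}=j_1$, $N_{rs}(i,j)$ denotes the number of occurrences of the pair $(r,s)$ among the $2k$ pairs $(i_t,j_t)$ and $(i_t,j_{t+1})$, $t=1,\dots,k$. Then $$U_k=\sum_{i_1,\dots,i_k=1}^p\ \sum_{j_1,\dots,j_k=1}^q\ \prod_{r=1}^p\prod_{s=1}^qH_{N_{rs}(i,j)}(\mathbf Y_{rs}).$$ *)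

theory Defs
  imports
    "HOL-Probability.Probability"
    "Jordan_Normal_Form.Char_Poly"
begin

no_notation Finite_Cartesian_Product.vec_nth (infixl "$" 90)

subsection \<open>Singular values and Schatten norms\<close>

text \<open>
  Square roots of the eigenvalues of \<open>A\<^sup>T A\<close>, repeated according to multiplicity and
  listed in decreasing order; the \<open>i\<close>-th singular value in the usual counting from one
  is the list entry with index \<open>i - 1\<close>.
\<close>

definition singular_values :: "real mat \<Rightarrow> real list" where
  "singular_values A =
     rev (sorted_list_of_multiset (image_mset sqrt (proots (char_poly (A\<^sup>T * A)))))"

definition singular_value :: "nat \<Rightarrow> real mat \<Rightarrow> real" where
  "singular_value i A = singular_values A ! (i - 1)"

definition schatten_norm :: "nat \<Rightarrow> real mat \<Rightarrow> real" where
  "schatten_norm s A = root s (\<Sum>i=1..dim_col A. singular_value i A ^ s)"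

lemma gram_eigenvalue:
  fixes A :: "real mat" and z :: complex
  assumes A: "A \<in> carrier_mat p q"
    and z: "poly (char_poly (map_mat of_real (A\<^sup>T * A))) z = 0"
  shows "\<exists>b::real. b \<ge> 0 \<and> z = of_real b"
proof -
  let ?B = "map_mat of_real (A\<^sup>T * A) :: complex mat"
  have B: "?B \<in> carrier_mat q q" using A by auto
  from z have "eigenvalue ?B z" using eigenvalue_root_char_poly[OF B] by simp
  then obtain v where v: "v \<in> carrier_vec q" "v \<noteq> 0\<^sub>v q" "?B *\<^sub>v v = z \<cdot>\<^sub>v v"
    using A unfolding eigenvalue_def eigenvector_def by auto
  define x where "x i = v $ i" for i
  define a where "a r i = complex_of_real (A $$ (r, i))" for r i
  define w where "w r = (\<Sum>i<q. a r i * x i)" for r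
  have ev: "(\<Sum>j<q. (\<Sum>r<p. a r i * a r j) * x j) = z * x i" if "i < q" for i
  proof -
    have "(?B *\<^sub>v v) $ i = (\<Sum>j<q. (\<Sum>r<p. a r i * a r j) * x j)"
      using that A v(1)
      by (auto simp: scalar_prod_def a_def x_def atLeast0LessThan intro!: sum.cong)
    moreover have "(z \<cdot>\<^sub>v v) $ i = z * x i" using that v(1) by (simp add: x_def)
    ultimately show ?thesis using v(3) by simp
  qed
  have "z * of_real (\<Sum>i<q. (cmod (x i))\<^sup>2) = (\<Sum>i<q. cnj (x i) * (z * x i))"
    by (simp add: sum_distrib_left complex_norm_square mult_ac flip: of_real_power)
  also have "\<dots> = (\<Sum>i<q. cnj (x i) * (\<Sum>j<q. (\<Sum>r<p. a r i * a r j) * x j))"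
    using ev by simp
  also have "\<dots> = (\<Sum>i<q. \<Sum>j<q. \<Sum>r<p. cnj (a r i * x i) * (a r j * x j))"
    by (simp add: sum_distrib_left sum_distrib_right a_def mult_ac)
  also have "\<dots> = (\<Sum>i<q. \<Sum>r<p. \<Sum>j<q. cnj (a r i * x i) * (a r j * x j))"
    by (intro sum.cong refl sum.swap)
  also have "\<dots> = (\<Sum>r<p. \<Sum>i<q. \<Sum>j<q. cnj (a r i * x i) * (a r j * x j))"
    by (rule sum.swap)
  also have "\<dots> = (\<Sum>r<p. cnj (w r) * w r)"
    by (simp add: w_def cnj_sum sum_product)
  also have "\<dots> = of_real (\<Sum>r<p. (cmod (w r))\<^sup>2)"
    by (simp add: complex_norm_square mult_ac flip: of_real_power)
  finally have eq: "z * of_real (\<Sum>i<q. (cmod (x i))\<^sup>2) = of_real (\<Sum>r<p. (cmod (w r))\<^sup>2)" .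
  obtain i where "i < q" "x i \<noteq> 0"
    using v(1,2) unfolding x_def by (metis carrier_vecD eq_vecI index_zero_vec(1,2))
  then have pos: "(\<Sum>i<q. (cmod (x i))\<^sup>2) > 0"
    by (intro sum_pos2[of _ i]) auto
  let ?b = "(\<Sum>r<p. (cmod (w r))\<^sup>2) / (\<Sum>i<q. (cmod (x i))\<^sup>2)"
  have "z = of_real ?b"
    using eq pos by (simp add: field_simps del: of_real_sum of_real_power)
  moreover have "?b \<ge> 0" by (intro divide_nonneg_nonneg sum_nonneg) auto
  ultimately show ?thesis by blast
qed

lemma proots_gram:
  fixes A :: "real mat"
  assumes A: "A \<in> carrier_mat p q"
  shows "size (proots (char_poly (A\<^sup>T * A))) = q"
    and "\<And>b. b \<in># proots (char_poly (A\<^sup>T * A)) \<Longrightarrow> b \<ge> 0"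
proof -
  let ?P = "char_poly (A\<^sup>T * A)"
  let ?B = "map_mat of_real (A\<^sup>T * A) :: complex mat"
  have G: "A\<^sup>T * A \<in> carrier_mat q q" and B: "?B \<in> carrier_mat q q" using A by auto
  interpret poly_hom: map_poly_inj_idom_hom "of_real :: real \<Rightarrow> complex" ..
  obtain as where as: "char_poly ?B = (\<Prod>a\<leftarrow>as. [:- a, 1:])" "length as = q"
    using char_poly_factorized[OF B] by blast
  have re: "a = of_real (Re a) \<and> Re a \<ge> 0" if "a \<in> set as" for a
  proof -
    have "poly (char_poly ?B) a = 0"
      using that unfolding as(1) by (auto simp: poly_prod_list prod_list_zero_iff)
    from gram_eigenvalue[OF A this] show ?thesis by auto
  qed
  let ?bs = "map Re as"
  have "map_poly of_real ?P = char_poly ?B"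
    by (rule of_real_hom.char_poly_hom[OF G, symmetric])
  also have "\<dots> = (\<Prod>a\<leftarrow>as. [:- complex_of_real (Re a), 1:])"
    unfolding as(1) using re by (intro arg_cong[of _ _ prod_list] map_cong) auto
  also have "\<dots> = map_poly of_real (\<Prod>b\<leftarrow>?bs. [:- b, 1:])"
    by (induction as) (simp_all add: poly_hom.hom_mult del: mult_pCons_left)
  finally have P: "?P = (\<Prod>b\<leftarrow>?bs. [:- b, 1:])"
    by (simp only: poly_hom.eq_iff)
  have "proots (\<Prod>b\<leftarrow>bs. [:- b, 1:]) = mset bs" for bs :: "real list"
  proof (induction bs)
    case (Cons b bs)
    have "(\<Prod>b\<leftarrow>bs. [:- b, 1:]) \<noteq> 0" by (auto simp: prod_list_zero_iff)
    then show ?case using Cons by (simp add: proots_mult del: mult_pCons_left)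
  qed simp
  then have "proots ?P = mset ?bs" unfolding P .
  then show "size (proots ?P) = q" "\<And>b. b \<in># proots ?P \<Longrightarrow> b \<ge> 0"
    using as(2) re by auto
qed

lemma length_singular_values:
  assumes "A \<in> carrier_mat p q"
  shows "length (singular_values A) = q"
  using proots_gram(1)[OF assms]
  by (simp add: singular_values_def flip: size_mset)

lemma singular_value_nonneg:
  assumes "A \<in> carrier_mat p q" "1 \<le> i" "i \<le> q"
  shows "singular_value i A \<ge> 0"
proof -
  have "singular_value i A \<in> set (singular_values A)"
    using assms length_singular_values[OF assms(1)] by (simp add: singular_value_def)
  then show ?thesis using proots_gram(2)[OF assms(1)]
    by (auto simp: singular_values_def)
qed

lemma singular_value_antimono:
  assumes "A \<in> carrier_mat p q" "1 \<le> i" "i \<le> j" "j \<le> q"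
  shows "singular_value j A \<le> singular_value i A"
proof -
  have "sorted (rev (singular_values A))" by (simp add: singular_values_def)
  then show ?thesis
    using assms length_singular_values[OF assms(1)]
    by (simp add: singular_value_def sorted_rev_nth_mono)
qed

lemma schatten_norm_power:
  assumes "A \<in> carrier_mat p q" "s > 0"
  shows "schatten_norm s A ^ s = (\<Sum>i=1..q. singular_value i A ^ s)"
  using assms singular_value_nonneg[OF assms(1)]
  by (auto simp: schatten_norm_def intro!: real_root_pow_pos2 sum_nonneg)


subsection \<open>Hermite polynomials\<close>

definition hermite :: "nat \<Rightarrow> real \<Rightarrow> real" where
  "hermite r y = (-1) ^ r * (deriv ^^ r) std_normal_density y / std_normal_density y"

lemma hermite_poly:
  "\<exists>h :: real poly. degree h = r \<and> lead_coeff h = 1 \<and>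
     (\<forall>y. (deriv ^^ r) std_normal_density y = (-1) ^ r * poly h y * std_normal_density y)"
proof (induction r)
  case 0
  show ?case by (rule exI[of _ 1]) simp
next
  case (Suc r)
  then obtain h :: "real poly" where h: "degree h = r" "lead_coeff h = 1"
    and D: "(deriv ^^ r) std_normal_density =
              (\<lambda>y. (-1) ^ r * poly h y * std_normal_density y)"
    by (auto simp: fun_eq_iff)
  define g where "g = pCons 0 h - pderiv h"
  have phi: "(std_normal_density has_field_derivative - y * std_normal_density y) (at y)" for y
    unfolding std_normal_density_def
    by (auto intro!: derivative_eq_intros simp: field_simps power2_eq_square)
  have "(deriv ^^ Suc r) std_normal_density y =
          (-1) ^ Suc r * poly g y * std_normal_density y" for y
  proof -
    have "((\<lambda>y. (-1) ^ r * poly h y * std_normal_density y) has_field_derivative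
            (-1) ^ Suc r * poly g y * std_normal_density y) (at y)"
      by (rule derivative_eq_intros phi poly_DERIV refl)+ (simp add: g_def algebra_simps)
    then show ?thesis unfolding funpow.simps o_def D by (rule DERIV_imp_deriv)
  qed
  moreover have h0: "h \<noteq> 0" using h by auto
  have "degree (pderiv h) < degree (pCons 0 h)"
    using h0 by (simp add: degree_pderiv)
  then have "degree g = Suc r"
    unfolding g_def diff_conv_add_uminus using h h0 by (subst degree_add_eq_left) auto
  moreover have "lead_coeff g = 1"
  proof -
    have "coeff g (Suc r) = 1"
      using h by (simp add: g_def coeff_pderiv coeff_eq_0)
    then show ?thesis using \<open>degree g = Suc r\<close> by simp
  qed
  ultimately show ?case by blast
qed

lemma hermite_eq_poly:
  "\<exists>h :: real poly. degree h = r \<and> lead_coeff h = 1 \<and> (\<forall>y. hermite r y = poly h y)"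
proof -
  obtain h :: "real poly" where "degree h = r" "lead_coeff h = 1"
    and "\<And>y. (deriv ^^ r) std_normal_density y = (-1) ^ r * poly h y * std_normal_density y"
    using hermite_poly by blast
  moreover have "(-1::real) ^ r * ((-1) ^ r * c) = c" for c
    by (simp flip: power_mult_distrib mult.assoc)
  moreover have "std_normal_density y \<noteq> 0" for y
    by (simp add: std_normal_density_def)
  ultimately show ?thesis by (auto simp: hermite_def intro!: exI[of _ h])
qed


subsection \<open>The statistic\<close>

text \<open>
  Row, column and sequence indices start at 0, so \<open>i\<close> and \<open>j\<close> are functions on
  \<open>{..<k}\<close> and the cyclic successor of \<open>t\<close> is \<open>Suc t mod k\<close>.
\<close>

definition pair_count ::
  "nat \<Rightarrow> (nat \<Rightarrow> nat) \<Rightarrow> (nat \<Rightarrow> nat) \<Rightarrow> nat \<Rightarrow> nat \<Rightarrow> nat" where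
  "pair_count k i j r s =
     card {t \<in> {..<k}. (i t, j t) = (r, s)} +
     card {t \<in> {..<k}. (i t, j (Suc t mod k)) = (r, s)}"

definition U_stat :: "nat \<Rightarrow> real mat \<Rightarrow> real" where
  "U_stat k Y =
     (\<Sum>i \<in> {..<k} \<rightarrow>\<^sub>E {..<dim_row Y}. \<Sum>j \<in> {..<k} \<rightarrow>\<^sub>E {..<dim_col Y}.
        \<Prod>r<dim_row Y. \<Prod>s<dim_col Y. hermite (pair_count k i j r s) (Y $$ (r, s)))"


subsection \<open>The noise\<close>

text \<open>
  The law of a \<open>p \<times> q\<close> matrix with independent standard normal entries; a sample
  \<open>\<omega>\<close> gives the matrix \<open>mat p q \<omega>\<close>. Using the law instead of an arbitrary
  underlying probability space allows constants that do not depend on the type of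
  that space; \<open>variance_std_gaussian\<close> carries variances over to any such space.
\<close>

definition std_gaussian :: "nat \<Rightarrow> nat \<Rightarrow> (nat \<times> nat \<Rightarrow> real) measure" where
  "std_gaussian p q = (\<Pi>\<^sub>M rs \<in> {..<p} \<times> {..<q}. density lborel std_normal_density)"

lemma prob_space_std_gaussian: "prob_space (std_gaussian p q)"
  unfolding std_gaussian_def by (intro prob_space_PiM prob_space_normal_density) simp

lemma measurable_U_stat:
  assumes "A \<in> carrier_mat p q"
  shows "(\<lambda>\<omega>. U_stat k (A + mat p q \<omega>)) \<in>
    borel_measurable (\<Pi>\<^sub>M rs \<in> {..<p} \<times> {..<q}. borel)"
proof -
  have H: "hermite r \<in> borel_measurable borel" for r
  proof -
    obtain h :: "real poly" where "\<And>y. hermite r y = poly h y" using hermite_eq_poly by blast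
    then have "hermite r = poly h" by auto
    then show ?thesis by (auto intro!: borel_measurable_continuous_onI continuous_intros)
  qed
  have "(\<lambda>\<omega>. U_stat k (A + mat p q \<omega>)) =
    (\<lambda>\<omega>. \<Sum>i \<in> {..<k} \<rightarrow>\<^sub>E {..<p}. \<Sum>j \<in> {..<k} \<rightarrow>\<^sub>E {..<q}.
        \<Prod>r<p. \<Prod>s<q. hermite (pair_count k i j r s) (A $$ (r, s) + \<omega> (r, s)))"
    using assms by (auto simp: U_stat_def fun_eq_iff intro!: sum.cong prod.cong)
  also have "\<dots> \<in> borel_measurable (\<Pi>\<^sub>M rs \<in> {..<p} \<times> {..<q}. borel)"
    by (intro borel_measurable_sum borel_measurable_prod measurable_compose[OF _ H]
          borel_measurable_add borel_measurable_const measurable_component_singleton) auto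
  finally show ?thesis .
qed

lemma (in prob_space) variance_std_gaussian:
  assumes A: "A \<in> carrier_mat p q" and pq: "p \<ge> 1" "q \<ge> 1"
    and ind: "indep_vars (\<lambda>_. borel) E ({..<p} \<times> {..<q})"
    and dis: "\<And>rs. rs \<in> {..<p} \<times> {..<q} \<Longrightarrow>
                distributed M lborel (E rs) std_normal_density"
  shows "variance (\<lambda>x. U_stat k (A + mat p q (\<lambda>rs. E rs x))) =
    prob_space.variance (std_gaussian p q) (\<lambda>\<omega>. U_stat k (A + mat p q \<omega>))"
proof -
  let ?I = "{..<p} \<times> {..<q}" and ?U = "\<lambda>\<omega>. U_stat k (A + mat p q \<omega>)"
  let ?E = "\<lambda>x. \<lambda>rs\<in>?I. E rs x" and ?N = "\<Pi>\<^sub>M rs\<in>?I. (borel :: real measure)"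
  have rv: "random_variable borel (E rs)" if "rs \<in> ?I" for rs
    using distributed_measurable[OF dis[OF that]] by simp
  have law: "distr M borel (E rs) = density lborel std_normal_density" if "rs \<in> ?I" for rs
    using distributed_distr_eq_density[OF dis[OF that]] by (simp cong: distr_cong)
  have "?I \<noteq> {}" using pq by (auto simp: lessThan_empty_iff)
  then have D: "distr M ?N ?E = std_gaussian p q"
    using ind law indep_vars_iff_distr_eq_PiM'[of ?I E "\<lambda>_. borel"] rv
    by (auto simp: std_gaussian_def intro!: PiM_cong)
  have Em: "?E \<in> measurable M ?N" using rv by (intro measurable_restrict) auto
  have eq: "mat p q (\<lambda>rs. E rs x) = mat p q (?E x)" for x by (intro eq_matI) auto
  note Um = measurable_U_stat[OF A, of k]
  have "integral\<^sup>L (std_gaussian p q) ?U = expectation (\<lambda>x. ?U (?E x))"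
    unfolding D[symmetric] by (rule integral_distr[OF Em Um])
  moreover have "integral\<^sup>L (std_gaussian p q) (\<lambda>\<omega>. (?U \<omega> - c)\<^sup>2) =
      expectation (\<lambda>x. (?U (?E x) - c)\<^sup>2)" for c
    unfolding D[symmetric] by (rule integral_distr[OF Em]) (use Um in measurable)
  ultimately show ?thesis unfolding eq by simp
qed

end

theory Submission
  imports Defs "Jordan_Normal_Form.Schur_Decomposition"
begin

text \<open>
  Hermite polynomials are the Wick powers of a standard normal variable, so \<open>U\<^sub>k\<close> is the
  Wick-ordered version of the trace of \<open>(Y\<^sup>T Y)\<^sup>k\<close>: a sum over closed walks with \<open>2k\<close> slots, each
  slot holding an entry of \<open>Y\<close>. The addition formula for Hermite polynomials (\<open>hermite_prod_add\<close>)
  lets every slot choose between its signal entry and its noise entry, so \<open>U\<^sub>k\<close> is the sum over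
  all sets \<open>S\<close> of slots of a part \<open>U\<^sub>S\<close> with noise exactly in \<open>S\<close>. The part with \<open>S\<close> empty is
  constant; by Cauchy-Schwarz over the \<open>4\<^sup>k\<close> sets, it is enough to bound each \<open>E U\<^sub>S\<^sup>2\<close> with \<open>S\<close>
  nonempty (\<open>variance_le_noise_parts\<close>).

  The Wick ordering is removed by decoupling. Orthogonality of the Hermite polynomials says that
  \<open>E U\<^sub>S\<^sup>2\<close> counts matchings between the slots of two walks. Give each slot a colour, and
  replace the Hermite products by ordinary products of entries of independent noise matrices, one
  for each colour. Among the colourings of the second walk exactly one is compatible with a given
  matching, so the resulting polynomial \<open>G\<close> has a large correlation with the sum of all coloured
  Hermite products, and \<open>E U\<^sub>S\<^sup>2\<close> is at most \<open>E G\<^sup>2\<close> times the number of colourings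
  (\<open>decoupling\<close>). Three colours are used: one for a single distinguished slot of \<open>S\<close>, and two for
  the remaining slots according to the parity of their position.

  Now \<open>G\<close> is the trace of a product of \<open>2k\<close> matrices, linear in the noise at the distinguished
  slot. Averaging over that noise leaves the squared Frobenius norm of the open word formed by the
  other \<open>2k - 1\<close> letters (\<open>decoupled_part_second_moment\<close>). Each letter is the signal \<open>A\<close> or one of
  two independent noise matrices \<open>Z\<^sub>0\<close>, \<open>Z\<^sub>1\<close>, with transposes at alternate places. A
  noncommutative Hoelder inequality (\<open>frob_sq_word_le\<close>) bounds this by the squared operator norms
  of the noise letters times \<open>tr ((A\<^sup>T A)\<^sup>a)\<close>, where \<open>a\<close> is the number of signal letters. Young's
  inequality for each singular value then leaves only the two extreme cases: a word of noise and a
  word of signal letters.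

  The operator norms must be as small as the smaller dimension allows. Noise that shares a factor
  \<open>F\<^sup>T F'\<close> of the word with a signal letter matters only through its projection on the column space
  of \<open>A\<close> (\<open>column_space_isometry\<close>), so its squared operator norm is of order \<open>Q = q + k\<close>. Two noise letters in one such factor form
  \<open>Z\<^sub>0\<^sup>T Z\<^sub>1\<close>, of squared operator norm of order \<open>PQ\<close> with \<open>P = p + q + k\<close>. Only if the
  neighbour of the distinguished slot in its pair is noise does the word begin with a full \<open>p \<times> q\<close>
  noise matrix, at the cost \<open>P\<close>: that is the origin of the term with \<open>p\<close> and the exponent \<open>4k - 4\<close>.
  Moments of these norms come from averaging \<open>(g\<^sup>T X h)\<^sup>2\<^sup>M\<close> over Gaussian vectors \<open>g\<close> and \<open>h\<close>
  (\<open>operator_norm_le_bilin_mom\<close>): for fixed \<open>g\<close> and \<open>h\<close> this is explicit in the noise, and the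
  loss is exponential in \<open>M\<close>, a constant factor after taking \<open>M\<close>-th roots. All in all the
  expected squared Frobenius norm is at most a constant times \<open>(PQ)\<^sup>k + P tr ((A\<^sup>T A)\<^sup>2\<^sup>k\<^sup>-\<^sup>2) +
  tr ((A\<^sup>T A)\<^sup>2\<^sup>k\<^sup>-\<^sup>1)\<close>, up to constant factors in \<open>P\<close> and \<open>Q\<close> (\<open>expected_word_bound\<close>).
\<close>

section \<open>Hermite polynomials and the standard normal law\<close>

fun hermite_p :: "nat \<Rightarrow> real poly" where
  "hermite_p 0 = 1"
| "hermite_p (Suc n) = pCons 0 (hermite_p n) - pderiv (hermite_p n)"

lemma std_normal_density_derivs:
  "(deriv ^^ n) std_normal_density = (\<lambda>y. (-1) ^ n * poly (hermite_p n) y * std_normal_density y)"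
proof (induction n)
  case (Suc n)
  have phi: "(std_normal_density has_field_derivative - y * std_normal_density y) (at y)" for y
    unfolding std_normal_density_def
    by (auto intro!: derivative_eq_intros simp: field_simps power2_eq_square)
  have "((\<lambda>y. (-1) ^ n * poly (hermite_p n) y * std_normal_density y) has_field_derivative
          (-1) ^ Suc n * poly (hermite_p (Suc n)) y * std_normal_density y) (at y)" for y
    by (rule derivative_eq_intros phi poly_DERIV refl)+ (simp add: algebra_simps)
  then show ?case unfolding funpow.simps o_def Suc by (intro ext DERIV_imp_deriv)
qed simp

lemma hermite_eq: "hermite n y = poly (hermite_p n) y"
proof -
  have "(-1::real) ^ n * ((-1) ^ n * c) = c" for c
    by (simp flip: power_mult_distrib mult.assoc)
  moreover have "std_normal_density y \<noteq> 0"
    by (simp add: std_normal_density_def)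
  ultimately show ?thesis by (simp add: hermite_def std_normal_density_derivs)
qed

lemma pderiv_hermite_p: "pderiv (hermite_p (Suc n)) = Polynomial.smult (of_nat (Suc n)) (hermite_p n)"
proof (induction n)
  case 0
  show ?case by (simp add: pderiv_pCons)
next
  case (Suc n)
  have "pderiv (hermite_p (Suc (Suc n))) =
      hermite_p (Suc n) + (pCons 0 (pderiv (hermite_p (Suc n))) - pderiv (pderiv (hermite_p (Suc n))))"
    by (subst hermite_p.simps(2)) (simp only: pderiv_diff pderiv_pCons add_diff_eq)
  also have "pCons 0 (pderiv (hermite_p (Suc n))) - pderiv (pderiv (hermite_p (Suc n)))
      = Polynomial.smult (of_nat (Suc n)) (pCons 0 (hermite_p n) - pderiv (hermite_p n))"
    by (simp only: Suc pderiv_smult smult_diff_right smult_pCons mult_zero_right)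
  also have "pCons 0 (hermite_p n) - pderiv (hermite_p n) = hermite_p (Suc n)" by simp
  finally show ?case
    by (simp only: of_nat_Suc[of "Suc n"] smult_add_left smult_1_left)
qed

text \<open>Since \<open>H\<^sub>n\<^sub>+\<^sub>1' = (n + 1) H\<^sub>n\<close>, both sides have the same derivative in \<open>a\<close> by the
  induction hypothesis, and they agree at \<open>a = 0\<close>.\<close>
lemma hermite_p_add:
  "poly (hermite_p n) (a + x) = (\<Sum>l\<le>n. of_nat (n choose l) * a ^ (n - l) * poly (hermite_p l) x)"
proof (induction n arbitrary: a)
  case (Suc n)
  define f where "f a = poly (hermite_p (Suc n)) (a + x) -
     (\<Sum>l\<le>Suc n. of_nat (Suc n choose l) * a ^ (Suc n - l) * poly (hermite_p l) x)" for a
  have D: "(f has_field_derivative 0) (at a)" for a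
  proof -
    have 1: "((\<lambda>a. poly (hermite_p (Suc n)) (a + x)) has_field_derivative
          real (Suc n) * poly (hermite_p n) (a + x)) (at a)"
      by (rule derivative_eq_intros refl DERIV_chain2[OF poly_DERIV])+
        (simp only: pderiv_hermite_p, simp)
    have 2: "((\<lambda>a. \<Sum>l\<le>Suc n. of_nat (Suc n choose l) * a ^ (Suc n - l) * poly (hermite_p l) x)
        has_field_derivative
        (\<Sum>l\<le>Suc n. of_nat (Suc n choose l) * (real (Suc n - l) * a ^ (Suc n - l - 1)) *
            poly (hermite_p l) x)) (at a)"
      by (rule derivative_eq_intros refl)+ (intro sum.cong refl, auto simp: Suc_diff_le of_nat_diff)
    have "(\<Sum>l\<le>Suc n. of_nat (Suc n choose l) * (real (Suc n - l) * a ^ (Suc n - l - 1)) *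
            poly (hermite_p l) x) =
          (\<Sum>l\<le>n. of_nat (Suc n choose l) * (real (Suc n - l) * a ^ (n - l)) * poly (hermite_p l) x)"
      by (simp add: Suc_diff_le add_diff_eq)
    also have "\<dots> = (\<Sum>l\<le>n. real (Suc n) * (of_nat (n choose l) * a ^ (n - l) * poly (hermite_p l) x))"
    proof (rule sum.cong[OF refl])
      fix l assume "l \<in> {..n}"
      then have l: "l \<le> n" by simp
      have "(Suc n choose l) * (Suc n - l) = Suc n * (n choose l)"
        using binomial_absorb_comp[of "Suc n" l] by (simp add: mult.commute)
      then have "real (Suc n choose l) * real (Suc n - l) = real (Suc n) * real (n choose l)"
        by (metis of_nat_mult)
      then show "of_nat (Suc n choose l) * (real (Suc n - l) * a ^ (n - l)) * poly (hermite_p l) x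
        = real (Suc n) * (of_nat (n choose l) * a ^ (n - l) * poly (hermite_p l) x)"
        by (metis (no_types, lifting) mult.assoc)
    qed
    also have "\<dots> = real (Suc n) * poly (hermite_p n) (a + x)"
      by (simp only: Suc sum_distrib_left)
    finally show ?thesis
      unfolding f_def using DERIV_diff[OF 1 2] by simp
  qed
  have "f a = f 0" using DERIV_const_ratio_const2[of a 0 f 0] DERIV_isconst_all[of f a 0] D by blast
  also have "f 0 = 0"
  proof -
    have "(\<Sum>l\<le>Suc n. of_nat (Suc n choose l) * (0::real) ^ (Suc n - l) * poly (hermite_p l) x)
      = (\<Sum>l\<in>{Suc n}. of_nat (Suc n choose l) * (0::real) ^ (Suc n - l) * poly (hermite_p l) x)"
      by (rule sum.mono_neutral_right) auto
    then show ?thesis by (simp add: f_def)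
  qed
  finally show ?case by (simp add: f_def)
qed simp

abbreviation stdN :: "real measure" where
  "stdN \<equiv> density lborel std_normal_density"

text \<open>The moment of order \<open>2M\<close> of the standard normal law, that is \<open>(2M - 1)!!\<close>.\<close>
definition normal_mom :: "nat \<Rightarrow> real" where "normal_mom M = fact (2 * M) / (2 ^ M * fact M)"

lemma prob_space_stdN: "prob_space stdN"
  by (rule prob_space_normal_density) simp

lemma integrable_stdN_power: "integrable stdN (\<lambda>x. x ^ n)"
  by (subst integrable_real_density) (auto simp: integrable_std_normal_moment)

lemma integral_stdN_power:
  "(\<integral>x. x ^ n \<partial>stdN) = (if even n then normal_mom (n div 2) else 0)"
proof -
  have "(\<integral>x. x ^ n \<partial>stdN) = (\<integral>x. std_normal_density x * x ^ n \<partial>lborel)"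
    by (subst integral_real_density) auto
  then show ?thesis
    using integral_std_normal_moment_odd[of "n div 2"]
    by (auto simp: normal_mom_def integral_std_normal_moment_even elim!: evenE oddE)
qed

lemma normal_mom_0 [simp]: "normal_mom 0 = 1" by (simp add: normal_mom_def)

lemma normal_mom_Suc: "normal_mom (Suc M) = real (2 * M + 1) * normal_mom M"
proof -
  have "(fact (2 * Suc M) :: real) = 2 * (real M + 1) * (2 * real M + 1) * fact (2 * M)"
    by (simp add: algebra_simps)
  moreover have "(fact (Suc M) :: real) = (real M + 1) * fact M" by simp
  ultimately have "normal_mom (Suc M) = (2 * (real M + 1)) * ((2 * real M + 1) * fact (2 * M)) /
      ((2 * (real M + 1)) * (2 ^ M * fact M))"
    unfolding normal_mom_def by (simp only: power_Suc mult.assoc mult.left_commute mult.commute)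
  also have "\<dots> = (2 * real M + 1) * fact (2 * M) / (2 ^ M * fact M)"
    by (rule mult_divide_mult_cancel_left) simp
  finally show ?thesis by (simp add: normal_mom_def)
qed

lemma normal_mom_pos: "normal_mom M > 0" by (simp add: normal_mom_def)

lemma integrable_stdN_poly: "integrable stdN (poly p)"
  unfolding poly_altdef
  by (intro Bochner_Integration.integrable_sum integrable_mult_right integrable_stdN_power)

lemma integrable_stdN_poly' [simp]: "integrable stdN (\<lambda>x. poly p x)"
  by (rule integrable_stdN_poly)

text \<open>Stein's identity, or integration by parts against the normal weight. On monomials it is the
  recursion \<open>normal_mom_Suc\<close> for the even moments.\<close>
lemma stein:
  "(\<integral>x. x * poly p x \<partial>stdN) = (\<integral>x. poly (pderiv p) x \<partial>stdN)"
proof -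
  have M: "(\<integral>x. x * x ^ n \<partial>stdN) = real n * (\<integral>x. x ^ (n - 1) \<partial>stdN)" for n
  proof -
    have "(\<integral>x. x * x ^ n \<partial>stdN) = (\<integral>x. x ^ Suc n \<partial>stdN)" by simp
    also have "\<dots> = real n * (\<integral>x. x ^ (n - 1) \<partial>stdN)"
    proof (cases "even n")
      case True
      then show ?thesis unfolding integral_stdN_power by (cases n) auto
    next
      case False
      then obtain m where m: "n = 2 * m + 1" by (elim oddE)
      show ?thesis unfolding integral_stdN_power m by (simp add: normal_mom_Suc)
    qed
    finally show ?thesis .
  qed
  have pd: "poly (pderiv p) x = (\<Sum>i\<le>degree p. coeff p i * (real i * x ^ (i - 1)))" for x
  proof -
    have "(poly p has_field_derivative (\<Sum>i\<le>degree p. coeff p i * (real i * x ^ (i - 1)))) (at x)"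
      unfolding poly_altdef
      by (rule derivative_eq_intros refl)+ (intro sum.cong refl, simp)
    then show ?thesis using poly_DERIV[of p x] DERIV_unique by blast
  qed
  have "(\<integral>x. x * poly p x \<partial>stdN) = (\<integral>x. (\<Sum>i\<le>degree p. coeff p i * (x * x ^ i)) \<partial>stdN)"
    by (simp add: poly_altdef sum_distrib_left mult_ac)
  also have "\<dots> = (\<Sum>i\<le>degree p. coeff p i * (\<integral>x. x * x ^ i \<partial>stdN))"
    using integrable_stdN_power[of "Suc _"]
    by (subst Bochner_Integration.integral_sum) (auto intro!: integrable_mult_right)
  also have "\<dots> = (\<Sum>i\<le>degree p. coeff p i * (real i * (\<integral>x. x ^ (i - 1) \<partial>stdN)))"
    by (simp only: M)
  also have "\<dots> = (\<integral>x. poly (pderiv p) x \<partial>stdN)"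
    unfolding pd using integrable_stdN_power
    by (subst Bochner_Integration.integral_sum) (auto intro!: integrable_mult_right)
  finally show ?thesis .
qed

text \<open>By Stein's identity the operator \<open>p \<mapsto> x p - p'\<close>, which builds the Hermite polynomials from
  \<open>1\<close>, is the adjoint of differentiation; so all \<open>n\<close> derivatives end up on \<open>p\<close>.\<close>
lemma integral_mult_hermite:
  "(\<integral>x. poly (p * hermite_p n) x \<partial>stdN) = (\<integral>x. poly ((pderiv ^^ n) p) x \<partial>stdN)"
proof (induction n arbitrary: p)
  case (Suc n)
  have "poly (p * hermite_p (Suc n)) x = x * poly (p * hermite_p n) x - poly (p * pderiv (hermite_p n)) x"
    for x by (simp add: algebra_simps)
  note P = this
  have "(\<integral>x. poly (p * hermite_p (Suc n)) x \<partial>stdN) =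
     (\<integral>x. x * poly (p * hermite_p n) x \<partial>stdN) - (\<integral>x. poly (p * pderiv (hermite_p n)) x \<partial>stdN)"
  proof -
    have "(\<lambda>x. x * poly (p * hermite_p n) x) = poly (pCons 0 (p * hermite_p n))"
      by (simp add: fun_eq_iff)
    then have "integrable stdN (\<lambda>x. x * poly (p * hermite_p n) x)"
      using integrable_stdN_poly by simp
    then show ?thesis
      by (simp only: P)
        (rule Bochner_Integration.integral_diff, simp_all only: integrable_stdN_poly')
  qed
  also have "\<dots> = (\<integral>x. poly (pderiv (p * hermite_p n)) x - poly (p * pderiv (hermite_p n)) x \<partial>stdN)"
    unfolding stein by (subst Bochner_Integration.integral_diff) auto
  also have "\<dots> = (\<integral>x. poly (pderiv p * hermite_p n) x \<partial>stdN)"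
    by (rule Bochner_Integration.integral_cong) (simp_all add: pderiv_mult algebra_simps)
  also have "\<dots> = (\<integral>x. poly ((pderiv ^^ Suc n) p) x \<partial>stdN)"
    unfolding Suc funpow_Suc_right o_def ..
  finally show ?case .
qed simp

lemma funpow_pderiv_hermite: "(pderiv ^^ n) (hermite_p n) = [:fact n:]"
proof (induction n)
  case (Suc n)
  have sm: "(pderiv ^^ n) (Polynomial.smult c p) = Polynomial.smult c ((pderiv ^^ n) p)" for c and p :: "real poly"
    by (induction n) (simp_all add: pderiv_smult)
  have "(pderiv ^^ Suc n) (hermite_p (Suc n)) = (pderiv ^^ n) (pderiv (hermite_p (Suc n)))"
    unfolding funpow_Suc_right o_def ..
  then show ?case unfolding pderiv_hermite_p sm Suc by simp
qed (simp add: one_pCons)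

lemma funpow_pderiv_0: "(pderiv ^^ n) (0::real poly) = 0"
  by (induction n) simp_all

lemma funpow_pderiv_hermite_less: "m < n \<Longrightarrow> (pderiv ^^ n) (hermite_p m) = 0"
proof -
  assume "m < n"
  then obtain j where n: "n = Suc j + m" using less_imp_Suc_add by (metis add.commute add_Suc_right)
  show ?thesis unfolding n funpow_add o_def funpow_pderiv_hermite funpow_Suc_right
    by (simp add: pderiv_pCons funpow_pderiv_0)
qed

lemma hermite_orthogonal:
  "(\<integral>x. poly (hermite_p m) x * poly (hermite_p n) x \<partial>stdN) = (if m = n then fact n else 0)"
proof -
  have C: "poly [:fact n:] = (\<lambda>x::real. fact n)" for n by (simp add: fun_eq_iff)
  have *: "(\<integral>x. poly (hermite_p m) x * poly (hermite_p n) x \<partial>stdN) = (if m = n then fact n else 0)"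
    if "m \<le> n" for m n
    using integral_mult_hermite[of "hermite_p m" n] that
      prob_space.prob_space[OF prob_space_stdN]
    by (cases "m = n") (simp_all add: funpow_pderiv_hermite funpow_pderiv_hermite_less C)
  show ?thesis using *[of m n] *[of n m] by (cases "m \<le> n") (auto simp: mult.commute)
qed

lemma funpow_pderiv_monom: "(pderiv ^^ n) (monom (1::real) n) = [:fact n:]"
proof (induction n)
  case (Suc n)
  have sm: "(pderiv ^^ n) (Polynomial.smult c p) = Polynomial.smult c ((pderiv ^^ n) p)" for c and p :: "real poly"
    by (induction n) (simp_all add: pderiv_smult)
  have "monom (real (Suc n)) n = Polynomial.smult (real (Suc n)) (monom 1 n)" by (simp add: smult_monom)
  then show ?case unfolding funpow_Suc_right o_def pderiv_monom using Suc sm[of "real (Suc n)"]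
    by simp
qed (simp add: monom_0)

text \<open>The Hermite polynomial of degree \<open>n\<close> is orthogonal to lower degrees, and its pairing with the
  monomial of degree \<open>n\<close> is its squared norm. So in degrees up to \<open>n\<close> a monomial and a Hermite
  polynomial pair in the same way; this is what allows \<open>decoupling\<close> to replace one by the other.\<close>
lemma monomial_hermite:
  assumes "m \<le> n"
  shows "(\<integral>x. x ^ m * poly (hermite_p n) x \<partial>stdN) = (if m = n then fact n else 0)"
proof -
  have eq: "(\<integral>x. x ^ m * poly (hermite_p n) x \<partial>stdN) = (\<integral>x. poly ((pderiv ^^ n) (monom 1 m)) x \<partial>stdN)"
    using integral_mult_hermite[of "monom 1 m" n] by (simp add: poly_monom)
  have C: "poly [:fact n:] = (\<lambda>x::real. fact n)" for n by (simp add: fun_eq_iff)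
  show ?thesis
  proof (cases "m = n")
    case True
    then show ?thesis unfolding eq using prob_space.prob_space[OF prob_space_stdN]
      by (simp add: funpow_pderiv_monom C)
  next
    case False
    then obtain j where n: "n = Suc j + m"
      using assms less_imp_Suc_add[of m n] by (metis add.commute add_Suc_right le_neq_implies_less)
    have "(pderiv ^^ n) (monom (1::real) m) = 0"
      unfolding n funpow_add o_def funpow_pderiv_monom funpow_Suc_right
      by (simp add: pderiv_pCons funpow_pderiv_0)
    moreover have "poly (0::real poly) = (\<lambda>x. 0)" by (simp add: fun_eq_iff)
    ultimately show ?thesis unfolding eq using False by simp
  qed
qed

section \<open>Moments of linear and quadratic forms in Gaussian vectors\<close>

abbreviation gauss :: "'i set \<Rightarrow> ('i \<Rightarrow> real) measure" where
  "gauss I \<equiv> PiM I (\<lambda>_. stdN)"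

global_interpretation stdN: prob_space stdN
  by (rule prob_space_stdN)

lemma product_sigma_finite_stdN: "product_sigma_finite (\<lambda>_. stdN)"
  by (simp add: product_sigma_finite_def stdN.sigma_finite_measure_axioms)

lemma prob_space_gauss: "prob_space (gauss I)"
  by (intro prob_space_PiM prob_space_stdN)

lemma measurable_gauss_component [measurable (raw)]:
  assumes "i \<in> I"
  shows "(\<lambda>\<omega>. \<omega> i) \<in> borel_measurable (gauss I)"
proof -
  have "(\<lambda>\<omega>. \<omega> i) \<in> measurable (gauss I) stdN"
    using measurable_component_singleton[OF assms] .
  then show ?thesis by (simp cong: measurable_cong_sets)
qed

lemma indep_gauss_components:
  assumes "I \<noteq> {}"
  shows "prob_space.indep_vars (gauss I) (\<lambda>_. borel) (\<lambda>i \<omega>. \<omega> i) I"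
proof -
  interpret G: prob_space "gauss I" by (rule prob_space_gauss)
  have d: "distr (gauss I) borel (\<lambda>\<omega>. \<omega> i) = stdN" if "i \<in> I" for i
  proof -
    have "distr (gauss I) borel (\<lambda>\<omega>. \<omega> i) = distr (gauss I) stdN (\<lambda>\<omega>. \<omega> i)"
      by (rule distr_cong) auto
    also have "\<dots> = stdN" using that prob_space_stdN by (intro distr_PiM_component) auto
    finally show ?thesis .
  qed
  have "distr (gauss I) (PiM I (\<lambda>_. borel)) (\<lambda>\<omega>. \<lambda>i\<in>I. \<omega> i) = distr (gauss I) (gauss I) (\<lambda>\<omega>. \<omega>)"
  proof (rule distr_cong)
    show "sets (PiM I (\<lambda>_. borel :: real measure)) = sets (gauss I)"
      by (intro sets_PiM_cong) auto
    show "(\<lambda>i\<in>I. \<omega> i) = \<omega>" if "\<omega> \<in> space (gauss I)" for \<omega>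
      using that by (auto simp: space_PiM PiE_def extensional_def restrict_def fun_eq_iff)
  qed simp
  also have "\<dots> = gauss I" by (rule distr_id)
  also have "\<dots> = PiM I (\<lambda>i. distr (gauss I) borel (\<lambda>\<omega>. \<omega> i))"
    by (intro PiM_cong) (auto simp: d)
  finally show ?thesis
    by (subst G.indep_vars_iff_distr_eq_PiM'[OF assms]) auto
qed

lemma distributed_gauss_component:
  assumes "i \<in> I"
  shows "distributed (gauss I) lborel (\<lambda>\<omega>. \<omega> i) std_normal_density"
proof -
  have "distr (gauss I) lborel (\<lambda>\<omega>. \<omega> i) = distr (gauss I) stdN (\<lambda>\<omega>. \<omega> i)"
    by (rule distr_cong) auto
  also have "\<dots> = stdN" using assms prob_space_stdN by (intro distr_PiM_component) auto
  finally show ?thesis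
    unfolding distributed_def using assms by auto
qed

text \<open>A linear form in independent standard normals is a centred normal with variance
  \<open>\<Sum> a\<^sub>i\<^sup>2\<close>. Vanishing coefficients are dropped first, because a degenerate normal has no
  density.\<close>
lemma gauss_linear_moment:
  assumes fin: "finite I"
  shows "(\<integral>\<^sup>+\<omega>. ennreal ((\<Sum>i\<in>I. a i * \<omega> i) ^ (2 * M)) \<partial>gauss I) =
    ennreal (normal_mom M * (\<Sum>i\<in>I. (a i)\<^sup>2) ^ M)"
proof -
  interpret G: prob_space "gauss I" by (rule prob_space_gauss)
  define I' where "I' = {i\<in>I. a i \<noteq> 0}"
  have I': "finite I'" "I' \<subseteq> I" using fin by (auto simp: I'_def)
  have s1: "(\<Sum>i\<in>I. a i * \<omega> i) = (\<Sum>i\<in>I'. a i * \<omega> i)" for \<omega>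
    using fin by (intro sum.mono_neutral_right) (auto simp: I'_def)
  have s2: "(\<Sum>i\<in>I. (a i)\<^sup>2) = (\<Sum>i\<in>I'. (a i)\<^sup>2)"
    using fin by (intro sum.mono_neutral_right) (auto simp: I'_def)
  show ?thesis
  proof (cases "I' = {}")
    case True
    then show ?thesis unfolding s1 s2
      by (cases M) (simp_all add: G.emeasure_space_1)
  next
    case False
    then have ne: "I \<noteq> {}" using I' by auto
    define s where "s = sqrt (\<Sum>i\<in>I'. (a i)\<^sup>2)"
    have ind: "G.indep_vars (\<lambda>_. borel) (\<lambda>i \<omega>. a i * \<omega> i) I'"
    proof -
      have "G.indep_vars (\<lambda>_. borel) (\<lambda>i. (\<lambda>x. a i * x) \<circ> (\<lambda>\<omega>. \<omega> i)) I"
        by (rule G.indep_vars_compose[OF indep_gauss_components[OF ne]]) auto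
      then have "G.indep_vars (\<lambda>_. borel) (\<lambda>i \<omega>. a i * \<omega> i) I"
        by (simp add: o_def)
      then show ?thesis by (rule G.indep_vars_subset[OF _ I'(2)])
    qed
    have "distributed (gauss I) lborel (\<lambda>\<omega>. \<Sum>i\<in>I'. a i * \<omega> i)
        (normal_density (\<Sum>i\<in>I'. 0) (sqrt (\<Sum>i\<in>I'. \<bar>a i\<bar>\<^sup>2)))"
    proof (rule G.sum_indep_normal[OF I'(1) False ind])
      fix i assume i: "i \<in> I'"
      then show "0 < \<bar>a i\<bar>" by (simp add: I'_def)
      have "distributed (gauss I) lborel (\<lambda>\<omega>. 0 + a i * \<omega> i) (normal_density (0 + a i * 0) (\<bar>a i\<bar> * 1))"
        using i I' by (intro G.normal_density_affine) (auto simp: I'_def intro: distributed_gauss_component)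
      then show "distributed (gauss I) lborel (\<lambda>\<omega>. a i * \<omega> i) (normal_density 0 \<bar>a i\<bar>)" by simp
    qed
    then have D: "distributed (gauss I) lborel (\<lambda>\<omega>. \<Sum>i\<in>I'. a i * \<omega> i) (normal_density 0 s)"
      by (simp add: s_def)
    have "(\<Sum>i\<in>I'. (a i)\<^sup>2) > 0"
      by (rule sum_pos[OF I'(1) False]) (simp add: I'_def)
    then have s: "s > 0" unfolding s_def by simp
    have "(\<integral>\<^sup>+\<omega>. ennreal ((\<Sum>i\<in>I'. a i * \<omega> i) ^ (2 * M)) \<partial>gauss I) =
        (\<integral>\<^sup>+x. ennreal (normal_density 0 s x) * ennreal (x ^ (2 * M)) \<partial>lborel)"
      by (rule distributed_nn_integral[OF D, symmetric]) measurable
    also have "\<dots> = (\<integral>\<^sup>+x. ennreal (normal_density 0 s x * (x - 0) ^ (2 * M)) \<partial>lborel)"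
      by (intro nn_integral_cong) (simp add: ennreal_mult')
    also have "\<dots> = ennreal (fact (2 * M) / ((2 / s\<^sup>2) ^ M * fact M))"
      using normal_moment_even[OF s, of 0 M]
      by (intro nn_integral_eq_integral[THEN trans])
         (auto simp: has_bochner_integral_iff integrable_normal_moment[OF s])
    also have "fact (2 * M) / ((2 / s\<^sup>2) ^ M * fact M) = normal_mom M * (s\<^sup>2) ^ M"
      using s by (simp add: normal_mom_def power_divide)
    also have "s\<^sup>2 = (\<Sum>i\<in>I'. (a i)\<^sup>2)" unfolding s_def by (simp add: sum_nonneg)
    finally show ?thesis unfolding s1 s2 .
  qed
qed

lemma normal_mom_pochhammer: "normal_mom M = 2 ^ M * pochhammer (1/2) M"
  by (induction M) (simp_all add: normal_mom_Suc pochhammer_Suc algebra_simps)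

lemma stdN_even_moment: "(\<integral>\<^sup>+x. ennreal (x ^ (2 * M)) \<partial>stdN) = ennreal (normal_mom M)"
  by (subst nn_integral_eq_integral) (auto simp: integrable_stdN_power integral_stdN_power)

lemma pochhammer_nonneg': "(a::real) \<ge> 0 \<Longrightarrow> pochhammer a n \<ge> 0"
  by (induction n) (auto simp: pochhammer_Suc)

lemma ennreal_sum_mult:
  assumes "\<And>l. l \<in> A \<Longrightarrow> c l \<ge> 0" "\<And>l. l \<in> A \<Longrightarrow> d l \<ge> 0"
  shows "ennreal (\<Sum>l\<in>A. c l * d l) = (\<Sum>l\<in>A. ennreal (c l) * ennreal (d l))"
proof -
  have "ennreal (\<Sum>l\<in>A. c l * d l) = (\<Sum>l\<in>A. ennreal (c l * d l))"
    using assms by (intro sum_ennreal[symmetric]) auto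
  also have "\<dots> = (\<Sum>l\<in>A. ennreal (c l) * ennreal (d l))"
    using assms by (intro sum.cong refl ennreal_mult) auto
  finally show ?thesis .
qed

text \<open>The moments of the chi-squared law, by induction on the dimension: the new coordinate enters by
  the binomial theorem, and the sum that results is Vandermonde's identity for rising factorials.\<close>
lemma gauss_norm_moment:
  fixes I :: "'i set"
  assumes "finite I"
  shows "(\<integral>\<^sup>+\<omega>. ennreal ((\<Sum>i\<in>I. (\<omega> i)\<^sup>2) ^ M) \<partial>gauss I) =
    ennreal (2 ^ M * pochhammer (real (card I) / 2) M)"
  using assms
proof (induction I arbitrary: M rule: finite_induct)
  case empty
  interpret G: prob_space "gauss ({} :: 'i set)" by (rule prob_space_gauss)
  have "2 ^ M * pochhammer (real (card ({} :: 'i set)) / 2) M = (0::real) ^ M"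
    by (cases M) (simp_all add: pochhammer_rec)
  moreover have "(\<integral>\<^sup>+\<omega>. ennreal ((\<Sum>i\<in>{}. (\<omega> i)\<^sup>2) ^ M) \<partial>gauss ({} :: 'i set)) =
      ennreal (0 ^ M) * emeasure (gauss {}) (space (gauss ({} :: 'i set)))"
    by (simp only: sum.empty nn_integral_const)
  ultimately show ?case by (simp only: G.emeasure_space_1 mult_1_right)
next
  case (insert i I)
  define n where "n = real (card I) / 2"
  let ?s = "\<lambda>x. \<Sum>j\<in>I. (x j)\<^sup>2"
  define f :: "('i \<Rightarrow> real) \<Rightarrow> ennreal" where
    "f = (\<lambda>\<omega>. ennreal ((\<Sum>j\<in>insert i I. (\<omega> j)\<^sup>2) ^ M))"
  have "(\<integral>\<^sup>+\<omega>. f \<omega> \<partial>gauss (insert i I)) = (\<integral>\<^sup>+x. (\<integral>\<^sup>+y. f (x(i := y)) \<partial>stdN) \<partial>gauss I)"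
    by (rule product_sigma_finite.product_nn_integral_insert
        [OF product_sigma_finite_stdN insert.hyps(1,2)]) (unfold f_def, measurable)
  also have "\<dots> = (\<integral>\<^sup>+x. (\<integral>\<^sup>+y. (\<Sum>l\<le>M. ennreal (of_nat (M choose l) * ?s x ^ (M - l)) * ennreal (y ^ (2 * l))) \<partial>stdN) \<partial>gauss I)"
  proof (intro nn_integral_cong)
    fix x :: "'i \<Rightarrow> real" and y :: real
    have "(\<Sum>j\<in>I. ((x(i := y)) j)\<^sup>2) = ?s x"
      using insert.hyps by (intro sum.cong) auto
    then have "(\<Sum>j\<in>insert i I. ((x(i := y)) j)\<^sup>2) = y\<^sup>2 + ?s x"
      using insert.hyps by simp
    then have "(\<Sum>j\<in>insert i I. ((x(i := y)) j)\<^sup>2) ^ M =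
       (\<Sum>l\<le>M. of_nat (M choose l) * ?s x ^ (M - l) * y ^ (2 * l))"
      by (simp only: binomial_ring power_mult) (simp only: mult_ac)
    then show "f (x(i := y)) =
      (\<Sum>l\<le>M. ennreal (of_nat (M choose l) * ?s x ^ (M - l)) * ennreal (y ^ (2 * l)))"
      by (simp only: f_def) (rule ennreal_sum_mult, auto simp: sum_nonneg)
  qed
  also have "\<dots> = (\<integral>\<^sup>+x. (\<Sum>l\<le>M. ennreal (of_nat (M choose l) * normal_mom l) * ennreal (?s x ^ (M - l))) \<partial>gauss I)"
  proof (intro nn_integral_cong)
    fix x
    have "(\<integral>\<^sup>+y. (\<Sum>l\<le>M. ennreal (of_nat (M choose l) * ?s x ^ (M - l)) * ennreal (y ^ (2 * l))) \<partial>stdN)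
      = (\<Sum>l\<le>M. ennreal (of_nat (M choose l) * ?s x ^ (M - l)) * (\<integral>\<^sup>+y. ennreal (y ^ (2 * l)) \<partial>stdN))"
      by (subst nn_integral_sum) (auto intro!: sum.cong nn_integral_cmult)
    also have "\<dots> = (\<Sum>l\<le>M. ennreal (of_nat (M choose l) * normal_mom l) * ennreal (?s x ^ (M - l)))"
    proof (rule sum.cong[OF refl])
      fix l
      have "ennreal (u * w) * ennreal v = ennreal (u * v) * ennreal w"
        if "u \<ge> 0" "v \<ge> 0" "w \<ge> 0" for u v w :: real
        using that by (simp add: ennreal_mult mult_ac)
      then show "ennreal (of_nat (M choose l) * ?s x ^ (M - l)) * (\<integral>\<^sup>+y. ennreal (y ^ (2 * l)) \<partial>stdN)
        = ennreal (of_nat (M choose l) * normal_mom l) * ennreal (?s x ^ (M - l))"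
        unfolding stdN_even_moment by (simp add: normal_mom_pos less_imp_le sum_nonneg)
    qed
    finally show "(\<integral>\<^sup>+y. (\<Sum>l\<le>M. ennreal (of_nat (M choose l) * ?s x ^ (M - l)) * ennreal (y ^ (2 * l))) \<partial>stdN)
      = (\<Sum>l\<le>M. ennreal (of_nat (M choose l) * normal_mom l) * ennreal (?s x ^ (M - l)))" .
  qed
  also have "\<dots> = (\<Sum>l\<le>M. ennreal (of_nat (M choose l) * normal_mom l) * (\<integral>\<^sup>+x. ennreal (?s x ^ (M - l)) \<partial>gauss I))"
    by (subst nn_integral_sum) (auto intro!: sum.cong nn_integral_cmult)
  also have "\<dots> = (\<Sum>l\<le>M. ennreal (of_nat (M choose l) * normal_mom l * (2 ^ (M - l) * pochhammer n (M - l))))"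
    unfolding insert.IH n_def by (intro sum.cong refl ennreal_mult'[symmetric]) (simp add: normal_mom_pos less_imp_le)
  also have "\<dots> = ennreal (\<Sum>l\<le>M. of_nat (M choose l) * normal_mom l * (2 ^ (M - l) * pochhammer n (M - l)))"
    by (rule sum_ennreal) (simp add: normal_mom_pos less_imp_le n_def pochhammer_nonneg')
  also have "(\<Sum>l\<le>M. of_nat (M choose l) * normal_mom l * (2 ^ (M - l) * pochhammer n (M - l))) =
      (\<Sum>l\<le>M. 2 ^ M * (of_nat (M choose l) * pochhammer (1/2) l * pochhammer n (M - l)))"
  proof (rule sum.cong[OF refl])
    fix l assume "l \<in> {..M}"
    then have "(2::real) ^ M = 2 ^ l * 2 ^ (M - l)" by (simp flip: power_add)
    then show "of_nat (M choose l) * normal_mom l * (2 ^ (M - l) * pochhammer n (M - l)) =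
      2 ^ M * (of_nat (M choose l) * pochhammer (1/2) l * pochhammer n (M - l))"
      unfolding normal_mom_pochhammer by (simp add: mult_ac)
  qed
  also have "\<dots> = 2 ^ M * pochhammer (1/2 + n) M"
    unfolding pochhammer_binomial_sum by (simp add: sum_distrib_left)
  also have "1/2 + n = real (card (insert i I)) / 2"
    using insert.hyps by (simp add: n_def field_simps)
  finally show ?case unfolding f_def .
qed

text \<open>The moment \<open>E \<parallel>g\<parallel>\<^sup>2\<^sup>M\<close> of a standard Gaussian vector in dimension \<open>n\<close>, see
  \<open>gauss_norm_moment\<close>.\<close>
definition chi_mom :: "nat \<Rightarrow> nat \<Rightarrow> real" where
  "chi_mom n M = 2 ^ M * pochhammer (real n / 2) M"

lemma chi_mom_nonneg: "chi_mom n M \<ge> 0"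
  unfolding chi_mom_def by (intro mult_nonneg_nonneg pochhammer_nonneg') auto

lemma chi_mom_le: "chi_mom n M \<le> (real n + 2 * real M) ^ M"
proof -
  have "2 ^ M * pochhammer (real n / 2) M \<le> (real n + 2 * real L) ^ M" if "M \<le> L" for L
    using that
  proof (induction M)
    case (Suc M)
    have "2 ^ Suc M * pochhammer (real n / 2) (Suc M) =
        (2 ^ M * pochhammer (real n / 2) M) * (real n + 2 * real M)"
      by (simp add: pochhammer_Suc algebra_simps)
    also have "\<dots> \<le> (real n + 2 * real L) ^ M * (real n + 2 * real L)"
      using Suc by (intro mult_mono) (auto simp: pochhammer_nonneg')
    finally show ?case by (simp add: mult.commute)
  qed simp
  then show ?thesis by (simp add: chi_mom_def)
qed

lemma fact_le_normal_mom: "fact M \<le> normal_mom M"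
proof (induction M)
  case (Suc M)
  have "(fact (Suc M) :: real) \<le> real (2 * M + 1) * fact M" by simp
  also have "\<dots> \<le> real (2 * M + 1) * normal_mom M" using Suc by (intro mult_left_mono) auto
  finally show ?case by (simp add: normal_mom_Suc)
qed simp

lemma normal_mom_le: "normal_mom M \<le> (2 * real M) ^ M"
proof -
  have "normal_mom M \<le> (2 * real L) ^ M" if "M \<le> L" for L
    using that
  proof (induction M)
    case (Suc M)
    have "normal_mom (Suc M) \<le> (2 * real L) * (2 * real L) ^ M"
      unfolding normal_mom_Suc using Suc by (intro mult_mono) (auto simp: normal_mom_pos less_imp_le)
    then show ?case by simp
  qed simp
  then show ?thesis by simp
qed

text \<open>\<open>M\<^sup>M / M!\<close> is a single term of the series of \<open>e\<^sup>M\<close>, and \<open>e \<le> 3\<close>.\<close>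
lemma power_self_le_fact: "real M ^ M \<le> 3 ^ M * fact M"
proof -
  have "real M ^ M / fact M \<le> (\<Sum>n<Suc M. real M ^ n / fact n)"
    by (rule member_le_sum) auto
  also have "\<dots> \<le> (\<Sum>n. real M ^ n / fact n)"
    using summable_exp[of "real M"]
    by (intro sum_le_suminf) (auto simp: field_simps)
  also have "\<dots> = exp (real M)" by (simp add: exp_def divide_inverse mult.commute)
  also have "\<dots> = exp 1 ^ M" by (simp flip: exp_of_nat_mult)
  also have "\<dots> \<le> 3 ^ M" by (intro power_mono exp_le) simp
  finally show ?thesis by (simp add: field_simps)
qed

text \<open>Once \<open>M\<close> is at least the dimension, both moments are \<open>M\<^sup>M\<close> up to factors exponential in \<open>M\<close>, at
  least as an upper bound for the first and a lower bound for the second; so averaging over Gaussian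
  vectors costs only a constant after taking \<open>M\<close>-th roots.\<close>
lemma chi_mom_le_normal_mom:
  assumes "n \<le> M"
  shows "chi_mom n M \<le> 9 ^ M * normal_mom M"
proof -
  have "chi_mom n M \<le> (real n + 2 * real M) ^ M" by (rule chi_mom_le)
  also have "\<dots> \<le> (3 * real M) ^ M" using assms by (intro power_mono) auto
  also have "\<dots> = 3 ^ M * real M ^ M" by (simp add: power_mult_distrib)
  also have "\<dots> \<le> 3 ^ M * (3 ^ M * normal_mom M)"
    using power_self_le_fact[of M] fact_le_normal_mom[of M]
    by (intro mult_left_mono) (auto intro: order_trans)
  also have "\<dots> = 9 ^ M * normal_mom M" by (simp flip: mult.assoc power_mult_distrib)
  finally show ?thesis .
qed

section \<open>Operator norms from Gaussian averages\<close>

text \<open>A substitute for the operator norm of \<open>X\<close> to the power \<open>2M\<close>. Unlike the norm it is an average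
  of powers of forms that are linear in \<open>X\<close>, so its expectation for random \<open>X\<close> can be computed.\<close>
definition bilin_mom :: "nat \<Rightarrow> 'i set \<Rightarrow> 'j set \<Rightarrow> ('i \<Rightarrow> 'j \<Rightarrow> real) \<Rightarrow> ennreal" where
  "bilin_mom M I J X =
     (\<integral>\<^sup>+g. \<integral>\<^sup>+h. ennreal ((\<Sum>i\<in>I. \<Sum>j\<in>J. g i * X i j * h j) ^ (2 * M)) \<partial>gauss J \<partial>gauss I)"

text \<open>By \<open>gauss_linear_moment\<close>, \<open>normal_mom M \<parallel>X v\<parallel>\<^sup>2\<^sup>M\<close> is the average of
  \<open>(g\<^sup>T X v)\<^sup>2\<^sup>M\<close> over \<open>g\<close>; Cauchy-Schwarz separates \<open>v\<close> from \<open>X\<^sup>T g\<close>, and the same identity turns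
  \<open>normal_mom M \<parallel>X\<^sup>T g\<parallel>\<^sup>2\<^sup>M\<close> into an average over \<open>h\<close>.\<close>
lemma operator_norm_le_bilin_mom:
  fixes X :: "'i \<Rightarrow> 'j \<Rightarrow> real"
  assumes fin: "finite I" "finite J"
  shows "ennreal ((normal_mom M)\<^sup>2 * (\<Sum>i\<in>I. (\<Sum>j\<in>J. X i j * v j)\<^sup>2) ^ M) \<le>
    ennreal ((\<Sum>j\<in>J. (v j)\<^sup>2) ^ M) * bilin_mom M I J X"
proof -
  let ?c = "\<lambda>g j. \<Sum>i\<in>I. g i * X i j" and ?V = "\<Sum>j\<in>J. (v j)\<^sup>2"
  have m0: "normal_mom M \<ge> 0" using normal_mom_pos[of M] by simp
  have "ennreal ((normal_mom M)\<^sup>2 * (\<Sum>i\<in>I. (\<Sum>j\<in>J. X i j * v j)\<^sup>2) ^ M) =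
      ennreal (normal_mom M) * (\<integral>\<^sup>+g. ennreal ((\<Sum>i\<in>I. (\<Sum>j\<in>J. X i j * v j) * g i) ^ (2 * M)) \<partial>gauss I)"
    unfolding gauss_linear_moment[OF fin(1)]
    using m0 by (subst ennreal_mult'[symmetric]) (auto simp: power2_eq_square mult.assoc)
  also have "\<dots> = (\<integral>\<^sup>+g. ennreal (normal_mom M) * ennreal ((\<Sum>i\<in>I. (\<Sum>j\<in>J. X i j * v j) * g i) ^ (2 * M)) \<partial>gauss I)"
    by (rule nn_integral_cmult[symmetric]) measurable
  also have "\<dots> \<le> (\<integral>\<^sup>+g. ennreal (?V ^ M) * ennreal (normal_mom M * (\<Sum>j\<in>J. (?c g j)\<^sup>2) ^ M) \<partial>gauss I)"
  proof (rule nn_integral_mono)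
    fix g
    have "(\<Sum>i\<in>I. (\<Sum>j\<in>J. X i j * v j) * g i) = (\<Sum>j\<in>J. v j * ?c g j)"
      unfolding sum_distrib_left sum_distrib_right by (subst sum.swap) (simp add: mult_ac)
    moreover have "(\<Sum>j\<in>J. v j * ?c g j)\<^sup>2 \<le> ?V * (\<Sum>j\<in>J. (?c g j)\<^sup>2)"
      by (rule Cauchy_Schwarz_ineq_sum)
    ultimately have "(\<Sum>i\<in>I. (\<Sum>j\<in>J. X i j * v j) * g i) ^ (2 * M) \<le> (?V * (\<Sum>j\<in>J. (?c g j)\<^sup>2)) ^ M"
      by (simp add: power_mult power_mono)
    then have "normal_mom M * (\<Sum>i\<in>I. (\<Sum>j\<in>J. X i j * v j) * g i) ^ (2 * M)
        \<le> ?V ^ M * (normal_mom M * (\<Sum>j\<in>J. (?c g j)\<^sup>2) ^ M)"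
      using mult_left_mono[OF _ m0] by (metis (no_types, lifting) power_mult_distrib mult.left_commute)
    then show "ennreal (normal_mom M) * ennreal ((\<Sum>i\<in>I. (\<Sum>j\<in>J. X i j * v j) * g i) ^ (2 * M))
        \<le> ennreal (?V ^ M) * ennreal (normal_mom M * (\<Sum>j\<in>J. (?c g j)\<^sup>2) ^ M)"
      using m0
      by (subst ennreal_mult'[symmetric], simp, subst ennreal_mult'[symmetric])
         (auto intro!: ennreal_leI zero_le_power sum_nonneg zero_le_power2)
  qed
  also have "\<dots> = ennreal (?V ^ M) * (\<integral>\<^sup>+g. ennreal (normal_mom M * (\<Sum>j\<in>J. (?c g j)\<^sup>2) ^ M) \<partial>gauss I)"
    by (rule nn_integral_cmult) measurable
  also have "(\<integral>\<^sup>+g. ennreal (normal_mom M * (\<Sum>j\<in>J. (?c g j)\<^sup>2) ^ M) \<partial>gauss I) = bilin_mom M I J X"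
    unfolding bilin_mom_def gauss_linear_moment[OF fin(2), symmetric]
    by (intro nn_integral_cong, subst sum.swap) (simp add: sum_distrib_right)
  finally show ?thesis .
qed

text \<open>The preceding estimate after taking \<open>M\<close>-th roots, for an average that is at most \<open>t\<^sup>M\<close> in the
  units \<open>normal_mom\<^sup>2 K\<^sup>M\<close> in which it is later shown to have expectation at most \<open>1\<close>.\<close>
lemma operator_norm_from_bilin_mom:
  assumes fin: "finite I" "finite J" and K: "K > 0" and t: "t \<ge> 0" and M: "M > 0"
    and le: "bilin_mom M I J X * ennreal (1 / ((normal_mom M)\<^sup>2 * K ^ M)) \<le> ennreal (t ^ M)"
  shows "(\<Sum>i\<in>I. (\<Sum>j\<in>J. X i j * v j)\<^sup>2) \<le> K * t * (\<Sum>j\<in>J. (v j)\<^sup>2)"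
proof -
  let ?a = "\<Sum>i\<in>I. (\<Sum>j\<in>J. X i j * v j)\<^sup>2" and ?V = "\<Sum>j\<in>J. (v j)\<^sup>2"
  let ?g = "(normal_mom M)\<^sup>2 * K ^ M"
  have g: "?g > 0" using K normal_mom_pos[of M] by simp
  have V: "?V \<ge> 0" by (intro sum_nonneg) auto
  have "bilin_mom M I J X = bilin_mom M I J X * ennreal (1 / ?g) * ennreal ?g"
  proof -
    have "ennreal (1 / x) * ennreal x = 1" if "x > 0" for x
      using that by (subst ennreal_mult[symmetric]) auto
    from this[OF g] show ?thesis by (simp add: mult.assoc)
  qed
  also have "\<dots> \<le> ennreal (t ^ M) * ennreal ?g" by (rule mult_right_mono[OF le]) simp
  finally have b: "bilin_mom M I J X \<le> ennreal (t ^ M * ?g)"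
    using t g by (subst ennreal_mult) auto
  have "ennreal ((normal_mom M)\<^sup>2 * ?a ^ M) \<le> ennreal (?V ^ M) * bilin_mom M I J X"
    by (rule operator_norm_le_bilin_mom[OF fin])
  also have "\<dots> \<le> ennreal (?V ^ M) * ennreal (t ^ M * ?g)" by (rule mult_left_mono[OF b]) simp
  also have "\<dots> = ennreal (?V ^ M * (t ^ M * ?g))"
    using V t g by (intro ennreal_mult[symmetric]) auto
  finally have "(normal_mom M)\<^sup>2 * ?a ^ M \<le> ?V ^ M * (t ^ M * ?g)"
    using V t g by (subst (asm) ennreal_le_iff) (auto intro!: mult_nonneg_nonneg)
  also have "\<dots> = (normal_mom M)\<^sup>2 * (K * t * ?V) ^ M" by (simp add: power_mult_distrib mult_ac)
  finally have "?a ^ M \<le> (K * t * ?V) ^ M"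
    using normal_mom_pos[of M] by simp
  then show ?thesis
    using M V K t by (rule_tac power_le_imp_le_base[of _ "M - 1"]) auto
qed

section \<open>A noncommutative Hoelder inequality\<close>

definition mtrace :: "real mat \<Rightarrow> real" where
  "mtrace A = (\<Sum>i<dim_row A. A $$ (i, i))"

definition frob_inner :: "real mat \<Rightarrow> real mat \<Rightarrow> real" where
  "frob_inner A B = (\<Sum>(i, j)\<in>{..<dim_row A} \<times> {..<dim_col A}. A $$ (i, j) * B $$ (i, j))"

definition frob_sq :: "real mat \<Rightarrow> real" where
  "frob_sq A = (\<Sum>(i, j)\<in>{..<dim_row A} \<times> {..<dim_col A}. (A $$ (i, j))\<^sup>2)"

lemma frob_sq_nonneg: "frob_sq A \<ge> 0"
  unfolding frob_sq_def by (intro sum_nonneg) auto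

lemma frob_sq_inner: "frob_sq A = frob_inner A A"
  by (simp add: frob_sq_def frob_inner_def power2_eq_square)

lemma index_mult_mat_sum:
  assumes "A \<in> carrier_mat m n" "B \<in> carrier_mat n l" "i < m" "j < l"
  shows "(A * B) $$ (i, j) = (\<Sum>k<n. A $$ (i, k) * B $$ (k, j))"
  using assms by (auto simp: scalar_prod_def atLeast0LessThan intro!: sum.cong)

lemma mtrace_mult:
  assumes "A \<in> carrier_mat m n" "B \<in> carrier_mat n m"
  shows "mtrace (A * B) = (\<Sum>i<m. \<Sum>k<n. A $$ (i, k) * B $$ (k, i))"
  using assms unfolding mtrace_def
  by (intro sum.cong index_mult_mat_sum) auto

lemma mtrace_comm:
  assumes "A \<in> carrier_mat m n" "B \<in> carrier_mat n m"
  shows "mtrace (A * B) = mtrace (B * A)"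
  unfolding mtrace_mult[OF assms] mtrace_mult[OF assms(2,1)]
  by (subst sum.swap) (simp add: mult.commute)

lemma mtrace_transpose: "A \<in> carrier_mat n n \<Longrightarrow> mtrace A\<^sup>T = mtrace A"
  by (simp add: mtrace_def)

lemma frob_inner_mtrace:
  assumes "A \<in> carrier_mat m n" "B \<in> carrier_mat m n"
  shows "frob_inner A B = mtrace (A\<^sup>T * B)"
proof -
  have "mtrace (A\<^sup>T * B) = (\<Sum>i<n. \<Sum>k<m. A $$ (k, i) * B $$ (k, i))"
    using assms by (subst mtrace_mult[of _ n m]) auto
  also have "\<dots> = (\<Sum>k<m. \<Sum>i<n. A $$ (k, i) * B $$ (k, i))"
    by (rule sum.swap)
  finally show ?thesis using assms by (auto simp: frob_inner_def sum.cartesian_product)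
qed

lemma frob_inner_cauchy: 
  assumes "A \<in> carrier_mat m n" "B \<in> carrier_mat m n"
  shows "(frob_inner A B)\<^sup>2 \<le> frob_sq A * frob_sq B"
  using Cauchy_Schwarz_ineq_sum[of "\<lambda>p. A $$ p" "\<lambda>p. B $$ p" "{..<m} \<times> {..<n}"] assms
  by (auto simp: frob_inner_def frob_sq_def case_prod_unfold)

text \<open>Up to cyclic permutation under the trace, \<open>(PTQ)\<^sup>T (PTQ)\<close> is the product of
  \<open>(T Q Q\<^sup>T)\<^sup>T\<close> and \<open>P\<^sup>T P T\<close>: the same cyclic word is cut at two other places. Cauchy-Schwarz for
  the Frobenius inner product then separates the two halves.\<close>
lemma frob_sq_sandwich:
  assumes P: "P \<in> carrier_mat n n" and T: "T \<in> carrier_mat n n" and Q: "Q \<in> carrier_mat n n"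
  shows "(frob_sq (P * T * Q))\<^sup>2 \<le> frob_sq (P\<^sup>T * (P * T)) * frob_sq (T * (Q * Q\<^sup>T))"
proof -
  note c = P T Q
  have "frob_sq (P * T * Q) = mtrace ((P * T * Q)\<^sup>T * (P * T * Q))"
    using c by (simp add: frob_sq_inner frob_inner_mtrace[of _ n n])
  also have "(P * T * Q)\<^sup>T = Q\<^sup>T * (T\<^sup>T * P\<^sup>T)"
    using c by (simp add: transpose_mult[of _ n n _ n])
  also have "Q\<^sup>T * (T\<^sup>T * P\<^sup>T) * (P * T * Q) = Q\<^sup>T * (T\<^sup>T * (P\<^sup>T * (P * T)) * Q)"
    using c by (simp add: assoc_mult_mat[of _ n n _ n _ n])
  also have "mtrace \<dots> = mtrace (T\<^sup>T * (P\<^sup>T * (P * T)) * Q * Q\<^sup>T)"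
    using c by (intro mtrace_comm[of _ n n]) auto
  also have "T\<^sup>T * (P\<^sup>T * (P * T)) * Q * Q\<^sup>T = T\<^sup>T * (P\<^sup>T * (P * T) * (Q * Q\<^sup>T))"
    using c by (simp add: assoc_mult_mat[of _ n n _ n _ n])
  also have "mtrace \<dots> = mtrace (P\<^sup>T * (P * T) * (Q * Q\<^sup>T) * T\<^sup>T)"
    using c by (intro mtrace_comm[of _ n n]) auto
  also have "P\<^sup>T * (P * T) * (Q * Q\<^sup>T) * T\<^sup>T = P\<^sup>T * (P * T) * (Q * Q\<^sup>T * T\<^sup>T)"
    using c by (intro assoc_mult_mat[of _ n n _ n _ n]) auto
  also have "mtrace \<dots> = mtrace (Q * Q\<^sup>T * T\<^sup>T * (P\<^sup>T * (P * T)))"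
    using c by (intro mtrace_comm[of _ n n]) auto
  also have "Q * Q\<^sup>T * T\<^sup>T = (T * (Q * Q\<^sup>T))\<^sup>T"
    using c by (simp add: transpose_mult[of _ n n _ n])
  also have "mtrace ((T * (Q * Q\<^sup>T))\<^sup>T * (P\<^sup>T * (P * T))) = frob_inner (T * (Q * Q\<^sup>T)) (P\<^sup>T * (P * T))"
    using c by (intro frob_inner_mtrace[of _ n n, symmetric]) auto
  finally have "frob_sq (P * T * Q) = frob_inner (T * (Q * Q\<^sup>T)) (P\<^sup>T * (P * T))" .
  then show ?thesis
    using frob_inner_cauchy[of "T * (Q * Q\<^sup>T)" n n "P\<^sup>T * (P * T)"] c
    by (simp add: mult.commute)
qed

definition opnorm_sq_le :: "nat \<Rightarrow> real \<Rightarrow> real mat \<Rightarrow> bool" where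
  "opnorm_sq_le n c X \<longleftrightarrow> X \<in> carrier_mat n n \<and> c \<ge> 0 \<and>
     (\<forall>v::nat \<Rightarrow> real. (\<Sum>i<n. (\<Sum>j<n. X $$ (i, j) * v j)\<^sup>2) \<le> c * (\<Sum>j<n. (v j)\<^sup>2))"

lemma opnorm_sq_le_mono: "opnorm_sq_le n c X \<Longrightarrow> c \<le> d \<Longrightarrow> opnorm_sq_le n d X"
  unfolding opnorm_sq_le_def
  by (meson mult_right_mono order_trans sum_nonneg zero_le_power2)

lemma opnorm_sq_leI:
  assumes X: "X \<in> carrier_mat n n" and c: "c \<ge> 0"
    and x: "\<And>i j. i < n \<Longrightarrow> j < n \<Longrightarrow> X $$ (i, j) = x i j"
    and le: "\<And>v. (\<Sum>i<n. (\<Sum>j<n. x i j * v j)\<^sup>2) \<le> c * (\<Sum>j<n. (v j)\<^sup>2)"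
  shows "opnorm_sq_le n c X"
proof -
  have "(\<Sum>i<n. (\<Sum>j<n. X $$ (i, j) * v j)\<^sup>2) = (\<Sum>i<n. (\<Sum>j<n. x i j * v j)\<^sup>2)" for v
    by (intro sum.cong refl arg_cong[where f = "\<lambda>z. z\<^sup>2"]) (use x in auto)
  then show ?thesis using X c le unfolding opnorm_sq_le_def by simp
qed

lemma frob_sq_sum: "frob_sq A = (\<Sum>i<dim_row A. \<Sum>j<dim_col A. (A $$ (i, j))\<^sup>2)"
  unfolding frob_sq_def by (rule sum.cartesian_product[symmetric])

lemma frob_sq_mult_left:
  assumes X: "X \<in> carrier_mat m n" and "c \<ge> 0"
    and op: "\<And>v. (\<Sum>i<m. (\<Sum>j<n. X $$ (i, j) * v j)\<^sup>2) \<le> c * (\<Sum>j<n. (v j)\<^sup>2)"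
    and G: "G \<in> carrier_mat n l"
  shows "frob_sq (X * G) \<le> c * frob_sq G"
proof -
  have "frob_sq (X * G) = (\<Sum>i<m. \<Sum>j<l. (\<Sum>k<n. X $$ (i, k) * G $$ (k, j))\<^sup>2)"
    using X G unfolding frob_sq_sum
    by (auto simp: index_mult_mat_sum[OF X G] simp del: index_mult_mat(1) intro!: sum.cong)
  also have "\<dots> = (\<Sum>j<l. \<Sum>i<m. (\<Sum>k<n. X $$ (i, k) * G $$ (k, j))\<^sup>2)" by (rule sum.swap)
  also have "\<dots> \<le> (\<Sum>j<l. c * (\<Sum>k<n. (G $$ (k, j))\<^sup>2))"
    by (intro sum_mono op)
  also have "\<dots> = c * (\<Sum>k<n. \<Sum>j<l. (G $$ (k, j))\<^sup>2)"
    by (subst sum.swap) (simp add: sum_distrib_left)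
  also have "\<dots> = c * frob_sq G"
    using G by (simp add: frob_sq_sum)
  finally show ?thesis .
qed

lemma frob_sq_transpose: "frob_sq A\<^sup>T = frob_sq A"
proof -
  have "frob_sq A\<^sup>T = (\<Sum>i<dim_col A. \<Sum>j<dim_row A. (A $$ (j, i))\<^sup>2)"
    by (simp add: frob_sq_sum)
  also have "\<dots> = frob_sq A" unfolding frob_sq_sum by (rule sum.swap)
  finally show ?thesis .
qed

text \<open>With \<open>w = X\<^sup>T v\<close> one has \<open>\<parallel>w\<parallel>\<^sup>2 = \<langle>v, X w\<rangle>\<close>, and Cauchy-Schwarz bounds the square of this by
  \<open>\<parallel>v\<parallel>\<^sup>2 c \<parallel>w\<parallel>\<^sup>2\<close>.\<close>
lemma opnorm_sq_le_transpose:
  assumes "opnorm_sq_le n c X"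
  shows "opnorm_sq_le n c X\<^sup>T"
proof -
  have X: "X \<in> carrier_mat n n" and c: "c \<ge> 0"
    and op: "\<And>v. (\<Sum>i<n. (\<Sum>j<n. X $$ (i, j) * v j)\<^sup>2) \<le> c * (\<Sum>j<n. (v j)\<^sup>2)"
    using assms by (auto simp: opnorm_sq_le_def)
  have "(\<Sum>i<n. (\<Sum>j<n. X\<^sup>T $$ (i, j) * v j)\<^sup>2) \<le> c * (\<Sum>j<n. (v j)\<^sup>2)" for v :: "nat \<Rightarrow> real"
  proof -
    define w where "w i = (\<Sum>j<n. X $$ (j, i) * v j)" for i
    have w: "(\<Sum>i<n. (\<Sum>j<n. X\<^sup>T $$ (i, j) * v j)\<^sup>2) = (\<Sum>i<n. (w i)\<^sup>2)"
      using X by (auto simp: w_def intro!: sum.cong)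
    have "(\<Sum>i<n. (w i)\<^sup>2) = (\<Sum>i<n. w i * (\<Sum>j<n. X $$ (j, i) * v j))"
      by (simp add: w_def power2_eq_square)
    also have "\<dots> = (\<Sum>i<n. \<Sum>j<n. w i * X $$ (j, i) * v j)"
      by (simp add: sum_distrib_left mult.assoc)
    also have "\<dots> = (\<Sum>j<n. \<Sum>i<n. w i * X $$ (j, i) * v j)"
      by (rule sum.swap)
    also have "\<dots> = (\<Sum>j<n. v j * (\<Sum>i<n. X $$ (j, i) * w i))"
      by (simp add: sum_distrib_left mult_ac)
    finally have eq: "(\<Sum>i<n. (w i)\<^sup>2) = (\<Sum>j<n. v j * (\<Sum>i<n. X $$ (j, i) * w i))" .
    have "(\<Sum>i<n. (w i)\<^sup>2)\<^sup>2 \<le> (\<Sum>j<n. (v j)\<^sup>2) * (\<Sum>j<n. (\<Sum>i<n. X $$ (j, i) * w i)\<^sup>2)"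
      unfolding eq by (rule Cauchy_Schwarz_ineq_sum)
    also have "\<dots> \<le> (\<Sum>j<n. (v j)\<^sup>2) * (c * (\<Sum>i<n. (w i)\<^sup>2))"
      by (intro mult_left_mono op sum_nonneg) auto
    finally have le: "(\<Sum>i<n. (w i)\<^sup>2) * (\<Sum>i<n. (w i)\<^sup>2) \<le> (c * (\<Sum>j<n. (v j)\<^sup>2)) * (\<Sum>i<n. (w i)\<^sup>2)"
      by (simp add: power2_eq_square mult_ac)
    have "(\<Sum>i<n. (w i)\<^sup>2) \<ge> 0" by (intro sum_nonneg) auto
    then consider "(\<Sum>i<n. (w i)\<^sup>2) = 0" | "(\<Sum>i<n. (w i)\<^sup>2) > 0" by linarith
    then have "(\<Sum>i<n. (w i)\<^sup>2) \<le> c * (\<Sum>j<n. (v j)\<^sup>2)"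
    proof cases
      case 1
      then show ?thesis using c by (simp add: sum_nonneg)
    next
      case 2
      then show ?thesis using le mult_right_le_imp_le by blast
    qed
    then show ?thesis unfolding w .
  qed
  then show ?thesis using X c by (simp add: opnorm_sq_le_def)
qed

lemma frob_sq_mult_left':
  assumes "opnorm_sq_le n c X" "G \<in> carrier_mat n l"
  shows "frob_sq (X * G) \<le> c * frob_sq G"
  using assms by (intro frob_sq_mult_left[where m = n and n = n]) (auto simp: opnorm_sq_le_def)

lemma frob_sq_mult_right:
  assumes X: "opnorm_sq_le n c X" and G: "G \<in> carrier_mat l n"
  shows "frob_sq (G * X) \<le> c * frob_sq G"
proof -
  have "X \<in> carrier_mat n n" using X by (simp add: opnorm_sq_le_def)
  then have "frob_sq (G * X) = frob_sq (X\<^sup>T * G\<^sup>T)"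
    using G frob_sq_transpose[of "G * X"] by (simp add: transpose_mult[of G l n X n])
  also have "\<dots> \<le> c * frob_sq G\<^sup>T"
    using opnorm_sq_le_transpose[OF X] G by (intro frob_sq_mult_left') auto
  finally show ?thesis by (simp add: frob_sq_transpose)
qed

text \<open>A word has two kinds of letters: \<open>None\<close> stands for \<open>R\<close> or \<open>R\<^sup>T\<close>, and \<open>Some (X, c)\<close> for a
  matrix \<open>X\<close> whose squared operator norm is meant to be at most \<open>c\<close>. Whether \<open>None\<close> means \<open>R\<close> or
  \<open>R\<^sup>T\<close> depends on the parity of its position; the flag says which of them the first position has.
  Letters of the second kind also use up a position.\<close>
fun word_prod :: "nat \<Rightarrow> real mat \<Rightarrow> bool \<Rightarrow> (real mat \<times> real) option list \<Rightarrow> real mat" where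
  "word_prod n R b [] = 1\<^sub>m n"
| "word_prod n R b (None # xs) = (if b then R else R\<^sup>T) * word_prod n R (\<not> b) xs"
| "word_prod n R b (Some (X, c) # xs) = X * word_prod n R (\<not> b) xs"

definition word_ok :: "nat \<Rightarrow> (real mat \<times> real) option list \<Rightarrow> bool" where
  "word_ok n xs \<longleftrightarrow> (\<forall>X c. Some (X, c) \<in> set xs \<longrightarrow> opnorm_sq_le n c X)"

fun word_cost :: "(real mat \<times> real) option list \<Rightarrow> real" where
  "word_cost [] = 1"
| "word_cost (None # xs) = word_cost xs"
| "word_cost (Some (X, c) # xs) = c * word_cost xs"

definition num_signal :: "(real mat \<times> real) option list \<Rightarrow> nat" where
  "num_signal xs = length (filter (\<lambda>x. x = None) xs)"

definition num_noise :: "(real mat \<times> real) option list \<Rightarrow> nat" where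
  "num_noise xs = length (filter (\<lambda>x. x \<noteq> None) xs)"

lemma word_cost_append: "word_cost (xs @ ys) = word_cost xs * word_cost ys"
  by (induction xs rule: word_cost.induct) auto

lemma word_cost_replicate [simp]: "word_cost (replicate a None) = 1"
  by (induction a) auto

lemma num_signal_simps [simp]:
  "num_signal [] = 0" "num_signal (None # xs) = Suc (num_signal xs)"
  "num_signal (Some x # xs) = num_signal xs"
  "num_signal (xs @ ys) = num_signal xs + num_signal ys"
  "num_signal (replicate a None) = a"
  by (simp_all add: num_signal_def)

lemma num_noise_simps [simp]:
  "num_noise [] = 0" "num_noise (None # xs) = num_noise xs"
  "num_noise (Some x # xs) = Suc (num_noise xs)"
  "num_noise (xs @ ys) = num_noise xs + num_noise ys"
  "num_noise (replicate a None) = 0"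
  by (simp_all add: num_noise_def)

lemma word_ok_simps [simp]:
  "word_ok n []" "word_ok n (None # xs) \<longleftrightarrow> word_ok n xs"
  "word_ok n (Some (X, c) # xs) \<longleftrightarrow> opnorm_sq_le n c X \<and> word_ok n xs"
  "word_ok n (xs @ ys) \<longleftrightarrow> word_ok n xs \<and> word_ok n ys"
  "word_ok n (replicate a None)"
  by (auto simp: word_ok_def)

lemma word_prod_carrier:
  "R \<in> carrier_mat n n \<Longrightarrow> word_ok n xs \<Longrightarrow> word_prod n R b xs \<in> carrier_mat n n"
  by (induction n R b xs rule: word_prod.induct) (auto simp: opnorm_sq_le_def)

lemma word_prod_append:
  assumes "R \<in> carrier_mat n n" "word_ok n (xs @ ys)"
  shows "word_prod n R b (xs @ ys) =
    word_prod n R b xs * word_prod n R (if even (length xs) then b else \<not> b) ys"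
  using assms
proof (induction n R b xs rule: word_prod.induct)
  case (1 n R b)
  then show ?case using word_prod_carrier[of R n ys b] by simp
next
  case (2 n R b xs)
  note c = word_prod_carrier[of R n xs] word_prod_carrier[of R n ys]
  from 2 c show ?case
    by (auto simp: assoc_mult_mat[of _ n n _ n _ n])
next
  case (3 n R b X c xs)
  note c = word_prod_carrier[of R n xs] word_prod_carrier[of R n ys]
  from 3 c show ?case
    by (auto simp: assoc_mult_mat[of X n n _ n _ n] opnorm_sq_le_def)
qed

lemma pow_mat_conj:
  assumes L: "L \<in> carrier_mat n n"
  shows "L\<^sup>T * ((L * L\<^sup>T) ^\<^sub>m a) * L = (L\<^sup>T * L) ^\<^sub>m (Suc a)"
proof (induction a)
  case (Suc a)
  have "L\<^sup>T * (M * (L * L\<^sup>T)) * L = L\<^sup>T * M * L * (L\<^sup>T * L)" if "M \<in> carrier_mat n n" for M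
    using L that by (simp add: assoc_mult_mat[of _ n n _ n _ n])
  moreover have "(L * L\<^sup>T) ^\<^sub>m a \<in> carrier_mat n n" using L by auto
  ultimately have "L\<^sup>T * ((L * L\<^sup>T) ^\<^sub>m (Suc a)) * L = L\<^sup>T * ((L * L\<^sup>T) ^\<^sub>m a) * L * (L\<^sup>T * L)"
    by (simp only: pow_mat.simps)
  then show ?case unfolding Suc by simp
qed (use L in simp)

text \<open>In \<open>w\<^sup>T w\<close> the alternating letters \<open>R\<close> and \<open>R\<^sup>T\<close> meet from the middle outwards, so the product is
  a power of \<open>R\<^sup>T R\<close> or of \<open>R R\<^sup>T\<close>; both have the same trace.\<close>
lemma frob_sq_word_signal:
  assumes R: "R \<in> carrier_mat n n"
  shows "frob_sq (word_prod n R b (replicate a None)) = mtrace ((R\<^sup>T * R) ^\<^sub>m a)"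
proof -
  define L where "L b = (if b then R else R\<^sup>T)" for b
  define e where "e a = (if even a then b else \<not> b)" for a :: nat
  have L: "L b \<in> carrier_mat n n" for b using R by (auto simp: L_def)
  have LT: "(L b)\<^sup>T = L (\<not> b)" for b by (simp add: L_def)
  have w: "(word_prod n R b (replicate a None))\<^sup>T * word_prod n R b (replicate a None) =
      ((L (e a)) * (L (e a))\<^sup>T) ^\<^sub>m a"
  proof (induction a)
    case (Suc a)
    let ?w = "word_prod n R b (replicate a None)"
    have wc: "?w \<in> carrier_mat n n" using R by (intro word_prod_carrier) auto
    have "replicate (Suc a) (None :: (real mat \<times> real) option) = replicate a None @ [None]"
      by (simp add: replicate_append_same)
    then have "word_prod n R b (replicate (Suc a) None) = ?w * L (e a)"
      using R L by (simp only:, subst word_prod_append) (auto simp: e_def L_def)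
    then have "(word_prod n R b (replicate (Suc a) None))\<^sup>T * word_prod n R b (replicate (Suc a) None)
       = (L (e a))\<^sup>T * (?w\<^sup>T * ?w) * L (e a)"
      using wc L[of "e a"] by (simp add: transpose_mult[of _ n n _ n] assoc_mult_mat[of _ n n _ n _ n])
    also have "\<dots> = ((L (e a))\<^sup>T * L (e a)) ^\<^sub>m (Suc a)"
      unfolding Suc by (rule pow_mat_conj[OF L])
    also have "(L (e a))\<^sup>T * L (e a) = L (e (Suc a)) * (L (e (Suc a)))\<^sup>T"
      by (simp add: LT e_def)
    finally show ?case .
  qed (use R L[of "e 0"] in simp)
  have tr: "mtrace ((R * R\<^sup>T) ^\<^sub>m a) = mtrace ((R\<^sup>T * R) ^\<^sub>m a)" for a
  proof (cases a)
    case (Suc a')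
    define M where "M = (R\<^sup>T * R) ^\<^sub>m a'"
    have c: "M \<in> carrier_mat n n" using R by (auto simp: M_def)
    have "(R * R\<^sup>T) ^\<^sub>m a = R * M * R\<^sup>T"
      using pow_mat_conj[of "R\<^sup>T" n a'] R Suc by (simp add: M_def)
    also have "mtrace \<dots> = mtrace (R\<^sup>T * (R * M))"
      using R c by (intro mtrace_comm[of _ n n]) auto
    also have "R\<^sup>T * (R * M) = (R\<^sup>T * R) * M"
      using R c by (simp add: assoc_mult_mat[of _ n n _ n _ n])
    also have "mtrace \<dots> = mtrace (M * (R\<^sup>T * R))"
      using R c by (intro mtrace_comm[of _ n n]) auto
    finally show ?thesis by (simp add: Suc M_def)
  qed (use R in simp)
  have wc: "word_prod n R b (replicate a None) \<in> carrier_mat n n"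
    using R by (intro word_prod_carrier) auto
  show ?thesis
    unfolding frob_sq_inner frob_inner_mtrace[OF wc wc] w
    by (cases "e a") (simp_all add: L_def tr)
qed

text \<open>At the first point where the maximum is attained the inequality \<open>lc\<close> would force the value
  before it to be maximal as well.\<close>
lemma log_convex_le_endpoints:
  fixes f :: "nat \<Rightarrow> real"
  assumes nonneg: "\<And>i. f i \<ge> 0"
    and lc: "\<And>i. 0 < i \<Longrightarrow> i < s \<Longrightarrow> (f i)\<^sup>2 \<le> f (i - 1) * f (i + 1)"
    and "i \<le> s"
  shows "f i \<le> max (f 0) (f s)"
proof -
  define m where "m = Max (f ` {..s})"
  have le: "f i \<le> m" if "i \<le> s" for i using that by (auto simp: m_def intro!: Max_ge)
  have "m \<in> f ` {..s}" unfolding m_def by (rule Max_in) auto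
  then have ex: "\<exists>i. i \<le> s \<and> f i = m" by auto
  define l where "l = (LEAST i. i \<le> s \<and> f i = m)"
  have l: "l \<le> s" "f l = m" using LeastI_ex[OF ex] by (auto simp: l_def)
  have least: "f i \<noteq> m" if "i < l" "i \<le> s" for i
    using not_less_Least that unfolding l_def by blast
  have "m \<le> max (f 0) (f s)"
  proof (cases "l = 0 \<or> l = s \<or> m = 0")
    case True
    then show ?thesis using l nonneg[of 0] by (auto simp: le_max_iff_disj)
  next
    case False
    then have i: "0 < l" "l < s" and m: "m > 0" using l nonneg[of l] by auto
    have "m * m \<le> f (l - 1) * f (l + 1)" using lc[OF i] l by (simp add: power2_eq_square)
    also have "\<dots> \<le> f (l - 1) * m" using i by (intro mult_left_mono le nonneg) auto
    finally have "m \<le> f (l - 1)" using m by simp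
    then have "f (l - 1) = m" using le[of "l - 1"] l by simp
    moreover have "f (l - 1) \<noteq> m" using i l(1) by (intro least) auto
    ultimately show ?thesis by simp
  qed
  then show ?thesis using le[OF assms(3)] by linarith
qed

lemma word_decomp:
  assumes "num_noise xs > 0"
  obtains e ys f where "xs = replicate e None @ ys @ replicate f None"
    "ys \<noteq> []" "hd ys \<noteq> None" "last ys \<noteq> None"
proof -
  define zs where "zs = dropWhile (\<lambda>x. x = None) xs"
  have 1: "takeWhile (\<lambda>x. x = None) xs = replicate (length (takeWhile (\<lambda>x. x = None) xs)) None"
    by (metis (mono_tags, lifting) replicate_eqI set_takeWhileD)
  obtain x where x: "x \<in> set xs" "x \<noteq> None"
    using assms by (auto simp: num_noise_def filter_empty_conv)
  have zs: "zs \<noteq> []"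
    unfolding zs_def dropWhile_eq_Nil_conv using x by blast
  then have hdzs: "hd zs \<noteq> None"
    using hd_dropWhile[of "\<lambda>x. x = None" xs] unfolding zs_def by blast
  define ws where "ws = dropWhile (\<lambda>x. x = None) (rev zs)"
  have 2: "takeWhile (\<lambda>x. x = None) (rev zs) = replicate (length (takeWhile (\<lambda>x. x = None) (rev zs))) None"
    by (metis (mono_tags, lifting) replicate_eqI set_takeWhileD)
  have ws: "ws \<noteq> []"
  proof
    assume "ws = []"
    then have "\<forall>x\<in>set zs. x = None"
      unfolding ws_def dropWhile_eq_Nil_conv set_rev .
    from bspec[OF this hd_in_set[OF zs]] hdzs show False by contradiction
  qed
  then have hdws: "hd ws \<noteq> None"
    using hd_dropWhile[OF ws[unfolded ws_def]] by (simp only: ws_def not_False_eq_True)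
  have zs': "zs = rev ws @ replicate (length (takeWhile (\<lambda>x. x = None) (rev zs))) None"
  proof -
    have "rev zs = replicate (length (takeWhile (\<lambda>x. x = None) (rev zs))) None @ ws"
      unfolding ws_def using 2 takeWhile_dropWhile_id[of "\<lambda>x. x = None" "rev zs"] by simp
    then have "rev (rev zs) = rev ws @ replicate (length (takeWhile (\<lambda>x. x = None) (rev zs))) None"
      by (metis rev_append rev_replicate)
    then show ?thesis by simp
  qed
  have "xs = replicate (length (takeWhile (\<lambda>x. x = None) xs)) None @ zs"
    unfolding zs_def using 1 takeWhile_dropWhile_id[of "\<lambda>x. x = None" xs] by simp
  moreover have "hd (rev ws) \<noteq> None"
    using hdzs ws arg_cong[OF zs', of hd] by simp
  ultimately show thesis
    using that[of _ "rev ws"] zs' ws hdws last_rev[of ws] by (metis rev_is_Nil_conv)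
qed

lemma replicate_snoc: "replicate (Suc m) x = replicate m x @ [x]"
  by (simp add: replicate_append_same)

lemma replicate_snoc2: "replicate (Suc (Suc m)) x = replicate m x @ [x, x]"
  by (induction m) simp_all

text \<open>A noncommutative Hoelder inequality. Let the word begin with \<open>e\<close> and end with \<open>f\<close> signal letters
  around a middle part \<open>ys\<close> that begins and ends with noise, and let \<open>\<phi> i\<close> be the squared Frobenius
  norm when \<open>i\<close> of these \<open>e + f\<close> letters stand in front. By \<open>frob_sq_sandwich\<close> \<open>\<phi>\<close> is log-convex, so
  it is largest when all the signal letters stand on one side. Then a noise letter is outermost on the
  other side and can be split off at the price of its operator norm, which leaves a word with one noise
  letter less.\<close>
lemma frob_sq_word_le:
  assumes R: "R \<in> carrier_mat n n" and ok: "word_ok n xs"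
  shows "frob_sq (word_prod n R b xs) \<le> word_cost xs * mtrace ((R\<^sup>T * R) ^\<^sub>m num_signal xs)"
  using ok
proof (induction "num_noise xs" arbitrary: b xs)
  case 0
  have "xs = replicate (num_signal xs) None"
    using 0(1) unfolding num_noise_def num_signal_def
    by (metis (mono_tags, lifting) "0" filter_empty_conv filter_True length_0_conv num_noise_def replicate_eqI)
  then show ?case using frob_sq_word_signal[OF R, of b "num_signal xs"]
    by (metis mult_1 order_refl word_cost_replicate)
next
  case (Suc r)
  obtain e ys f where xs: "xs = replicate e None @ ys @ replicate f None"
    and ys: "ys \<noteq> []" "hd ys \<noteq> None" "last ys \<noteq> None"
    using word_decomp[of xs] Suc(2) by (metis zero_less_Suc)
  define s where "s = e + f"
  define L where "L b = (if b then R else R\<^sup>T)" for b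
  have L: "L b \<in> carrier_mat n n" for b using R by (auto simp: L_def)
  have LT: "(L b)\<^sup>T = L (\<not> b)" for b by (simp add: L_def)
  define c where "c = (if even e then b else \<not> b)"
  \<comment> \<open>The flag alternates with \<open>i\<close>, so that the middle part \<open>ys\<close> is read in the same way for all \<open>i\<close>.\<close>
  define bb where "bb i = (if even i then c else \<not> c)" for i :: nat
  define w where "w i = replicate i None @ ys @ replicate (s - i) None" for i
  define \<phi> where "\<phi> i = frob_sq (word_prod n R (bb i) (w i))" for i
  have oky: "word_ok n ys" using Suc(3) by (simp add: xs)
  have okw: "word_ok n (w i)" for i using oky by (simp add: w_def)
  have xs_w: "xs = w e" and b: "b = bb e" by (auto simp: xs w_def s_def bb_def c_def)
  have lc: "(\<phi> i)\<^sup>2 \<le> \<phi> (i - 1) * \<phi> (i + 1)" if i: "0 < i" "i < s" for i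
  proof -
    define m where "m = s - i - 1"
    have e: "s - (i - 1) = Suc (Suc m)" "s - i = Suc m" "s - (i + 1) = m"
      using i by (auto simp: m_def)
    define z where "z = replicate (i - 1) None @ ys @ replicate m None"
    have okz: "word_ok n z" using oky by (simp add: z_def)
    define T where "T = word_prod n R (bb (i - 1)) z"
    have T: "T \<in> carrier_mat n n" unfolding T_def by (intro word_prod_carrier R okz)
    define \<beta> where "\<beta> = (if even (length z) then bb (i - 1) else \<not> bb (i - 1))"
    have bbS: "bb (Suc j) = (\<not> bb j)" for j by (simp add: bb_def)
    obtain j where j: "i = Suc j" using i by (cases i) auto
    have w0: "w (i - 1) = z @ [None, None]"
      unfolding w_def z_def e(1) replicate_snoc2 by simp
    have w1: "w i = None # z @ [None]"
      unfolding w_def z_def e(2) replicate_snoc by (simp add: j)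
    have w2: "w (i + 1) = None # None # z"
      unfolding w_def z_def e(3) by (simp add: j)
    have one: "word_prod n R b' [None] = L b'" for b' using R by (auto simp: L_def)
    have two: "word_prod n R b' [None, None] = L b' * (L b')\<^sup>T" for b' using R by (auto simp: L_def)
    have z1: "word_prod n R (bb (i - 1)) (z @ [None]) = T * L \<beta>"
      using okz R by (subst word_prod_append) (auto simp only: T_def \<beta>_def one word_ok_simps)
    have z2: "word_prod n R (bb (i - 1)) (z @ [None, None]) = T * (L \<beta> * (L \<beta>)\<^sup>T)"
      using okz R by (subst word_prod_append) (auto simp only: T_def \<beta>_def two word_ok_simps)
    have p0: "\<phi> (i - 1) = frob_sq (T * (L \<beta> * (L \<beta>)\<^sup>T))"
      unfolding \<phi>_def w0 z2 ..
    have p1: "\<phi> i = frob_sq (L (bb i) * T * L \<beta>)"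
    proof -
      have "word_prod n R (bb i) (w i) = L (bb i) * word_prod n R (bb (i - 1)) (z @ [None])"
        unfolding w1 by (simp add: L_def bbS j)
      then show ?thesis unfolding \<phi>_def z1
        using T L by (simp add: assoc_mult_mat[of _ n n _ n _ n])
    qed
    have p2: "\<phi> (i + 1) = frob_sq ((L (bb i))\<^sup>T * (L (bb i) * T))"
    proof -
      have "word_prod n R (bb (i + 1)) (w (i + 1)) = L (bb (i + 1)) * (L (bb i) * T)"
        unfolding w2 by (simp add: L_def bbS j T_def)
      then show ?thesis unfolding \<phi>_def LT by (simp add: bbS)
    qed
    show ?thesis
      unfolding p0 p1 p2 using frob_sq_sandwich[OF L T L] by (simp add: mult.commute)
  qed
  have ns: "num_signal xs = s + num_signal ys" "word_cost xs = word_cost ys"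
    "num_noise xs = num_noise ys"
    by (simp_all add: xs s_def word_cost_append)
  let ?B = "word_cost xs * mtrace ((R\<^sup>T * R) ^\<^sub>m num_signal xs)"
  have "\<phi> 0 \<le> ?B"
  proof -
    obtain X d ys' where y: "ys = Some (X, d) # ys'"
      using ys by (cases ys) auto
    have X: "opnorm_sq_le n d X" using oky by (simp add: y)
    have "\<phi> 0 = frob_sq (X * word_prod n R (\<not> bb 0) (ys' @ replicate s None))"
      by (simp add: \<phi>_def w_def y)
    also have "\<dots> \<le> d * frob_sq (word_prod n R (\<not> bb 0) (ys' @ replicate s None))"
      using oky by (intro frob_sq_mult_left'[OF X, of _ n] word_prod_carrier[OF R]) (simp add: y)
    also have "\<dots> \<le> d * (word_cost (ys' @ replicate s None) *
        mtrace ((R\<^sup>T * R) ^\<^sub>m num_signal (ys' @ replicate s None)))"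
    proof (rule mult_left_mono)
      have "r = num_noise (ys' @ replicate s None)" using Suc.hyps(2) ns(3) y by simp
      moreover have "word_ok n (ys' @ replicate s None)" using oky y by simp
      ultimately show "frob_sq (word_prod n R (\<not> bb 0) (ys' @ replicate s None)) \<le>
        word_cost (ys' @ replicate s None) * mtrace ((R\<^sup>T * R) ^\<^sub>m num_signal (ys' @ replicate s None))"
        by (rule Suc.hyps(1))
    qed (use X in \<open>simp add: opnorm_sq_le_def\<close>)
    also have "\<dots> = ?B"
    proof -
      have "num_signal (ys' @ replicate s None) = s + num_signal ys" by (simp add: y)
      moreover have "d * word_cost (ys' @ replicate s None) = word_cost ys"
        by (simp add: y word_cost_append)
      ultimately show ?thesis unfolding ns by (simp only: mult.assoc[symmetric])
    qed
    finally show ?thesis .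
  qed
  moreover have "\<phi> s \<le> ?B"
  proof -
    obtain X d ys' where y: "ys = ys' @ [Some (X, d)]"
      using ys by (cases ys rule: rev_cases) auto
    have X: "opnorm_sq_le n d X" "X \<in> carrier_mat n n"
      using oky by (auto simp: y opnorm_sq_le_def)
    have wc: "word_prod n R (bb s) (replicate s None @ ys') \<in> carrier_mat n n"
      using oky by (intro word_prod_carrier[OF R]) (simp add: y)
    have "word_prod n R (bb s) ((replicate s None @ ys') @ [Some (X, d)]) =
        word_prod n R (bb s) (replicate s None @ ys') * X"
      using oky R X by (subst word_prod_append) (auto simp: y)
    then have "\<phi> s = frob_sq (word_prod n R (bb s) (replicate s None @ ys') * X)"
      by (simp add: \<phi>_def w_def y)
    also have "\<dots> \<le> d * frob_sq (word_prod n R (bb s) (replicate s None @ ys'))"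
      by (rule frob_sq_mult_right[OF X(1) wc])
    also have "\<dots> \<le> d * (word_cost (replicate s None @ ys') *
        mtrace ((R\<^sup>T * R) ^\<^sub>m num_signal (replicate s None @ ys')))"
    proof (rule mult_left_mono)
      have "r = num_noise (replicate s None @ ys')" using Suc.hyps(2) ns(3) y by simp
      moreover have "word_ok n (replicate s None @ ys')" using oky y by simp
      ultimately show "frob_sq (word_prod n R (bb s) (replicate s None @ ys')) \<le>
        word_cost (replicate s None @ ys') * mtrace ((R\<^sup>T * R) ^\<^sub>m num_signal (replicate s None @ ys'))"
        by (rule Suc.hyps(1))
    qed (use X in \<open>simp add: opnorm_sq_le_def\<close>)
    also have "\<dots> = ?B"
    proof -
      have "num_signal (replicate s None @ ys') = s + num_signal ys" by (simp add: y)
      moreover have "d * word_cost (replicate s None @ ys') = word_cost ys"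
        by (simp add: y word_cost_append)
      ultimately show ?thesis unfolding ns by (simp only: mult.assoc[symmetric])
    qed
    finally show ?thesis .
  qed
  moreover have "\<phi> e \<le> max (\<phi> 0) (\<phi> s)"
    using lc by (intro log_convex_le_endpoints) (auto simp: \<phi>_def frob_sq_nonneg s_def)
  ultimately have "\<phi> e \<le> ?B" by linarith
  then show ?case by (simp add: \<phi>_def flip: b xs_w)
qed

section \<open>Singular values as traces\<close>

lemma prod_proots_dvd:
  fixes p :: "'a::idom poly"
  shows "(\<Prod>x\<in>#proots p. [:- x, 1:]) dvd p"
proof (induction p rule: poly_root_order_induct)
  case 0
  then show ?case by simp
next
  case (no_roots p)
  then have "proots p = {#}" by (simp add: multiset_eqI order_root)
  then show ?case by simp
next
  case (root p x n)
  have p: "p \<noteq> 0" using root.hyps by auto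
  then have "proots ([:- x, 1:] ^ n * p) = repeat_mset n {#x#} + proots p"
    by (simp add: proots_mult proots_power)
  moreover have "(\<Prod>y\<in>#repeat_mset n {#x#} + proots p. [:- y, 1:]) =
      [:- x, 1:] ^ n * (\<Prod>y\<in>#proots p. [:- y, 1:])"
    by (induction n) (simp_all add: mult.assoc del: mult_pCons_left)
  ultimately show ?case using root.IH by (simp only: mult_dvd_mono dvd_refl)
qed

lemma degree_prod_linear: "degree (\<Prod>x\<in>#M. [:- x, 1::'a::idom:]) = size M"
  and lead_coeff_prod_linear: "lead_coeff (\<Prod>x\<in>#M. [:- x, 1::'a::idom:]) = 1"
proof -
  have "degree (\<Prod>x\<in>#M. [:- x, 1::'a:]) = size M \<and> lead_coeff (\<Prod>x\<in>#M. [:- x, 1::'a:]) = 1"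
  proof (induction M)
    case (add x M)
    then have "(\<Prod>x\<in>#M. [:- x, 1::'a:]) \<noteq> 0" by auto
    then have "degree ([:- x, 1:] * (\<Prod>x\<in>#M. [:- x, 1::'a:])) = Suc (size M)"
      using add by (subst degree_mult_eq) auto
    moreover have "lead_coeff ([:- x, 1:] * (\<Prod>x\<in>#M. [:- x, 1::'a:])) = 1"
      using add by (subst lead_coeff_mult) auto
    ultimately show ?case by (simp del: mult_pCons_left)
  qed simp
  then show "degree (\<Prod>x\<in>#M. [:- x, 1::'a:]) = size M" "lead_coeff (\<Prod>x\<in>#M. [:- x, 1::'a:]) = 1"
    by auto
qed

text \<open>The product over the roots divides \<open>p\<close>, and has the same degree and leading coefficient.\<close>
lemma monic_split_factorization:
  fixes p :: "real poly"
  assumes "lead_coeff p = 1" "size (proots p) = degree p"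
  shows "p = (\<Prod>x\<in>#proots p. [:- x, 1:])"
proof -
  let ?r = "\<Prod>x\<in>#proots p. [:- x, 1:]"
  obtain g where g: "p = ?r * g" using prod_proots_dvd[of p] by (rule dvdE)
  have nz: "?r \<noteq> 0" "g \<noteq> 0" using assms(1) g by auto
  have "degree p = degree ?r + degree g"
    using nz by (subst g) (simp add: degree_mult_eq)
  then have "degree g = 0" using assms(2) degree_prod_linear[of "proots p"] by simp
  moreover have "lead_coeff g = 1"
    using arg_cong[OF g, of lead_coeff] assms(1) lead_coeff_prod_linear[of "proots p"]
    by (simp only: lead_coeff_mult mult_1)
  ultimately have "g = 1" by (metis degree_0_id one_pCons of_real_1 monom_0 coeff_pCons_0 degree_eq_zeroE)
  then show ?thesis using g by simp
qed

lemma upper_triangular_pow: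
  fixes B :: "real mat"
  assumes B: "B \<in> carrier_mat n n" "upper_triangular B"
  shows "(\<forall>i<n. \<forall>j<i. (B ^\<^sub>m a) $$ (i, j) = 0) \<and> (\<forall>i<n. (B ^\<^sub>m a) $$ (i, i) = (B $$ (i, i)) ^ a)"
proof (induction a)
  case (Suc a)
  have c: "B ^\<^sub>m a \<in> carrier_mat n n" using B by auto
  have e: "(B ^\<^sub>m Suc a) $$ (i, j) = (\<Sum>k<n. (B ^\<^sub>m a) $$ (i, k) * B $$ (k, j))" if "i < n" "j < n" for i j
    using index_mult_mat_sum[OF c B(1) that] by simp
  have ut: "B $$ (k, j) = 0" if "j < k" "k < n" for k j
    using B that by (auto simp: upper_triangular_def)
  have "(B ^\<^sub>m Suc a) $$ (i, j) = 0" if "i < n" "j < i" for i j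
  proof -
    have "(B ^\<^sub>m a) $$ (i, k) * B $$ (k, j) = 0" if "k < n" for k
      using Suc ut[of j k] that \<open>i < n\<close> \<open>j < i\<close> by (cases "k < i") auto
    then have "(\<Sum>k<n. (B ^\<^sub>m a) $$ (i, k) * B $$ (k, j)) = 0"
      by (intro sum.neutral) (simp del: mult_eq_0_iff)
    then show ?thesis using that by (subst e) (simp_all del: pow_mat.simps)
  qed
  moreover have "(B ^\<^sub>m Suc a) $$ (i, i) = (B $$ (i, i)) ^ Suc a" if i: "i < n" for i
  proof -
    have "(B ^\<^sub>m a) $$ (i, k) * B $$ (k, i) = (if k = i then (B $$ (i, i)) ^ Suc a else 0)" if "k < n" for k
    proof (cases k i rule: linorder_cases)
      case less
      then have "(B ^\<^sub>m a) $$ (i, k) = 0" using Suc i by blast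
      then show ?thesis using less by simp
    next
      case equal
      have "(B ^\<^sub>m a) $$ (i, i) = (B $$ (i, i)) ^ a" using Suc i by blast
      then show ?thesis using equal by simp
    next
      case greater
      then show ?thesis using ut[OF greater that] by simp
    qed
    then have "(B ^\<^sub>m Suc a) $$ (i, i) = (\<Sum>k<n. if k = i then (B $$ (i, i)) ^ Suc a else 0)"
      unfolding e[OF i i] by (intro sum.cong) auto
    then show ?thesis using i by simp
  qed
  ultimately show ?case by blast
qed (use B in auto)

text \<open>Powers of a Schur triangular form carry the powers of the eigenvalues on their diagonal.\<close>
lemma mtrace_pow_char_poly:
  fixes G :: "real mat"
  assumes G: "G \<in> carrier_mat n n" and es: "char_poly G = (\<Prod>e\<leftarrow>es. [:- e, 1:])"
  shows "mtrace (G ^\<^sub>m a) = (\<Sum>e\<leftarrow>es. e ^ a)"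
proof -
  obtain B P Q where s: "schur_decomposition G es = (B, P, Q)"
    by (cases "schur_decomposition G es") auto
  have sim: "similar_mat_wit G B P Q" and ut: "upper_triangular B" and d: "diag_mat B = es"
    using schur_decomposition[OF G es s] by auto
  have c: "B \<in> carrier_mat n n" "P \<in> carrier_mat n n" "Q \<in> carrier_mat n n" and QP: "Q * P = 1\<^sub>m n"
    using similar_mat_witD2[OF G sim] by auto
  have Ba: "B ^\<^sub>m a \<in> carrier_mat n n" using c by auto
  have "mtrace (G ^\<^sub>m a) = mtrace (P * B ^\<^sub>m a * Q)"
    unfolding similar_mat_wit_pow_id[OF sim] ..
  also have "\<dots> = mtrace (Q * (P * B ^\<^sub>m a))"
    using c Ba by (intro mtrace_comm[of _ n n]) auto
  also have "Q * (P * B ^\<^sub>m a) = Q * P * B ^\<^sub>m a"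
    using c Ba by (simp add: assoc_mult_mat[of _ n n _ n _ n])
  also have "\<dots> = B ^\<^sub>m a" unfolding QP by (rule left_mult_one_mat[OF Ba])
  also have "mtrace (B ^\<^sub>m a) = (\<Sum>i<n. (B $$ (i, i)) ^ a)"
    using upper_triangular_pow[OF c(1) ut, of a] Ba by (auto simp: mtrace_def intro!: sum.cong)
  also have "\<dots> = (\<Sum>e\<leftarrow>diag_mat B. e ^ a)"
    using c by (simp add: diag_mat_def sum_list_sum_nth atLeast0LessThan)
  finally show ?thesis by (simp add: d)
qed

lemma sum_singular_value_powers:
  assumes A: "A \<in> carrier_mat p q"
  shows "(\<Sum>i=1..q. singular_value i A ^ (2 * a)) = mtrace ((A\<^sup>T * A) ^\<^sub>m a)"
proof -
  let ?G = "A\<^sup>T * A" and ?sv = "singular_values A"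
  let ?M = "proots (char_poly ?G)"
  have G: "?G \<in> carrier_mat q q" using A by auto
  obtain es where es: "mset es = ?M" using ex_mset by blast
  have mon: "degree (char_poly ?G) = q \<and> lead_coeff (char_poly ?G) = 1"
    using degree_monic_char_poly[OF G] by auto
  have "char_poly ?G = (\<Prod>x\<in>#?M. [:- x, 1:])"
    using mon proots_gram(1)[OF A] by (intro monic_split_factorization) auto
  also have "\<dots> = (\<Prod>e\<leftarrow>es. [:- e, 1:])"
    unfolding es[symmetric] by (simp flip: mset_map add: prod_mset_prod_list)
  finally have tr: "mtrace (?G ^\<^sub>m a) = (\<Sum>e\<leftarrow>es. e ^ a)"
    by (rule mtrace_pow_char_poly[OF G])
  have len: "length ?sv = q" by (rule length_singular_values[OF A])
  have "(\<Sum>i=1..q. singular_value i A ^ (2 * a)) = (\<Sum>i<q. (?sv ! i) ^ (2 * a))"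
    by (rule sum.reindex_bij_witness[of _ "\<lambda>i. Suc i" "\<lambda>i. i - 1"]) (auto simp: singular_value_def)
  also have "\<dots> = (\<Sum>x\<leftarrow>?sv. x ^ (2 * a))"
    by (simp add: sum_list_sum_nth len atLeast0LessThan)
  also have "\<dots> = (\<Sum>x\<in>#mset ?sv. x ^ (2 * a))"
    by (simp flip: sum_mset_sum_list mset_map)
  also have "mset ?sv = image_mset sqrt ?M" by (simp add: singular_values_def)
  also have "(\<Sum>x\<in>#image_mset sqrt ?M. x ^ (2 * a)) = (\<Sum>b\<in>#?M. b ^ a)"
    using proots_gram(2)[OF A]
    by (auto simp: image_mset.compositionality o_def power_mult intro!: arg_cong[where f = sum_mset] image_mset_cong)
  also have "\<dots> = (\<Sum>e\<leftarrow>es. e ^ a)"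
    unfolding es[symmetric] by (simp flip: sum_mset_sum_list mset_map)
  finally show ?thesis by (simp add: tr)
qed

section \<open>Restriction to the column space of the signal\<close>

text \<open>Gram-Schmidt in which a vector that depends on its predecessors contributes the zero vector.
  In this way the number of vectors stays \<open>m\<close> whatever the rank is. The normalisation \<open>v = b / N\<close>
  yields this zero vector by itself, since division by \<open>N = 0\<close> gives \<open>0\<close>.\<close>
lemma orthonormal_spanning:
  fixes a :: "nat \<Rightarrow> nat \<Rightarrow> real" and p :: nat
  defines "ip \<equiv> \<lambda>x y. \<Sum>r<p. x r * y r"
  shows "\<exists>u :: nat \<Rightarrow> nat \<Rightarrow> real.
    (\<forall>l<m. \<forall>l'<m. l \<noteq> l' \<longrightarrow> ip (u l) (u l') = 0) \<and> (\<forall>l<m. ip (u l) (u l) \<in> {0, 1}) \<and>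
    (\<forall>j<m. \<forall>r<p. a j r = (\<Sum>l<m. ip (u l) (a j) * u l r))"
proof (induction m)
  case (Suc m)
  then obtain u where
    H: "(\<forall>l<m. \<forall>l'<m. l \<noteq> l' \<longrightarrow> ip (u l) (u l') = 0) \<and> (\<forall>l<m. ip (u l) (u l) \<in> {0, 1}) \<and>
      (\<forall>j<m. \<forall>r<p. a j r = (\<Sum>l<m. ip (u l) (a j) * u l r))"
    by (elim exE)
  have orth: "ip (u l) (u l') = 0" if "l < m" "l' < m" "l \<noteq> l'" for l l'
    using H that by simp
  have nrm: "ip (u l) (u l) \<in> {0, 1}" if "l < m" for l
    using conjunct1[OF conjunct2[OF H]] that by blast
  have span: "a j r = (\<Sum>l<m. ip (u l) (a j) * u l r)" if "j < m" "r < p" for j r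
    using conjunct2[OF conjunct2[OF H]] that by blast
  have zero: "x r = 0" if "ip x x = 0" "r < p" for x r
    using that by (auto simp: ip_def sum_nonneg_eq_0_iff)
  have zero': "ip x y = 0" if "ip x x = 0" for x y
    using zero[OF that] by (simp add: ip_def)
  have comm: "ip x y = ip y x" for x y by (simp add: ip_def mult.commute)
  have scale: "ip x (\<lambda>r. y r / c) = ip x y / c" for x y c
    by (simp add: ip_def sum_divide_distrib)
  define b where "b r = a m r - (\<Sum>l<m. ip (u l) (a m) * u l r)" for r
  define N where "N = sqrt (ip b b)"
  define v where "v r = b r / N" for r
  define w where "w l = (if l = m then v else u l)" for l
  have bb: "ip b b \<ge> 0" by (auto simp: ip_def intro!: sum_nonneg)
  have ub: "ip (u l) b = 0" if l: "l < m" for l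
  proof -
    have "ip (u l) b = ip (u l) (a m) - (\<Sum>l'<m. ip (u l') (a m) * ip (u l) (u l'))"
      unfolding b_def
      by (simp add: ip_def right_diff_distrib sum_subtractf sum_distrib_left)
         (subst sum.swap, simp add: mult_ac)
    also have "(\<Sum>l'<m. ip (u l') (a m) * ip (u l) (u l')) = (\<Sum>l'<m. if l' = l then ip (u l) (a m) * ip (u l) (u l) else 0)"
      using orth[OF l] by (intro sum.cong) auto
    also have "\<dots> = ip (u l) (a m) * ip (u l) (u l)" using l by simp
    also have "\<dots> = ip (u l) (a m)" using nrm[OF l] zero'[of "u l" "a m"] by auto
    finally show ?thesis by simp
  qed
  have uv: "ip (u l) v = 0" if "l < m" for l
    using ub[OF that] scale[of "u l" b N] by (simp add: v_def[abs_def])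
  have vu: "ip v (u l) = 0" if "l < m" for l
    using uv[OF that] comm[of v "u l"] by (rule trans[rotated])
  have vv: "ip v v \<in> {0, 1}"
  proof -
    have "ip v v = ip b b / (N * N)"
      using scale[of v b N] scale[of b b N] comm[of v b] by (simp add: v_def[abs_def])
    also have "N * N = ip b b" using bb by (simp add: N_def)
    finally show ?thesis by simp
  qed
  have vam: "b r = ip v (a m) * v r" if r: "r < p" for r
  proof -
    have "ip b (a m) = ip b b"
    proof -
      have "ip b b = ip b (a m) - (\<Sum>l<m. ip (u l) (a m) * ip b (u l))"
        unfolding b_def
        by (simp add: ip_def right_diff_distrib sum_subtractf sum_distrib_left)
           (subst sum.swap, simp add: mult_ac)
      also have "(\<Sum>l<m. ip (u l) (a m) * ip b (u l)) = 0"
        using ub comm[of b] by (intro sum.neutral) auto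
      finally show ?thesis by simp
    qed
    then have "ip v (a m) = ip b b / N"
      using scale[of "a m" b N] comm[of "a m"] by (simp add: v_def[abs_def])
    moreover have "N * N = ip b b" using bb by (simp add: N_def)
    ultimately have "ip v (a m) * v r = (N * N) * b r / (N * N)" by (simp add: v_def)
    also have "\<dots> = b r"
      using zero[of b r] r \<open>N * N = ip b b\<close> by (cases "N = 0") auto
    finally show ?thesis by simp
  qed
  have "a j r = (\<Sum>l<Suc m. ip (w l) (a j) * w l r)" if j: "j < Suc m" and r: "r < p" for j r
  proof (cases "j = m")
    case True
    have "a m r = (\<Sum>l<m. ip (u l) (a m) * u l r) + ip v (a m) * v r"
      using vam[OF r] by (simp add: b_def)
    then show ?thesis by (simp add: w_def True)
  next
    case False
    then have j: "j < m" using j by simp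
    have "ip v (a j) = (\<Sum>l<m. ip (u l) (a j) * ip v (u l))"
    proof -
      have "ip v (a j) = (\<Sum>r<p. v r * (\<Sum>l<m. ip (u l) (a j) * u l r))"
      proof -
        have "(\<Sum>r<p. v r * a j r) = (\<Sum>r<p. v r * (\<Sum>l<m. ip (u l) (a j) * u l r))"
        proof (rule sum.cong[OF refl])
          fix r assume "r \<in> {..<p}"
          then have "a j r = (\<Sum>l<m. ip (u l) (a j) * u l r)" by (intro span[OF j]) simp
          then show "v r * a j r = v r * (\<Sum>l<m. ip (u l) (a j) * u l r)" by (rule arg_cong)
        qed
        then show ?thesis unfolding ip_def .
      qed
      also have "\<dots> = (\<Sum>r<p. \<Sum>l<m. ip (u l) (a j) * (v r * u l r))"
        by (simp only: sum_distrib_left mult.left_commute)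
      also have "\<dots> = (\<Sum>l<m. \<Sum>r<p. ip (u l) (a j) * (v r * u l r))"
        by (rule sum.swap)
      also have "\<dots> = (\<Sum>l<m. ip (u l) (a j) * (\<Sum>r<p. v r * u l r))"
        by (simp only: sum_distrib_left)
      finally show ?thesis by (simp only: ip_def)
    qed
    also have "\<dots> = 0" by (intro sum.neutral) (simp add: vu)
    finally have "ip v (a j) * v r = 0" by simp
    moreover have "(\<Sum>l<m. ip (w l) (a j) * w l r) = (\<Sum>l<m. ip (u l) (a j) * u l r)"
      by (intro sum.cong) (auto simp: w_def)
    ultimately have "(\<Sum>l<Suc m. ip (w l) (a j) * w l r) = (\<Sum>l<m. ip (u l) (a j) * u l r)"
      by (simp add: w_def)
    with span[OF j r] show ?thesis by (simp only:)
  qed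
  moreover have "ip (w l) (w l) \<in> {0, 1}" if "l < Suc m" for l
    using that nrm[of l] vv by (auto simp: w_def less_Suc_eq)
  moreover have "ip (w l) (w l') = 0" if "l < Suc m" "l' < Suc m" "l \<noteq> l'" for l l'
    using that orth[of l l'] uv[of l] uv[of l'] vu[of l] vu[of l'] by (auto simp: w_def less_Suc_eq)
  ultimately show ?case by blast
qed simp

text \<open>\<open>U\<close> is a partial isometry whose range contains the columns of \<open>A\<close>. Through \<open>A = U (U\<^sup>T A)\<close> a
  noise matrix next to \<open>A\<close> is replaced by its \<open>q \<times> q\<close> compression \<open>U\<^sup>T Z\<close>, whose size does not
  depend on \<open>p\<close>.\<close>
lemma column_space_isometry:
  assumes A: "A \<in> carrier_mat p q"
  obtains U where "U \<in> carrier_mat p q" "U * (U\<^sup>T * A) = A"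
    "\<And>v::nat \<Rightarrow> real. (\<Sum>r<p. (\<Sum>l<q. U $$ (r, l) * v l)\<^sup>2) \<le> (\<Sum>l<q. (v l)\<^sup>2)"
proof -
  define ip where "ip x y = (\<Sum>r<p. x r * y r)" for x y :: "nat \<Rightarrow> real"
  obtain u where
    H: "(\<forall>l<q. \<forall>l'<q. l \<noteq> l' \<longrightarrow> ip (u l) (u l') = 0) \<and> (\<forall>l<q. ip (u l) (u l) \<in> {0, 1}) \<and>
      (\<forall>j<q. \<forall>r<p. A $$ (r, j) = (\<Sum>l<q. ip (u l) (\<lambda>r. A $$ (r, j)) * u l r))"
    using orthonormal_spanning[where m = q and p = p and a = "\<lambda>j r. A $$ (r, j)"]
    unfolding ip_def by (elim exE)
  have orth: "ip (u l) (u l') = 0" if "l < q" "l' < q" "l \<noteq> l'" for l l'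
    using H that by simp
  have nrm: "ip (u l) (u l) \<in> {0, 1}" if "l < q" for l
    using conjunct1[OF conjunct2[OF H]] that by blast
  have span: "A $$ (r, j) = (\<Sum>l<q. ip (u l) (\<lambda>r. A $$ (r, j)) * u l r)" if "j < q" "r < p" for j r
    using conjunct2[OF conjunct2[OF H]] that by blast
  define U where "U = mat p q (\<lambda>(r, l). u l r)"
  have U: "U \<in> carrier_mat p q" by (simp add: U_def)
  have "U * (U\<^sup>T * A) = A"
  proof (rule eq_matI)
    fix r j assume "r < dim_row A" "j < dim_col A"
    then have r: "r < p" and j: "j < q" using A by auto
    have "(U * (U\<^sup>T * A)) $$ (r, j) = (\<Sum>l<q. U $$ (r, l) * (U\<^sup>T * A) $$ (l, j))"
      using U A r j by (intro index_mult_mat_sum[of _ p q _ q]) auto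
    also have "\<dots> = (\<Sum>l<q. u l r * ip (u l) (\<lambda>r. A $$ (r, j)))"
    proof (rule sum.cong[OF refl])
      fix l assume l: "l \<in> {..<q}"
      have "(U\<^sup>T * A) $$ (l, j) = (\<Sum>r<p. U\<^sup>T $$ (l, r) * A $$ (r, j))"
        using U A l j by (intro index_mult_mat_sum[of _ q p _ q]) auto
      also have "\<dots> = ip (u l) (\<lambda>r. A $$ (r, j))"
        unfolding ip_def using l by (intro sum.cong) (auto simp: U_def)
      finally show "U $$ (r, l) * (U\<^sup>T * A) $$ (l, j) = u l r * ip (u l) (\<lambda>r. A $$ (r, j))"
        using r l by (simp add: U_def)
    qed
    also have "\<dots> = A $$ (r, j)" using span[OF j r] by (simp add: mult.commute)
    finally show "(U * (U\<^sup>T * A)) $$ (r, j) = A $$ (r, j)" .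
  qed (use U A in auto)
  moreover have "(\<Sum>r<p. (\<Sum>l<q. U $$ (r, l) * v l)\<^sup>2) \<le> (\<Sum>l<q. (v l)\<^sup>2)" for v :: "nat \<Rightarrow> real"
  proof -
    have "(\<Sum>r<p. (\<Sum>l<q. U $$ (r, l) * v l)\<^sup>2) = (\<Sum>r<p. \<Sum>l<q. \<Sum>l'<q. (u l r * v l) * (u l' r * v l'))"
      by (intro sum.cong refl) (simp add: U_def power2_eq_square sum_product)
    also have "\<dots> = (\<Sum>l<q. \<Sum>r<p. \<Sum>l'<q. (u l r * v l) * (u l' r * v l'))"
      by (rule sum.swap)
    also have "\<dots> = (\<Sum>l<q. \<Sum>l'<q. \<Sum>r<p. (u l r * v l) * (u l' r * v l'))"
      by (intro sum.cong refl sum.swap)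
    also have "\<dots> = (\<Sum>l<q. \<Sum>l'<q. v l * v l' * ip (u l) (u l'))"
      by (simp add: ip_def sum_distrib_left mult_ac)
    also have "\<dots> = (\<Sum>l<q. \<Sum>l'<q. if l' = l then (v l)\<^sup>2 * ip (u l) (u l) else 0)"
      using orth by (intro sum.cong) (auto simp: power2_eq_square)
    also have "\<dots> = (\<Sum>l<q. (v l)\<^sup>2 * ip (u l) (u l))" by simp
    also have "\<dots> \<le> (\<Sum>l<q. (v l)\<^sup>2)"
      using nrm by (intro sum_mono mult_left_le) fastforce+
    finally show ?thesis .
  qed
  ultimately show thesis using that[OF U] by blast
qed

section \<open>Words in signal and noise\<close>

text \<open>A product of factors \<open>F\<^sup>T F'\<close>, where the flags tell at which places the signal \<open>A\<close> stands. The
  other places are filled by \<open>Z\<close> if they are transposed and by \<open>Z'\<close> if not; the two belong to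
  different parities in a closed walk, hence to independent noise matrices.\<close>
fun gram_word :: "nat \<Rightarrow> real mat \<Rightarrow> real mat \<Rightarrow> real mat \<Rightarrow> (bool \<times> bool) list \<Rightarrow> real mat" where
  "gram_word q A Z Z' [] = 1\<^sub>m q"
| "gram_word q A Z Z' ((a, b) # xs) =
     ((if a then A else Z)\<^sup>T * (if b then A else Z')) * gram_word q A Z Z' xs"

lemma gram_word_carrier:
  assumes "A \<in> carrier_mat p q" "Z \<in> carrier_mat p q" "Z' \<in> carrier_mat p q"
  shows "gram_word q A Z Z' xs \<in> carrier_mat q q"
  using assms
  by (induction q A Z Z' xs rule: gram_word.induct) (auto intro!: mult_carrier_mat[of _ _ p])

lemma gram_word_append:
  assumes c: "A \<in> carrier_mat p q" "Z \<in> carrier_mat p q" "Z' \<in> carrier_mat p q"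
  shows "gram_word q A Z Z' (xs @ ys) = gram_word q A Z Z' xs * gram_word q A Z Z' ys"
proof (induction xs)
  case Nil
  show ?case using gram_word_carrier[OF c, of ys] by simp
next
  case (Cons ab xs)
  obtain a b where ab: "ab = (a, b)" by (cases ab)
  have "(if a then A else Z)\<^sup>T * (if b then A else Z') \<in> carrier_mat q q"
    using c by (intro mult_carrier_mat[of _ q p]) auto
  from assoc_mult_mat[OF this gram_word_carrier[OF c, of xs] gram_word_carrier[OF c, of ys]]
  show ?case by (simp add: ab Cons)
qed

lemma gram_word_transpose:
  assumes c: "A \<in> carrier_mat p q" "Z \<in> carrier_mat p q" "Z' \<in> carrier_mat p q"
  shows "(gram_word q A Z Z' xs)\<^sup>T = gram_word q A Z' Z (rev (map prod.swap xs))"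
proof (induction xs)
  case (Cons ab xs)
  obtain a b where ab: "ab = (a, b)" by (cases ab)
  let ?F = "(if a then A else Z)" and ?F' = "(if b then A else Z')"
  have F: "?F \<in> carrier_mat p q" "?F' \<in> carrier_mat p q" using c by auto
  have w: "?F\<^sup>T * ?F' \<in> carrier_mat q q" "?F'\<^sup>T * ?F \<in> carrier_mat q q"
    using F by (auto intro!: mult_carrier_mat[of _ q p])
  have "(gram_word q A Z Z' (ab # xs))\<^sup>T = (gram_word q A Z Z' xs)\<^sup>T * (?F\<^sup>T * ?F')\<^sup>T"
    unfolding ab gram_word.simps by (rule transpose_mult[OF w(1) gram_word_carrier[OF c]])
  also have "(?F\<^sup>T * ?F')\<^sup>T = ?F'\<^sup>T * ?F"
    using F by (subst transpose_mult[of _ q p _ q]) auto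
  also have "\<dots> = gram_word q A Z' Z [(b, a)]"
    unfolding gram_word.simps right_mult_one_mat[OF w(2)] ..
  finally show ?case
    by (simp add: ab Cons gram_word_append[OF c(1,3,2)])
qed simp

lemma opnorm_sq_le_one: "opnorm_sq_le n 1 (1\<^sub>m n)"
  unfolding opnorm_sq_le_def
proof (intro conjI allI)
  fix v :: "nat \<Rightarrow> real"
  have "(\<Sum>j<n. 1\<^sub>m n $$ (i, j) * v j) = v i" if "i < n" for i
    using that by (simp add: if_distrib[of "\<lambda>x. x * _"] cong: if_cong)
  then show "(\<Sum>i<n. (\<Sum>j<n. 1\<^sub>m n $$ (i, j) * v j)\<^sup>2) \<le> 1 * (\<Sum>j<n. (v j)\<^sup>2)"
    by simp
qed auto

text \<open>Inserting \<open>U U\<^sup>T\<close> in front of \<open>A\<close> turns every signal letter into \<open>R = U\<^sup>T A\<close> and compresses the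
  noise next to it. Each noise position thus costs a factor \<open>s\<close>; two noise letters in one pair are
  kept together as \<open>Z\<^sup>T Z'\<close> and cost \<open>s\<^sup>2\<close>.\<close>
lemma gram_word_eq_word_prod:
  assumes A: "A \<in> carrier_mat p q" and Z: "Z \<in> carrier_mat p q" and Z': "Z' \<in> carrier_mat p q"
    and U: "U \<in> carrier_mat p q" "U * (U\<^sup>T * A) = A"
    and X: "opnorm_sq_le q s (U\<^sup>T * Z)" and X': "opnorm_sq_le q s (U\<^sup>T * Z')"
    and W: "opnorm_sq_le q (s\<^sup>2) (Z\<^sup>T * Z')"
  shows "\<exists>ws. word_ok q ws \<and> gram_word q A Z Z' xs = word_prod q (U\<^sup>T * A) False ws \<and>
     length ws = 2 * length xs \<and> word_cost ws = s ^ num_noise ws"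
proof (induction xs)
  case Nil
  show ?case by (rule exI[of _ "[]"]) simp
next
  case (Cons ab xs)
  obtain a b where ab: "ab = (a, b)" by (cases ab)
  let ?R = "U\<^sup>T * A"
  obtain ws where ws: "word_ok q ws" "gram_word q A Z Z' xs = word_prod q ?R False ws"
     "length ws = 2 * length xs" "word_cost ws = s ^ num_noise ws"
    using Cons by blast
  have R: "?R \<in> carrier_mat q q" using U A by auto
  have wc: "word_prod q ?R False ws \<in> carrier_mat q q" using word_prod_carrier[OF R ws(1)] .
  note c = A Z Z' U(1) R wc
  have RT: "A\<^sup>T * Y = ?R\<^sup>T * (U\<^sup>T * Y)" if "Y \<in> carrier_mat p q" for Y
  proof -
    have "A\<^sup>T = (U * ?R)\<^sup>T" using U(2) by simp
    also have "\<dots> = ?R\<^sup>T * U\<^sup>T" using c by (simp add: transpose_mult[of U p q ?R q])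
    finally show ?thesis using c that by (simp add: assoc_mult_mat[of _ q q _ p _ q])
  qed
  have RT': "Y\<^sup>T * A = (U\<^sup>T * Y)\<^sup>T * ?R" if "Y \<in> carrier_mat p q" for Y
  proof -
    have "Y\<^sup>T * A = Y\<^sup>T * (U * ?R)" using U(2) by simp
    also have "\<dots> = (Y\<^sup>T * U) * ?R" using c that by (simp add: assoc_mult_mat[of _ q p _ q _ q])
    also have "Y\<^sup>T * U = (U\<^sup>T * Y)\<^sup>T" using c that by (simp add: transpose_mult[of _ q p _ q])
    finally show ?thesis .
  qed
  note cc = assoc_mult_mat[of _ q q _ q _ q]
  have XT: "opnorm_sq_le q s (U\<^sup>T * Z)\<^sup>T" by (rule opnorm_sq_le_transpose[OF X])
  have xc: "U\<^sup>T * Z \<in> carrier_mat q q" "U\<^sup>T * Z' \<in> carrier_mat q q" "Z\<^sup>T * Z' \<in> carrier_mat q q"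
    using c by auto
  consider "a" "b" | "a" "\<not> b" | "\<not> a" "b" | "\<not> a" "\<not> b" by blast
  then show ?case
  proof cases
    case 1
    have "gram_word q A Z Z' (ab # xs) = word_prod q ?R False (None # None # ws)"
      using 1 R wc by (simp add: ab ws(2) RT[OF A] cc[OF _ _ wc])
    then show ?thesis using ws by (intro exI[of _ "None # None # ws"]) simp
  next
    case 2
    have "gram_word q A Z Z' (ab # xs) = word_prod q ?R False (None # Some (U\<^sup>T * Z', s) # ws)"
      using 2 R wc xc by (simp add: ab ws(2) RT[OF Z'] cc[OF _ _ wc])
    then show ?thesis using ws X' by (intro exI[of _ "None # Some (U\<^sup>T * Z', s) # ws"]) simp
  next
    case 3
    have "gram_word q A Z Z' (ab # xs) = word_prod q ?R False (Some ((U\<^sup>T * Z)\<^sup>T, s) # None # ws)"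
      using 3 R wc xc by (simp add: ab ws(2) RT'[OF Z] cc[OF _ _ wc])
    then show ?thesis using ws XT by (intro exI[of _ "Some ((U\<^sup>T * Z)\<^sup>T, s) # None # ws"]) simp
  next
    case 4
    \<comment> \<open>The identity letter fills the second position of the pair, so that parities are preserved.\<close>
    have "gram_word q A Z Z' (ab # xs) = word_prod q ?R False (Some (Z\<^sup>T * Z', s\<^sup>2) # Some (1\<^sub>m q, 1) # ws)"
      using 4 R wc xc by (simp add: ab ws(2))
    then show ?thesis using ws W opnorm_sq_le_one
      by (intro exI[of _ "Some (Z\<^sup>T * Z', s\<^sup>2) # Some (1\<^sub>m q, 1) # ws"]) (simp add: power2_eq_square)
  qed
qed

lemma young_power:
  fixes x s :: real
  assumes "x \<ge> 0" "s \<ge> 0"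
  shows "x ^ a * s ^ b \<le> x ^ (a + b) + s ^ (a + b)"
proof (cases "x \<le> s")
  case True
  then have "x ^ a * s ^ b \<le> s ^ a * s ^ b" using assms by (intro mult_right_mono power_mono) auto
  then show ?thesis using assms by (simp add: power_add add_increasing)
next
  case False
  then have "x ^ a * s ^ b \<le> x ^ a * x ^ b" using assms by (intro mult_left_mono power_mono) auto
  then show ?thesis using assms by (simp add: power_add add_increasing2)
qed

text \<open>The Hoelder bound \<open>s\<^sup>b \<Sum> \<sigma>\<^sub>i\<^sup>2\<^sup>a\<close> depends on the pattern of signal and noise. Young's inequality
  for each singular value bounds it by its two extremes, which depend only on the length.\<close>
lemma frob_sq_word_le_singular_values:
  assumes A: "A \<in> carrier_mat p q" and U: "U \<in> carrier_mat p q" "U * (U\<^sup>T * A) = A"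
    and ok: "word_ok q ws" "word_cost ws = s ^ num_noise ws" and s: "s \<ge> 0"
  shows "frob_sq (word_prod q (U\<^sup>T * A) b ws) \<le>
    real q * s ^ length ws + (\<Sum>i=1..q. singular_value i A ^ (2 * length ws))"
proof -
  let ?R = "U\<^sup>T * A" and ?a = "num_signal ws" and ?b = "num_noise ws"
  have R: "?R \<in> carrier_mat q q" using U A by auto
  have len: "?a + ?b = length ws"
  proof (induction ws)
    case (Cons x xs)
    then show ?case by (cases x) auto
  qed simp
  have "?R\<^sup>T * ?R = A\<^sup>T * A"
  proof -
    have "?R\<^sup>T = A\<^sup>T * U" using U A by (simp add: transpose_mult[of _ q p _ q])
    then have "?R\<^sup>T * ?R = A\<^sup>T * (U * ?R)"
      using U A R by (simp add: assoc_mult_mat[of _ q p _ q _ q])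
    then show ?thesis using U(2) by simp
  qed
  then have "frob_sq (word_prod q ?R b ws) \<le> s ^ ?b * mtrace ((A\<^sup>T * A) ^\<^sub>m ?a)"
    using frob_sq_word_le[OF R ok(1), of b] ok(2) by simp
  also have "\<dots> = (\<Sum>i=1..q. (singular_value i A ^ 2) ^ ?a * s ^ ?b)"
    unfolding sum_singular_value_powers[OF A, symmetric] sum_distrib_left
    by (intro sum.cong refl) (simp only: power_mult mult.commute[of _ "s ^ num_noise ws"])
  also have "\<dots> \<le> (\<Sum>i=1..q. (singular_value i A ^ 2) ^ (?a + ?b) + s ^ (?a + ?b))"
    using s by (intro sum_mono young_power) auto
  also have "\<dots> = real q * s ^ length ws + (\<Sum>i=1..q. singular_value i A ^ (2 * length ws))"
    unfolding len by (simp add: sum.distrib power_mult)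
  finally show ?thesis .
qed

text \<open>The letter in front of the word is not preceded by another one and so is not compressed. If it is
  \<open>A = U R\<close>, then \<open>U\<close> is a contraction and \<open>R\<close> one more signal letter; if it is noise, then it is split
  off with its full operator norm.\<close>
lemma frob_sq_open_word_le:
  assumes A: "A \<in> carrier_mat p q" and Z: "Z \<in> carrier_mat p q" and Z': "Z' \<in> carrier_mat p q"
    and U: "U \<in> carrier_mat p q" "U * (U\<^sup>T * A) = A"
      "\<And>v::nat \<Rightarrow> real. (\<Sum>r<p. (\<Sum>l<q. U $$ (r, l) * v l)\<^sup>2) \<le> (\<Sum>l<q. (v l)\<^sup>2)"
    and X: "opnorm_sq_le q s (U\<^sup>T * Z)" and X': "opnorm_sq_le q s (U\<^sup>T * Z')"
    and W: "opnorm_sq_le q (s\<^sup>2) (Z\<^sup>T * Z')"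
    and c: "c \<ge> 0" and opZ': "\<And>v::nat \<Rightarrow> real. (\<Sum>r<p. (\<Sum>l<q. Z' $$ (r, l) * v l)\<^sup>2) \<le> c * (\<Sum>l<q. (v l)\<^sup>2)"
    and n: "length xs = n"
  shows "frob_sq (A * gram_word q A Z Z' xs) \<le>
      real q * s ^ (2 * n + 1) + (\<Sum>i=1..q. singular_value i A ^ (4 * n + 2))"
    and "frob_sq (Z' * gram_word q A Z Z' xs) \<le>
      c * (real q * s ^ (2 * n) + (\<Sum>i=1..q. singular_value i A ^ (4 * n)))"
proof -
  have s: "s \<ge> 0" using X by (simp add: opnorm_sq_le_def)
  let ?R = "U\<^sup>T * A"
  have R: "?R \<in> carrier_mat q q" using U A by auto
  obtain ws where ws: "word_ok q ws" "gram_word q A Z Z' xs = word_prod q ?R False ws"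
     "length ws = 2 * n" "word_cost ws = s ^ num_noise ws"
    using gram_word_eq_word_prod[OF A Z Z' U(1,2) X X' W] n by blast
  have wc: "word_prod q ?R False ws \<in> carrier_mat q q" using word_prod_carrier[OF R ws(1)] .
  have "A * gram_word q A Z Z' xs = U * (?R * word_prod q ?R False ws)"
  proof -
    have "U * (?R * word_prod q ?R False ws) = U * ?R * word_prod q ?R False ws"
      by (rule assoc_mult_mat[OF U(1) R wc, symmetric])
    then show ?thesis by (simp only: U(2) ws(2))
  qed
  then have "frob_sq (A * gram_word q A Z Z' xs) = frob_sq (U * word_prod q ?R True (None # ws))"
    by simp
  also have "\<dots> \<le> 1 * frob_sq (word_prod q ?R True (None # ws))"
    using U R wc by (intro frob_sq_mult_left[where m = p and n = q and l = q]) auto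
  also have "\<dots> \<le> 1 * (real q * s ^ length (None # ws) + (\<Sum>i=1..q. singular_value i A ^ (2 * length (None # ws))))"
    using ws s by (intro mult_left_mono frob_sq_word_le_singular_values[OF A U(1,2)]) auto
  also have "\<dots> = real q * s ^ (2 * n + 1) + (\<Sum>i=1..q. singular_value i A ^ (4 * n + 2))"
    using ws(3) by simp
  finally show "frob_sq (A * gram_word q A Z Z' xs) \<le>
      real q * s ^ (2 * n + 1) + (\<Sum>i=1..q. singular_value i A ^ (4 * n + 2))" .
  have "frob_sq (Z' * gram_word q A Z Z' xs) \<le> c * frob_sq (word_prod q ?R False ws)"
    unfolding ws(2) by (rule frob_sq_mult_left[OF Z' c opZ' wc])
  also have "\<dots> \<le> c * (real q * s ^ length ws + (\<Sum>i=1..q. singular_value i A ^ (2 * length ws)))"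
    using ws s c by (intro mult_left_mono frob_sq_word_le_singular_values[OF A U(1,2)]) auto
  finally show "frob_sq (Z' * gram_word q A Z Z' xs) \<le>
      c * (real q * s ^ (2 * n) + (\<Sum>i=1..q. singular_value i A ^ (4 * n)))"
    using ws(3) by simp
qed

section \<open>Moments of the operator norms of Gaussian matrices\<close>

lemma sigma_finite_gauss: "sigma_finite_measure (gauss I)"
  using prob_space_gauss[of I] prob_space_imp_sigma_finite by blast

lemma nn_integral_gauss_swap:
  assumes f: "(\<lambda>x. f (fst x) (snd x)) \<in> borel_measurable (gauss I \<Otimes>\<^sub>M gauss J)"
  shows "(\<integral>\<^sup>+x. \<integral>\<^sup>+y. f x y \<partial>gauss J \<partial>gauss I) = (\<integral>\<^sup>+y. \<integral>\<^sup>+x. f x y \<partial>gauss I \<partial>gauss J)"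
proof -
  interpret P: pair_sigma_finite "gauss I" "gauss J"
    by (simp add: pair_sigma_finite_def sigma_finite_gauss)
  show ?thesis using P.Fubini'[of f] f by (simp add: case_prod_unfold)
qed

lemma nn_integral_gauss_swap3:
  assumes f: "(\<lambda>x. f (fst x) (fst (snd x)) (snd (snd x))) \<in>
    borel_measurable (gauss I \<Otimes>\<^sub>M (gauss J \<Otimes>\<^sub>M gauss K))"
  shows "(\<integral>\<^sup>+x. \<integral>\<^sup>+y. \<integral>\<^sup>+z. f x y z \<partial>gauss K \<partial>gauss J \<partial>gauss I) =
    (\<integral>\<^sup>+y. \<integral>\<^sup>+z. \<integral>\<^sup>+x. f x y z \<partial>gauss I \<partial>gauss K \<partial>gauss J)"
proof -
  interpret I: sigma_finite_measure "gauss I" by (rule sigma_finite_gauss)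
  interpret K: sigma_finite_measure "gauss K" by (rule sigma_finite_gauss)
  interpret JK: pair_sigma_finite "gauss J" "gauss K"
    by (simp add: pair_sigma_finite_def sigma_finite_gauss)
  interpret P: pair_sigma_finite "gauss I" "gauss J \<Otimes>\<^sub>M gauss K"
    by (simp add: pair_sigma_finite_def sigma_finite_gauss JK.sigma_finite_measure_axioms)
  have m1: "(\<lambda>w. f x (fst w) (snd w)) \<in> borel_measurable (gauss J \<Otimes>\<^sub>M gauss K)"
    if "x \<in> space (gauss I)" for x
    using measurable_compose[OF measurable_Pair1'[OF that] f] by simp
  have m2: "(\<lambda>w. \<integral>\<^sup>+x. f x (fst w) (snd w) \<partial>gauss I) \<in> borel_measurable (gauss J \<Otimes>\<^sub>M gauss K)"
  proof (rule I.borel_measurable_nn_integral)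
    have "(\<lambda>v. (snd v, fst v)) \<in> measurable ((gauss J \<Otimes>\<^sub>M gauss K) \<Otimes>\<^sub>M gauss I) (gauss I \<Otimes>\<^sub>M (gauss J \<Otimes>\<^sub>M gauss K))"
      by measurable
    from measurable_compose[OF this f]
    show "(\<lambda>(w, x). f x (fst w) (snd w)) \<in> borel_measurable ((gauss J \<Otimes>\<^sub>M gauss K) \<Otimes>\<^sub>M gauss I)"
      by (simp add: case_prod_unfold)
  qed
  have "(\<integral>\<^sup>+x. \<integral>\<^sup>+y. \<integral>\<^sup>+z. f x y z \<partial>gauss K \<partial>gauss J \<partial>gauss I) =
     (\<integral>\<^sup>+x. \<integral>\<^sup>+w. f x (fst w) (snd w) \<partial>(gauss J \<Otimes>\<^sub>M gauss K) \<partial>gauss I)"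
    using K.nn_integral_fst[OF m1] by (intro nn_integral_cong) simp
  also have "\<dots> = (\<integral>\<^sup>+w. \<integral>\<^sup>+x. f x (fst w) (snd w) \<partial>gauss I \<partial>(gauss J \<Otimes>\<^sub>M gauss K))"
    using P.Fubini'[of "\<lambda>x w. f x (fst w) (snd w)"] f by (simp add: case_prod_unfold)
  also have "\<dots> = (\<integral>\<^sup>+y. \<integral>\<^sup>+z. \<integral>\<^sup>+x. f x y z \<partial>gauss I \<partial>gauss K \<partial>gauss J)"
    using K.nn_integral_fst[OF m2] by simp
  finally show ?thesis .
qed

lemma measurable_gauss_component_comp:
  assumes "f \<in> measurable N (gauss I)" "i \<in> I"
  shows "(\<lambda>x. f x i) \<in> borel_measurable N"
  using measurable_compose[OF assms(1) measurable_gauss_component[OF assms(2)]] .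

lemma measurable_bilin_mom:
  assumes fin: "finite I" "finite J"
    and X: "\<And>i j. i \<in> I \<Longrightarrow> j \<in> J \<Longrightarrow> (\<lambda>\<zeta>. X \<zeta> i j) \<in> borel_measurable N"
  shows "(\<lambda>\<zeta>. bilin_mom M I J (X \<zeta>)) \<in> borel_measurable N"
proof -
  interpret I: sigma_finite_measure "gauss I" by (rule sigma_finite_gauss)
  interpret J: sigma_finite_measure "gauss J" by (rule sigma_finite_gauss)
  have 1: "(\<lambda>w. ennreal ((\<Sum>i\<in>I. \<Sum>j\<in>J. snd (fst w) i * X (fst (fst w)) i j * snd w j) ^ (2 * M)))
      \<in> borel_measurable ((N \<Otimes>\<^sub>M gauss I) \<Otimes>\<^sub>M gauss J)"
  proof (intro measurable_compose[OF _ measurable_ennreal] borel_measurable_power borel_measurable_sum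
      borel_measurable_times)
    fix i j assume ij: "i \<in> I" "j \<in> J"
    have "(\<lambda>w. snd (fst w)) \<in> measurable ((N \<Otimes>\<^sub>M gauss I) \<Otimes>\<^sub>M gauss J) (gauss I)" by measurable
    then show "(\<lambda>w. snd (fst w) i) \<in> borel_measurable ((N \<Otimes>\<^sub>M gauss I) \<Otimes>\<^sub>M gauss J)"
      by (rule measurable_gauss_component_comp[OF _ ij(1)])
    have "(\<lambda>w. fst (fst w)) \<in> measurable ((N \<Otimes>\<^sub>M gauss I) \<Otimes>\<^sub>M gauss J) N" by measurable
    from measurable_compose[OF this X[OF ij]]
    show "(\<lambda>w. X (fst (fst w)) i j) \<in> borel_measurable ((N \<Otimes>\<^sub>M gauss I) \<Otimes>\<^sub>M gauss J)" .
    show "(\<lambda>w. snd w j) \<in> borel_measurable ((N \<Otimes>\<^sub>M gauss I) \<Otimes>\<^sub>M gauss J)"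
      by (rule measurable_gauss_component_comp[OF measurable_snd ij(2)])
  qed
  have 2: "(\<lambda>v. \<integral>\<^sup>+h. ennreal ((\<Sum>i\<in>I. \<Sum>j\<in>J. snd v i * X (fst v) i j * h j) ^ (2 * M)) \<partial>gauss J)
      \<in> borel_measurable (N \<Otimes>\<^sub>M gauss I)"
    using 1 by (intro J.borel_measurable_nn_integral) (simp add: case_prod_unfold)
  show ?thesis unfolding bilin_mom_def
    using 2 by (intro I.borel_measurable_nn_integral) (simp add: case_prod_unfold)
qed

text \<open>The bilinear form \<open>\<alpha>\<^sup>T Z \<beta>\<close> is linear in the noise of colour \<open>c\<close>, with variance
  \<open>\<parallel>\<alpha>\<parallel>\<^sup>2 \<parallel>\<beta>\<parallel>\<^sup>2\<close>.\<close>
lemma gauss_rank_one_moment: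
  fixes C :: "'c set" and p q :: nat and \<alpha> \<beta> :: "nat \<Rightarrow> real"
  assumes C: "finite C" "c \<in> C"
  shows "(\<integral>\<^sup>+\<zeta>. ennreal ((\<Sum>r<p. \<Sum>s<q. \<alpha> r * \<beta> s * \<zeta> (c, r, s)) ^ (2 * M))
      \<partial>gauss (C \<times> ({..<p} \<times> {..<q}))) =
    ennreal (normal_mom M * ((\<Sum>r<p. (\<alpha> r)\<^sup>2) * (\<Sum>s<q. (\<beta> s)\<^sup>2)) ^ M)"
proof -
  define co where "co = (\<lambda>(c', r, s). if c' = c then \<alpha> r * \<beta> s else 0)"
  let ?J = "C \<times> ({..<p} \<times> {..<q})"
  have fin: "finite ?J" using C by auto
  have sub: "(\<Sum>j\<in>?J. F j) = (\<Sum>r<p. \<Sum>s<q. F (c, r, s))"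
    if "\<And>c' r s. c' \<noteq> c \<Longrightarrow> F (c', r, s) = 0" for F :: "'c \<times> nat \<times> nat \<Rightarrow> real"
  proof -
    have "(\<Sum>j\<in>?J. F j) = (\<Sum>j\<in>{c} \<times> ({..<p} \<times> {..<q}). F j)"
      using C fin that by (intro sum.mono_neutral_right) auto
    also have "\<dots> = (\<Sum>c'\<in>{c}. \<Sum>r<p. \<Sum>s<q. F (c', r, s))"
      by (simp only: sum.cartesian_product case_prod_eta split_def) simp
    finally show ?thesis by simp
  qed
  have "(\<Sum>r<p. \<Sum>s<q. \<alpha> r * \<beta> s * \<zeta> (c, r, s)) = (\<Sum>j\<in>?J. co j * \<zeta> j)" for \<zeta>
    by (subst sub) (auto simp: co_def)
  moreover have "(\<Sum>j\<in>?J. (co j)\<^sup>2) = (\<Sum>r<p. (\<alpha> r)\<^sup>2) * (\<Sum>s<q. (\<beta> s)\<^sup>2)"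
    by (subst sub) (auto simp: co_def sum_product power_mult_distrib)
  ultimately show ?thesis using gauss_linear_moment[OF fin, of co M] by simp
qed

lemma sum_sq_power_nonneg: "(\<Sum>i\<in>K. (x i)\<^sup>2) ^ M \<ge> (0::real)"
  by (simp add: sum_nonneg)

lemma ennreal_mult_eqI:
  "a \<ge> 0 \<Longrightarrow> b \<ge> 0 \<Longrightarrow> c \<ge> 0 \<Longrightarrow> d \<ge> 0 \<Longrightarrow> a * b = c * d \<Longrightarrow>
    ennreal a * ennreal b = ennreal c * ennreal d"
  by (metis ennreal_mult)

lemma ennreal_split_power:
  "a \<ge> 0 \<Longrightarrow> x \<ge> 0 \<Longrightarrow> y \<ge> 0 \<Longrightarrow> ennreal (a * (x * y) ^ M) = ennreal (a * y ^ M) * ennreal (x ^ M)"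
  by (subst ennreal_mult[symmetric]) (auto simp: power_mult_distrib mult_ac)

lemma nn_integral_norm_products:
  assumes fin: "finite I" "finite J" and "a \<ge> 0"
  shows "(\<integral>\<^sup>+g. \<integral>\<^sup>+h. ennreal (a * (\<Sum>i\<in>I. (g i)\<^sup>2) ^ M * (\<Sum>j\<in>J. (h j)\<^sup>2) ^ M) \<partial>gauss J \<partial>gauss I) =
    ennreal (a * chi_mom (card I) M * chi_mom (card J) M)"
proof -
  note nn = sum_sq_power_nonneg
  have "(\<integral>\<^sup>+g. \<integral>\<^sup>+h. ennreal (a * (\<Sum>i\<in>I. (g i)\<^sup>2) ^ M * (\<Sum>j\<in>J. (h j)\<^sup>2) ^ M) \<partial>gauss J \<partial>gauss I) =
    (\<integral>\<^sup>+g. \<integral>\<^sup>+h. ennreal (a * (\<Sum>i\<in>I. (g i)\<^sup>2) ^ M) * ennreal ((\<Sum>j\<in>J. (h j)\<^sup>2) ^ M) \<partial>gauss J \<partial>gauss I)"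
    using \<open>a \<ge> 0\<close> by (intro nn_integral_cong ennreal_mult mult_nonneg_nonneg nn)
  also have "\<dots> = (\<integral>\<^sup>+g. ennreal (a * (\<Sum>i\<in>I. (g i)\<^sup>2) ^ M) * ennreal (chi_mom (card J) M) \<partial>gauss I)"
    by (intro nn_integral_cong, subst nn_integral_cmult, measurable)
       (simp only: gauss_norm_moment[OF fin(2)] chi_mom_def)
  also have "\<dots> = (\<integral>\<^sup>+g. ennreal (a * chi_mom (card J) M) * ennreal ((\<Sum>i\<in>I. (g i)\<^sup>2) ^ M) \<partial>gauss I)"
    using \<open>a \<ge> 0\<close> nn[of _ I] chi_mom_nonneg[of "card J" M]
    by (intro nn_integral_cong) (simp add: mult_ac flip: ennreal_mult)
  also have "\<dots> = ennreal (a * chi_mom (card J) M) * ennreal (chi_mom (card I) M)"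
    by (subst nn_integral_cmult, measurable) (simp only: gauss_norm_moment[OF fin(1)] chi_mom_def)
  finally show ?thesis
    using \<open>a \<ge> 0\<close> chi_mom_nonneg[of "card J" M] chi_mom_nonneg[of "card I" M]
    by (simp add: mult_ac flip: ennreal_mult)
qed

text \<open>Integrated over the noise first, the form \<open>g\<^sup>T u\<^sup>T Z h\<close> has variance
  \<open>\<parallel>u g\<parallel>\<^sup>2 \<parallel>h\<parallel>\<^sup>2 \<le> \<parallel>g\<parallel>\<^sup>2 \<parallel>h\<parallel>\<^sup>2\<close>. With \<open>u = U\<close> this concerns the compressed noise, with \<open>u\<close> the
  identity the noise matrix itself.\<close>
lemma bilin_mom_projected_noise:
  fixes C :: "'c set" and p q :: nat and u :: "nat \<Rightarrow> 'g \<Rightarrow> real"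
  assumes C: "finite C" "c \<in> C" and G: "finite G"
    and u: "\<And>g :: 'g \<Rightarrow> real. (\<Sum>r<p. (\<Sum>i\<in>G. u r i * g i)\<^sup>2) \<le> (\<Sum>i\<in>G. (g i)\<^sup>2)"
  shows "(\<integral>\<^sup>+\<zeta>. bilin_mom M G {..<q} (\<lambda>i s. \<Sum>r<p. u r i * \<zeta> (c, r, s))
      \<partial>gauss (C \<times> ({..<p} \<times> {..<q}))) \<le>
    ennreal (normal_mom M * chi_mom (card G) M * chi_mom q M)"
proof -
  let ?J = "C \<times> ({..<p} \<times> {..<q})"
  define f where "f \<zeta> g h = ennreal ((\<Sum>i\<in>G. \<Sum>s<q. g i * (\<Sum>r<p. u r i * \<zeta> (c, r, s)) * h s) ^ (2 * M))"
    for \<zeta> :: "'c \<times> nat \<times> nat \<Rightarrow> real" and g :: "'g \<Rightarrow> real" and h :: "nat \<Rightarrow> real"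
  have "(\<lambda>x. f (fst x) (fst (snd x)) (snd (snd x))) \<in>
      borel_measurable (gauss ?J \<Otimes>\<^sub>M (gauss G \<Otimes>\<^sub>M gauss {..<q}))"
    unfolding f_def
    by (intro measurable_compose[OF _ measurable_ennreal] borel_measurable_power borel_measurable_sum
        borel_measurable_times borel_measurable_const)
       (use C in \<open>auto intro!: measurable_gauss_component_comp\<close>)
  then have "(\<integral>\<^sup>+\<zeta>. bilin_mom M G {..<q} (\<lambda>i s. \<Sum>r<p. u r i * \<zeta> (c, r, s)) \<partial>gauss ?J) =
      (\<integral>\<^sup>+g. \<integral>\<^sup>+h. \<integral>\<^sup>+\<zeta>. f \<zeta> g h \<partial>gauss ?J \<partial>gauss {..<q} \<partial>gauss G)"
    unfolding bilin_mom_def f_def[symmetric] by (rule nn_integral_gauss_swap3)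
  also have "\<dots> = (\<integral>\<^sup>+g. \<integral>\<^sup>+h. ennreal (normal_mom M *
      ((\<Sum>r<p. (\<Sum>i\<in>G. u r i * g i)\<^sup>2) * (\<Sum>s<q. (h s)\<^sup>2)) ^ M) \<partial>gauss {..<q} \<partial>gauss G)"
  proof (intro nn_integral_cong)
    fix g :: "'g \<Rightarrow> real" and h :: "nat \<Rightarrow> real"
    have "(\<Sum>i\<in>G. \<Sum>s<q. g i * (\<Sum>r<p. u r i * \<zeta> (c, r, s)) * h s) =
        (\<Sum>r<p. \<Sum>s<q. (\<Sum>i\<in>G. u r i * g i) * h s * \<zeta> (c, r, s))" for \<zeta>
    proof -
      have "(\<Sum>i\<in>G. \<Sum>s<q. g i * (\<Sum>r<p. u r i * \<zeta> (c, r, s)) * h s) =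
          (\<Sum>i\<in>G. \<Sum>s<q. \<Sum>r<p. u r i * g i * h s * \<zeta> (c, r, s))"
        by (simp add: sum_distrib_left sum_distrib_right mult_ac)
      also have "\<dots> = (\<Sum>i\<in>G. \<Sum>r<p. \<Sum>s<q. u r i * g i * h s * \<zeta> (c, r, s))"
        by (intro sum.cong refl sum.swap)
      also have "\<dots> = (\<Sum>r<p. \<Sum>i\<in>G. \<Sum>s<q. u r i * g i * h s * \<zeta> (c, r, s))"
        by (rule sum.swap)
      also have "\<dots> = (\<Sum>r<p. \<Sum>s<q. \<Sum>i\<in>G. u r i * g i * h s * \<zeta> (c, r, s))"
        by (intro sum.cong refl sum.swap)
      finally show ?thesis by (simp add: sum_distrib_right)
    qed
    then show "(\<integral>\<^sup>+\<zeta>. f \<zeta> g h \<partial>gauss ?J) = ennreal (normal_mom M *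
      ((\<Sum>r<p. (\<Sum>i\<in>G. u r i * g i)\<^sup>2) * (\<Sum>s<q. (h s)\<^sup>2)) ^ M)"
      unfolding f_def by (simp only: gauss_rank_one_moment[OF C])
  qed
  also have "\<dots> \<le> (\<integral>\<^sup>+g. \<integral>\<^sup>+h. ennreal (normal_mom M * (\<Sum>i\<in>G. (g i)\<^sup>2) ^ M * (\<Sum>s<q. (h s)\<^sup>2) ^ M)
      \<partial>gauss {..<q} \<partial>gauss G)"
    unfolding power_mult_distrib mult.assoc
    by (intro nn_integral_mono ennreal_leI mult_left_mono mult_right_mono power_mono u)
       (auto simp: sum_nonneg normal_mom_pos less_imp_le)
  also have "\<dots> = ennreal (normal_mom M * chi_mom (card G) M * chi_mom q M)"
    using nn_integral_norm_products[OF G finite_lessThan[of q], where a = "normal_mom M" and M = M]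
      normal_mom_pos[of M] by simp
  finally show ?thesis .
qed

text \<open>Multiplied by \<open>normal_mom M\<close>, the power \<open>\<parallel>Z g\<parallel>\<^sup>2\<^sup>M\<close> is the average of \<open>(y\<^sup>T Z g)\<^sup>2\<^sup>M\<close> over a
  Gaussian vector \<open>y\<close>, and the noise can be integrated out before \<open>y\<close>.\<close>
lemma noise_times_vector_moment:
  fixes C :: "'c set" and p q :: nat and g :: "nat \<Rightarrow> real"
  assumes C: "finite C" "c \<in> C"
  shows "(\<integral>\<^sup>+\<zeta>. ennreal ((\<Sum>r<p. (\<Sum>s<q. g s * \<zeta> (c, r, s))\<^sup>2) ^ M) \<partial>gauss (C \<times> ({..<p} \<times> {..<q}))) =
    ennreal (chi_mom p M * (\<Sum>s<q. (g s)\<^sup>2) ^ M)" (is "?L = _")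
proof -
  let ?J = "C \<times> ({..<p} \<times> {..<q})"
  define f where "f \<zeta> y = ennreal ((\<Sum>r<p. (\<Sum>s<q. g s * \<zeta> (c, r, s)) * y r) ^ (2 * M))"
    for \<zeta> :: "'c \<times> nat \<times> nat \<Rightarrow> real" and y :: "nat \<Rightarrow> real"
  have m: "(\<lambda>x. f (fst x) (snd x)) \<in> borel_measurable (gauss ?J \<Otimes>\<^sub>M gauss {..<p})"
    unfolding f_def
    by (intro measurable_compose[OF _ measurable_ennreal] borel_measurable_power borel_measurable_sum
        borel_measurable_times borel_measurable_const)
       (use C in \<open>auto intro!: measurable_gauss_component_comp\<close>)
  note nn = sum_sq_power_nonneg
  have m0: "normal_mom M \<ge> 0" using normal_mom_pos[of M] by simp
  have "ennreal (normal_mom M) * ?L = (\<integral>\<^sup>+\<zeta>. ennreal (normal_mom M) * ennreal ((\<Sum>r<p. (\<Sum>s<q. g s * \<zeta> (c, r, s))\<^sup>2) ^ M) \<partial>gauss ?J)"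
    using C by (intro nn_integral_cmult[symmetric]) measurable
  also have "\<dots> = (\<integral>\<^sup>+\<zeta>. \<integral>\<^sup>+y. f \<zeta> y \<partial>gauss {..<p} \<partial>gauss ?J)"
    unfolding f_def gauss_linear_moment[OF finite_lessThan]
    using nn m0 by (intro nn_integral_cong ennreal_mult[symmetric]) auto
  also have "\<dots> = (\<integral>\<^sup>+y. \<integral>\<^sup>+\<zeta>. f \<zeta> y \<partial>gauss ?J \<partial>gauss {..<p})"
    by (rule nn_integral_gauss_swap[OF m])
  also have "\<dots> = (\<integral>\<^sup>+y. ennreal (normal_mom M * ((\<Sum>r<p. (y r)\<^sup>2) * (\<Sum>s<q. (g s)\<^sup>2)) ^ M) \<partial>gauss {..<p})"
  proof (rule nn_integral_cong)
    fix y :: "nat \<Rightarrow> real"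
    have "(\<Sum>r<p. (\<Sum>s<q. g s * \<zeta> (c, r, s)) * y r) = (\<Sum>r<p. \<Sum>s<q. y r * g s * \<zeta> (c, r, s))" for \<zeta>
      by (simp add: sum_distrib_left sum_distrib_right mult_ac)
    then show "(\<integral>\<^sup>+\<zeta>. f \<zeta> y \<partial>gauss ?J) = ennreal (normal_mom M * ((\<Sum>r<p. (y r)\<^sup>2) * (\<Sum>s<q. (g s)\<^sup>2)) ^ M)"
      unfolding f_def by (simp only: gauss_rank_one_moment[OF C])
  qed
  also have "\<dots> = (\<integral>\<^sup>+y. ennreal (normal_mom M * (\<Sum>s<q. (g s)\<^sup>2) ^ M) * ennreal ((\<Sum>r<p. (y r)\<^sup>2) ^ M) \<partial>gauss {..<p})"
    using m0 by (intro nn_integral_cong ennreal_split_power sum_nonneg) auto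
  also have "\<dots> = ennreal (normal_mom M * (\<Sum>s<q. (g s)\<^sup>2) ^ M) * ennreal (chi_mom p M)"
    by (subst nn_integral_cmult, measurable) (simp add: gauss_norm_moment chi_mom_def)
  also have "\<dots> = ennreal (normal_mom M) * ennreal (chi_mom p M * (\<Sum>s<q. (g s)\<^sup>2) ^ M)"
    using nn m0 chi_mom_nonneg[of p M] by (intro ennreal_mult_eqI mult_nonneg_nonneg) auto
  finally show ?thesis
    using normal_mom_pos[of M] by (simp add: ennreal_mult_cancel_left)
qed

text \<open>Integrating over \<open>Z\<^sub>1\<close> with \<open>x = Z\<^sub>0 g\<close> held fixed leaves \<open>normal_mom M \<parallel>x\<parallel>\<^sup>2\<^sup>M \<parallel>h\<parallel>\<^sup>2\<^sup>M\<close>, and then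
  \<open>noise_times_vector_moment\<close> takes care of \<open>Z\<^sub>0\<close>.\<close>
lemma bilin_mom_product_of_noises:
  "(\<integral>\<^sup>+\<zeta>. bilin_mom M {..<q} {..<q} (\<lambda>l s. \<Sum>r<p. \<zeta> (0, r, l) * \<zeta> (Suc 0, r, s))
      \<partial>gauss ({0, Suc 0} \<times> ({..<p} \<times> {..<q}))) =
    ennreal (normal_mom M * chi_mom p M * chi_mom q M * chi_mom q M)"
proof -
  let ?I = "{..<p} \<times> {..<q}"
  let ?J = "{0, Suc 0} \<times> ?I"
  define f where "f \<zeta> g h = ennreal ((\<Sum>l<q. \<Sum>s<q. g l * (\<Sum>r<p. \<zeta> (0, r, l) * \<zeta> (Suc 0, r, s)) * h s) ^ (2 * M))"
    for \<zeta> :: "nat \<times> nat \<times> nat \<Rightarrow> real" and g :: "nat \<Rightarrow> real" and h :: "nat \<Rightarrow> real"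
  note nn = sum_sq_power_nonneg
  have m0: "normal_mom M \<ge> 0" using normal_mom_pos[of M] by simp
  have "(\<lambda>x. f (fst x) (fst (snd x)) (snd (snd x))) \<in>
      borel_measurable (gauss ?J \<Otimes>\<^sub>M (gauss {..<q} \<Otimes>\<^sub>M gauss {..<q}))"
    unfolding f_def
    by (intro measurable_compose[OF _ measurable_ennreal] borel_measurable_power borel_measurable_sum
        borel_measurable_times borel_measurable_const)
       (auto intro!: measurable_gauss_component_comp)
  then have "(\<integral>\<^sup>+\<zeta>. bilin_mom M {..<q} {..<q} (\<lambda>l s. \<Sum>r<p. \<zeta> (0, r, l) * \<zeta> (Suc 0, r, s)) \<partial>gauss ?J) =
      (\<integral>\<^sup>+g. \<integral>\<^sup>+h. \<integral>\<^sup>+\<zeta>. f \<zeta> g h \<partial>gauss ?J \<partial>gauss {..<q} \<partial>gauss {..<q})"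
    unfolding bilin_mom_def f_def[symmetric] by (rule nn_integral_gauss_swap3)
  also have "\<dots> = (\<integral>\<^sup>+g. \<integral>\<^sup>+h. ennreal (normal_mom M * chi_mom p M * (\<Sum>l<q. (g l)\<^sup>2) ^ M * (\<Sum>s<q. (h s)\<^sup>2) ^ M)
      \<partial>gauss {..<q} \<partial>gauss {..<q})"
  proof (intro nn_integral_cong)
    fix g h :: "nat \<Rightarrow> real"
    let ?x = "\<lambda>\<zeta> r. \<Sum>l<q. g l * \<zeta> (0::nat, r::nat, l)"
    define F where "F \<zeta> = ennreal ((\<Sum>r<p. \<Sum>s<q. ?x \<zeta> r * h s * \<zeta> (Suc 0, r, s)) ^ (2 * M))" for \<zeta> :: "nat \<times> nat \<times> nat \<Rightarrow> real"
    have "f \<zeta> g h = F \<zeta>" for \<zeta>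
    proof -
      have "(\<Sum>l<q. \<Sum>s<q. g l * (\<Sum>r<p. \<zeta> (0, r, l) * \<zeta> (Suc 0, r, s)) * h s) =
          (\<Sum>l<q. \<Sum>s<q. \<Sum>r<p. g l * \<zeta> (0, r, l) * h s * \<zeta> (Suc 0, r, s))"
        by (simp add: sum_distrib_left sum_distrib_right mult_ac)
      also have "\<dots> = (\<Sum>l<q. \<Sum>r<p. \<Sum>s<q. g l * \<zeta> (0, r, l) * h s * \<zeta> (Suc 0, r, s))"
        by (intro sum.cong refl sum.swap)
      also have "\<dots> = (\<Sum>r<p. \<Sum>l<q. \<Sum>s<q. g l * \<zeta> (0, r, l) * h s * \<zeta> (Suc 0, r, s))"
        by (rule sum.swap)
      also have "\<dots> = (\<Sum>r<p. \<Sum>s<q. \<Sum>l<q. g l * \<zeta> (0, r, l) * h s * \<zeta> (Suc 0, r, s))"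
        by (intro sum.cong refl sum.swap)
      finally show ?thesis unfolding f_def F_def by (simp add: sum_distrib_right)
    qed
    then have "(\<integral>\<^sup>+\<zeta>. f \<zeta> g h \<partial>gauss ?J) = (\<integral>\<^sup>+\<zeta>. F \<zeta> \<partial>gauss ({0} \<times> ?I \<union> {Suc 0} \<times> ?I))"
      by (simp only: insert_Times_insert Sigma_Un_distrib1[symmetric] insert_is_Un[of 0 "{Suc 0}", symmetric])
    also have "\<dots> = (\<integral>\<^sup>+x. \<integral>\<^sup>+y. F (merge ({0} \<times> ?I) ({Suc 0} \<times> ?I) (x, y)) \<partial>gauss ({Suc 0} \<times> ?I) \<partial>gauss ({0} \<times> ?I))"
      by (rule product_sigma_finite.product_nn_integral_fold[OF product_sigma_finite_stdN])
         (auto simp: F_def intro!: measurable_compose[OF _ measurable_ennreal] borel_measurable_power borel_measurable_sum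
        borel_measurable_times borel_measurable_const)
    also have "\<dots> = (\<integral>\<^sup>+x. ennreal (normal_mom M * ((\<Sum>r<p. (?x x r)\<^sup>2) * (\<Sum>s<q. (h s)\<^sup>2)) ^ M) \<partial>gauss ({0} \<times> ?I))"
    proof (rule nn_integral_cong)
      fix x :: "nat \<times> nat \<times> nat \<Rightarrow> real"
      have "F (merge ({0} \<times> ?I) ({Suc 0} \<times> ?I) (x, y)) =
          ennreal ((\<Sum>r<p. \<Sum>s<q. ?x x r * h s * y (Suc 0, r, s)) ^ (2 * M))" for y
        unfolding F_def by (intro arg_cong[where f = "\<lambda>t. ennreal (t ^ (2 * M))"] sum.cong refl)
          (auto simp: merge_def intro!: sum.cong)
      then show "(\<integral>\<^sup>+y. F (merge ({0} \<times> ?I) ({Suc 0} \<times> ?I) (x, y)) \<partial>gauss ({Suc 0} \<times> ?I)) =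
          ennreal (normal_mom M * ((\<Sum>r<p. (?x x r)\<^sup>2) * (\<Sum>s<q. (h s)\<^sup>2)) ^ M)"
        by (simp only: gauss_rank_one_moment[of "{Suc 0}" "Suc 0", simplified])
    qed
    also have "\<dots> = (\<integral>\<^sup>+x. ennreal (normal_mom M * (\<Sum>s<q. (h s)\<^sup>2) ^ M) * ennreal ((\<Sum>r<p. (?x x r)\<^sup>2) ^ M) \<partial>gauss ({0} \<times> ?I))"
      using m0 by (intro nn_integral_cong ennreal_split_power sum_nonneg) auto
    also have "\<dots> = ennreal (normal_mom M * (\<Sum>s<q. (h s)\<^sup>2) ^ M) * ennreal (chi_mom p M * (\<Sum>s<q. (g s)\<^sup>2) ^ M)"
      by (subst nn_integral_cmult, measurable)
         (simp only: noise_times_vector_moment[of "{0}" 0, simplified])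
    also have "\<dots> = ennreal (normal_mom M * chi_mom p M * (\<Sum>l<q. (g l)\<^sup>2) ^ M * (\<Sum>s<q. (h s)\<^sup>2) ^ M)"
      using nn m0 chi_mom_nonneg[of p M]
      by (subst ennreal_mult[symmetric])
         (auto simp: mult_ac sum_sq_power_nonneg intro!: mult_nonneg_nonneg)
    finally show "(\<integral>\<^sup>+\<zeta>. f \<zeta> g h \<partial>gauss ?J) =
       ennreal (normal_mom M * chi_mom p M * (\<Sum>l<q. (g l)\<^sup>2) ^ M * (\<Sum>s<q. (h s)\<^sup>2) ^ M)" .
  qed
  also have "\<dots> = ennreal (normal_mom M * chi_mom p M * chi_mom q M * chi_mom q M)"
    using nn_integral_norm_products[OF finite_lessThan[of q] finite_lessThan[of q],
        where a = "normal_mom M * chi_mom p M" and M = M]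
      m0 chi_mom_nonneg[of p M] by simp
  finally show ?thesis .
qed

section \<open>Decoupling\<close>

definition fibre_card :: "'u set \<Rightarrow> ('u \<Rightarrow> 'i) \<Rightarrow> 'i \<Rightarrow> nat" where
  "fibre_card S x i = card {u\<in>S. x u = i}"

text \<open>The number of bijections from \<open>S\<close> to \<open>T\<close> that preserve labels, for finite \<open>S\<close> and \<open>T\<close> with all labels in \<open>I\<close>.\<close>
definition matchings :: "'i set \<Rightarrow> 'u set \<Rightarrow> ('u \<Rightarrow> 'i) \<Rightarrow> 'v set \<Rightarrow> ('v \<Rightarrow> 'i) \<Rightarrow> real" where
  "matchings I S x T y =
     (\<Prod>i\<in>I. if fibre_card S x i = fibre_card T y i then fact (fibre_card S x i) else 0)"

lemma fibre_card_cong: "(\<And>u. u \<in> S \<Longrightarrow> x u = y u) \<Longrightarrow> fibre_card S x i = fibre_card S y i"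
  unfolding fibre_card_def by (rule arg_cong[where f = card]) auto

lemma fibre_card_insert:
  assumes "finite S" "u \<notin> S"
  shows "fibre_card (insert u S) x i = (if x u = i then Suc (fibre_card S x i) else fibre_card S x i)"
proof -
  have "{v \<in> insert u S. x v = i} = (if x u = i then insert u {v\<in>S. x v = i} else {v\<in>S. x v = i})"
    by auto
  then show ?thesis using assms by (simp add: fibre_card_def)
qed

text \<open>A matching consists of a partner for \<open>u\<close> with the same label and a matching of the rest.\<close>
lemma matchings_insert:
  assumes fin: "finite I" "finite S" "finite T" and u: "u \<notin> S" "x u \<in> I"
  shows "matchings I (insert u S) x T y = (\<Sum>v | v \<in> T \<and> y v = x u. matchings I S x (T - {v}) y)"
proof -
  define i0 where "i0 = x u"
  define m where "m = fibre_card T y i0"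
  define F where "F i = (if fibre_card S x i = fibre_card T y i then fact (fibre_card S x i) else (0::real))" for i
  have T1: "fibre_card (T - {v}) y i = (if i = i0 then m - 1 else fibre_card T y i)"
    if "v \<in> T" "y v = i0" for v i
    using fibre_card_insert[of "T - {v}" v y i] that fin by (auto simp: insert_absorb m_def)
  have summand: "matchings I S x (T - {v}) y =
      (if fibre_card S x i0 = m - 1 then fact (fibre_card S x i0) else 0) * (\<Prod>i\<in>I - {i0}. F i)"
    if v: "v \<in> T" "y v = i0" for v
  proof -
    have "matchings I S x (T - {v}) y =
      (if fibre_card S x i0 = fibre_card (T - {v}) y i0 then fact (fibre_card S x i0) else 0) *
      (\<Prod>i\<in>I - {i0}. if fibre_card S x i = fibre_card (T - {v}) y i then fact (fibre_card S x i) else 0)"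
      unfolding matchings_def using u fin by (intro prod.remove) (auto simp: i0_def)
    also have "(\<Prod>i\<in>I - {i0}. if fibre_card S x i = fibre_card (T - {v}) y i then fact (fibre_card S x i) else 0) =
        (\<Prod>i\<in>I - {i0}. F i)"
      by (rule prod.cong) (auto simp: F_def T1[OF v])
    finally show ?thesis by (simp only: T1[OF v] if_True simp_thms)
  qed
  have "(\<Sum>v | v \<in> T \<and> y v = x u. matchings I S x (T - {v}) y) =
      (\<Sum>v | v \<in> T \<and> y v = x u. (if fibre_card S x i0 = m - 1 then fact (fibre_card S x i0) else 0) * (\<Prod>i\<in>I - {i0}. F i))"
    by (rule sum.cong) (auto simp: summand i0_def)
  also have "\<dots> = real m * ((if fibre_card S x i0 = m - 1 then fact (fibre_card S x i0) else 0) * (\<Prod>i\<in>I - {i0}. F i))"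
    by (simp add: m_def fibre_card_def i0_def)
  also have "\<dots> = (if Suc (fibre_card S x i0) = m then fact (Suc (fibre_card S x i0)) else 0) * (\<Prod>i\<in>I - {i0}. F i)"
    by (cases m) auto
  also have "\<dots> = matchings I (insert u S) x T y"
  proof -
    have "matchings I (insert u S) x T y =
      (if fibre_card (insert u S) x i0 = fibre_card T y i0 then fact (fibre_card (insert u S) x i0) else 0) *
      (\<Prod>i\<in>I - {i0}. if fibre_card (insert u S) x i = fibre_card T y i then fact (fibre_card (insert u S) x i) else 0)"
      unfolding matchings_def using u fin by (intro prod.remove) (auto simp: i0_def)
    also have "(\<Prod>i\<in>I - {i0}. if fibre_card (insert u S) x i = fibre_card T y i then fact (fibre_card (insert u S) x i) else 0)
        = (\<Prod>i\<in>I - {i0}. F i)"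
      by (rule prod.cong) (auto simp: F_def fibre_card_insert[OF fin(2) u(1)] i0_def)
    finally show ?thesis
      by (simp add: fibre_card_insert[OF fin(2) u(1)] m_def i0_def)
  qed
  finally show ?thesis ..
qed

lemma matchings_cong:
  assumes "\<And>u. u \<in> S \<Longrightarrow> x u = x' u" "\<And>v. v \<in> T \<Longrightarrow> y v = y' v"
  shows "matchings I S x T y = matchings I S x' T y'"
proof -
  have "fibre_card S x i = fibre_card S x' i" "fibre_card T y i = fibre_card T y' i" for i
    using assms by (auto intro: fibre_card_cong)
  then show ?thesis by (simp only: matchings_def)
qed

lemma matchings_empty_left:
  assumes "finite I" "finite T" "y ` T \<subseteq> I"
  shows "matchings I {} x T y = (if T = {} then 1 else 0)"
proof (cases "T = {}")
  case False
  then obtain v where v: "v \<in> T" by auto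
  have "card {v' \<in> T. y v' = y v} > 0" using v assms(2) by (auto simp: card_gt_0_iff)
  then show ?thesis using v assms False
    by (auto simp: matchings_def fibre_card_def intro!: prod_zero bexI[of _ "y v"])
qed (simp add: matchings_def fibre_card_def)

text \<open>A matching that ignores colours carries the colouring \<open>\<kappa>\<close> of \<open>S\<close> over to \<open>T\<close>, and this is the only
  colouring of \<open>T\<close> for which it preserves colours too.\<close>
lemma sum_colourings_matchings:
  assumes fin: "finite I" "finite C" "finite S" "finite T"
    and "x ` S \<subseteq> I" "y ` T \<subseteq> I" "\<kappa> ` S \<subseteq> C"
  shows "(\<Sum>\<kappa>'\<in>T \<rightarrow>\<^sub>E C. matchings (C \<times> I) S (\<lambda>u. (\<kappa> u, x u)) T (\<lambda>v. (\<kappa>' v, y v))) = matchings I S x T y"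
  using fin(3,4) assms(5-7)
proof (induction S arbitrary: T rule: finite_induct)
  case empty
  have "matchings (C \<times> I) {} (\<lambda>u. (\<kappa> u, x u)) T (\<lambda>v. (\<kappa>' v, y v)) = (if T = {} then 1 else 0)"
    if "\<kappa>' \<in> T \<rightarrow>\<^sub>E C" for \<kappa>'
    using empty fin that by (intro matchings_empty_left) (auto simp: PiE_iff)
  moreover have "matchings I {} x T y = (if T = {} then 1 else 0)"
    using empty fin by (intro matchings_empty_left) auto
  ultimately show ?case by simp
next
  case (insert u S)
  let ?m = "\<lambda>v \<kappa>'. matchings (C \<times> I) S (\<lambda>u. (\<kappa> u, x u)) (T - {v}) (\<lambda>v. (\<kappa>' v, y v))"
  have finP: "finite (T \<rightarrow>\<^sub>E C)" using fin insert.prems by (intro finite_PiE) auto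
  have "(\<Sum>\<kappa>'\<in>T \<rightarrow>\<^sub>E C. matchings (C \<times> I) (insert u S) (\<lambda>u. (\<kappa> u, x u)) T (\<lambda>v. (\<kappa>' v, y v))) =
      (\<Sum>\<kappa>'\<in>T \<rightarrow>\<^sub>E C. \<Sum>v | v \<in> T \<and> (\<kappa>' v, y v) = (\<kappa> u, x u). ?m v \<kappa>')"
    using insert.prems insert.hyps fin by (intro sum.cong refl matchings_insert) auto
  also have "\<dots> = (\<Sum>\<kappa>'\<in>T \<rightarrow>\<^sub>E C. \<Sum>v | v \<in> T \<and> y v = x u. if \<kappa>' v = \<kappa> u then ?m v \<kappa>' else 0)"
  proof (rule sum.cong[OF refl])
    fix \<kappa>'
    have "(\<Sum>v | v \<in> T \<and> y v = x u. if \<kappa>' v = \<kappa> u then ?m v \<kappa>' else 0) =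
        (\<Sum>v\<in>{v \<in> {v. v \<in> T \<and> y v = x u}. \<kappa>' v = \<kappa> u}. ?m v \<kappa>')"
      using insert.prems(1) by (intro sum.inter_filter[symmetric]) auto
    also have "{v \<in> {v. v \<in> T \<and> y v = x u}. \<kappa>' v = \<kappa> u} = {v. v \<in> T \<and> (\<kappa>' v, y v) = (\<kappa> u, x u)}"
      by auto
    finally show "(\<Sum>v | v \<in> T \<and> (\<kappa>' v, y v) = (\<kappa> u, x u). ?m v \<kappa>') =
      (\<Sum>v | v \<in> T \<and> y v = x u. if \<kappa>' v = \<kappa> u then ?m v \<kappa>' else 0)" ..
  qed
  also have "\<dots> = (\<Sum>v | v \<in> T \<and> y v = x u. \<Sum>\<kappa>'\<in>T \<rightarrow>\<^sub>E C. if \<kappa>' v = \<kappa> u then ?m v \<kappa>' else 0)"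
    by (rule sum.swap)
  also have "\<dots> = (\<Sum>v | v \<in> T \<and> y v = x u. matchings I S x (T - {v}) y)"
  proof (rule sum.cong[OF refl])
    fix v assume "v \<in> {v. v \<in> T \<and> y v = x u}"
    then have v: "v \<in> T" "y v = x u" by auto
    have "(\<Sum>\<kappa>'\<in>T \<rightarrow>\<^sub>E C. if \<kappa>' v = \<kappa> u then ?m v \<kappa>' else 0) = (\<Sum>\<kappa>'\<in>{\<kappa>'\<in>T \<rightarrow>\<^sub>E C. \<kappa>' v = \<kappa> u}. ?m v \<kappa>')"
      by (rule sum.inter_filter[OF finP, symmetric])
    also have "\<dots> = (\<Sum>\<kappa>'\<in>(T - {v}) \<rightarrow>\<^sub>E C. ?m v \<kappa>')"
    proof (rule sum.reindex_bij_witness[of _ "\<lambda>\<kappa>'. \<kappa>'(v := \<kappa> u)" "\<lambda>\<kappa>'. \<kappa>'(v := undefined)"], goal_cases)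
      case (1 a) then show ?case by auto
    next
      case (2 a) then show ?case by (auto simp: PiE_iff extensional_def)
    next
      case (3 b) then show ?case by (auto simp: PiE_iff extensional_def fun_eq_iff)
    next
      case (4 b) then show ?case using v insert.prems by (auto simp: PiE_iff extensional_def)
    next
      case (5 a) then show ?case by (intro matchings_cong) auto
    qed
    also have "\<dots> = matchings I S x (T - {v}) y"
      using insert.prems by (intro insert.IH) auto
    finally show "(\<Sum>\<kappa>'\<in>T \<rightarrow>\<^sub>E C. if \<kappa>' v = \<kappa> u then ?m v \<kappa>' else 0) = matchings I S x (T - {v}) y" .
  qed
  also have "\<dots> = matchings I (insert u S) x T y"
    using insert.prems insert.hyps fin by (intro matchings_insert[symmetric]) auto
  finally show ?case .
qed

text \<open>The Wick product of the variables \<open>\<omega> (x u)\<close> for \<open>u\<close> in \<open>S\<close>.\<close>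
definition hermite_prod :: "'i set \<Rightarrow> 'u set \<Rightarrow> ('u \<Rightarrow> 'i) \<Rightarrow> ('i \<Rightarrow> real) \<Rightarrow> real" where
  "hermite_prod I S x \<omega> = (\<Prod>i\<in>I. poly (hermite_p (fibre_card S x i)) (\<omega> i))"

lemma poly_mult_fun: "poly (p * q) = (\<lambda>t. poly p t * poly q t)"
  by (simp add: fun_eq_iff)

lemma poly_monom_fun: "poly (monom (1::real) n) = (\<lambda>t. t ^ n)"
  by (simp add: fun_eq_iff poly_monom)

lemma sum_over_Times: "(\<Sum>v\<in>A \<times> B. F v) = (\<Sum>a\<in>A. \<Sum>b\<in>B. F (a, b))"
  by (simp add: sum.cartesian_product)

lemma integrable_gauss_poly_prod:
  assumes "finite I"
  shows "integrable (gauss I) (\<lambda>\<omega>. \<Prod>i\<in>I. poly (P i) (\<omega> i))"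
  using assms integrable_stdN_poly
  by (intro product_sigma_finite.product_integrable_prod[OF product_sigma_finite_stdN]) auto

lemma integral_gauss_poly_prod:
  assumes "finite I"
  shows "(\<integral>\<omega>. (\<Prod>i\<in>I. poly (P i) (\<omega> i)) \<partial>gauss I) = (\<Prod>i\<in>I. \<integral>x. poly (P i) x \<partial>stdN)"
  using assms integrable_stdN_poly
  by (intro product_sigma_finite.product_integral_prod[OF product_sigma_finite_stdN]) auto

lemma monomial_eq_poly_prod:
  assumes "finite I" "finite S" "x ` S \<subseteq> I"
  shows "(\<Prod>u\<in>S. \<omega> (x u)) = (\<Prod>i\<in>I. poly (monom (1::real) (fibre_card S x i)) (\<omega> i))"
proof -
  have "(\<Prod>i\<in>I. poly (monom (1::real) (fibre_card S x i)) (\<omega> i)) = (\<Prod>i\<in>I. \<Prod>u\<in>{u\<in>S. x u = i}. \<omega> (x u))"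
    by (intro prod.cong refl) (simp add: poly_monom fibre_card_def)
  also have "\<dots> = (\<Prod>u\<in>S. \<omega> (x u))"
    using assms by (intro prod.group) auto
  finally show ?thesis ..
qed

lemma gauss_hermite_hermite:
  assumes "finite I"
  shows "integrable (gauss I) (\<lambda>\<omega>. hermite_prod I S x \<omega> * hermite_prod I T y \<omega>)"
    and "(\<integral>\<omega>. hermite_prod I S x \<omega> * hermite_prod I T y \<omega> \<partial>gauss I) = matchings I S x T y"
proof -
  have e: "hermite_prod I S x \<omega> * hermite_prod I T y \<omega> =
      (\<Prod>i\<in>I. poly (hermite_p (fibre_card S x i) * hermite_p (fibre_card T y i)) (\<omega> i))" for \<omega>
    by (simp add: hermite_prod_def prod.distrib)
  show "integrable (gauss I) (\<lambda>\<omega>. hermite_prod I S x \<omega> * hermite_prod I T y \<omega>)"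
    unfolding e by (rule integrable_gauss_poly_prod[OF assms])
  show "(\<integral>\<omega>. hermite_prod I S x \<omega> * hermite_prod I T y \<omega> \<partial>gauss I) = matchings I S x T y"
    unfolding e integral_gauss_poly_prod[OF assms] matchings_def
    by (intro prod.cong refl) (simp add: poly_mult_fun hermite_orthogonal)
qed

lemma sum_fibre_card:
  assumes "finite I" "finite S" "x ` S \<subseteq> I"
  shows "(\<Sum>i\<in>I. fibre_card S x i) = card S"
proof -
  have "(\<Sum>i\<in>I. fibre_card S x i) = (\<Sum>i\<in>I. \<Sum>u\<in>{u\<in>S. x u = i}. 1)"
    by (simp add: fibre_card_def)
  also have "\<dots> = (\<Sum>u\<in>S. 1)" using assms by (intro sum.group) auto
  finally show ?thesis by simp
qed

text \<open>If all labels occur equally often in \<open>S\<close> and \<open>T\<close>, then each factor is a squared norm. Otherwise,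
  as the sizes of \<open>S\<close> and \<open>T\<close> agree, some label is rarer in \<open>S\<close> than in \<open>T\<close>, and its factor
  vanishes by orthogonality.\<close>
lemma gauss_monomial_hermite:
  assumes fin: "finite I" "finite S" "x ` S \<subseteq> I" "finite T" "y ` T \<subseteq> I" and card: "card S = card T"
  shows "integrable (gauss I) (\<lambda>\<omega>. (\<Prod>u\<in>S. \<omega> (x u)) * hermite_prod I T y \<omega>)"
    and "(\<integral>\<omega>. (\<Prod>u\<in>S. \<omega> (x u)) * hermite_prod I T y \<omega> \<partial>gauss I) = matchings I S x T y"
proof -
  have e: "(\<Prod>u\<in>S. \<omega> (x u)) * hermite_prod I T y \<omega> =
      (\<Prod>i\<in>I. poly (monom 1 (fibre_card S x i) * hermite_p (fibre_card T y i)) (\<omega> i))" for \<omega>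
    by (simp add: hermite_prod_def monomial_eq_poly_prod[OF fin(1-3)] prod.distrib)
  show "integrable (gauss I) (\<lambda>\<omega>. (\<Prod>u\<in>S. \<omega> (x u)) * hermite_prod I T y \<omega>)"
    unfolding e by (rule integrable_gauss_poly_prod[OF fin(1)])
  have "(\<integral>\<omega>. (\<Prod>u\<in>S. \<omega> (x u)) * hermite_prod I T y \<omega> \<partial>gauss I) =
      (\<Prod>i\<in>I. \<integral>t. t ^ fibre_card S x i * poly (hermite_p (fibre_card T y i)) t \<partial>stdN)"
    unfolding e integral_gauss_poly_prod[OF fin(1)] by (simp only: poly_mult_fun poly_monom_fun)
  also have "\<dots> = matchings I S x T y"
  proof (cases "\<forall>i\<in>I. fibre_card S x i \<le> fibre_card T y i")
    case True
    then show ?thesis unfolding matchings_def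
      by (intro prod.cong refl) (auto simp: monomial_hermite)
  next
    case False
    have "\<exists>i\<in>I. fibre_card S x i < fibre_card T y i"
    proof (rule ccontr)
      assume "\<not> (\<exists>i\<in>I. fibre_card S x i < fibre_card T y i)"
      then have "(\<Sum>i\<in>I. fibre_card T y i) < (\<Sum>i\<in>I. fibre_card S x i)"
        using False by (intro sum_strict_mono_ex1 fin(1)) (auto simp: not_less not_le)
      then show False using sum_fibre_card[OF fin(1-3)] sum_fibre_card[OF fin(1,4,5)] card by simp
    qed
    then obtain i where i: "i \<in> I" "fibre_card S x i < fibre_card T y i" by blast
    have "(\<Prod>i\<in>I. \<integral>t. t ^ fibre_card S x i * poly (hermite_p (fibre_card T y i)) t \<partial>stdN) = 0"
      using i fin(1) by (intro prod_zero bexI[of _ i]) (auto simp: monomial_hermite)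
    moreover have "matchings I S x T y = 0"
      unfolding matchings_def using i fin(1) by (intro prod_zero bexI[of _ i]) auto
    ultimately show ?thesis by simp
  qed
  finally show "(\<integral>\<omega>. (\<Prod>u\<in>S. \<omega> (x u)) * hermite_prod I T y \<omega> \<partial>gauss I) = matchings I S x T y" .
qed

lemma gauss_monomial_monomial_integrable:
  fixes x :: "'u \<Rightarrow> 'i" and y :: "'v \<Rightarrow> 'i"
  assumes fin: "finite I" "finite S" "x ` S \<subseteq> I" "finite T" "y ` T \<subseteq> I"
  shows "integrable (gauss I) (\<lambda>\<omega>. (\<Prod>u\<in>S. \<omega> (x u)) * (\<Prod>v\<in>T. \<omega> (y v)))"
proof -
  have e: "(\<Prod>u\<in>S. \<omega> (x u)) * (\<Prod>v\<in>T. \<omega> (y v)) =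
      (\<Prod>i\<in>I. poly (monom 1 (fibre_card S x i) * monom 1 (fibre_card T y i)) (\<omega> i))"
    for \<omega> :: "'i \<Rightarrow> real"
    unfolding monomial_eq_poly_prod[OF fin(1-3), of \<omega>] monomial_eq_poly_prod[OF fin(1,4,5), of \<omega>]
    by (simp add: prod.distrib)
  show ?thesis unfolding e by (rule integrable_gauss_poly_prod[OF fin(1)])
qed

lemma integral_sum_times_sum:
  fixes f :: "'w \<Rightarrow> 'a \<Rightarrow> real" and g :: "'v \<Rightarrow> 'a \<Rightarrow> real"
  assumes "\<And>w v. w \<in> W \<Longrightarrow> v \<in> V \<Longrightarrow> integrable M (\<lambda>\<omega>. f w \<omega> * g v \<omega>)"
  shows "integrable M (\<lambda>\<omega>. (\<Sum>w\<in>W. a w * f w \<omega>) * (\<Sum>v\<in>V. b v * g v \<omega>))"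
    and "(\<integral>\<omega>. (\<Sum>w\<in>W. a w * f w \<omega>) * (\<Sum>v\<in>V. b v * g v \<omega>) \<partial>M) =
      (\<Sum>w\<in>W. \<Sum>v\<in>V. a w * b v * (\<integral>\<omega>. f w \<omega> * g v \<omega> \<partial>M))"
proof -
  have e: "(\<Sum>w\<in>W. a w * f w \<omega>) * (\<Sum>v\<in>V. b v * g v \<omega>) =
      (\<Sum>w\<in>W. \<Sum>v\<in>V. a w * b v * (f w \<omega> * g v \<omega>))" for \<omega>
    unfolding sum_product by (intro sum.cong refl) (simp only: mult_ac)
  have i: "integrable M (\<lambda>\<omega>. a w * b v * (f w \<omega> * g v \<omega>))" if "w \<in> W" "v \<in> V" for w v
    using assms[OF that] by (rule integrable_mult_right)
  show "integrable M (\<lambda>\<omega>. (\<Sum>w\<in>W. a w * f w \<omega>) * (\<Sum>v\<in>V. b v * g v \<omega>))"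
    unfolding e by (intro Bochner_Integration.integrable_sum i)
  show "(\<integral>\<omega>. (\<Sum>w\<in>W. a w * f w \<omega>) * (\<Sum>v\<in>V. b v * g v \<omega>) \<partial>M) =
      (\<Sum>w\<in>W. \<Sum>v\<in>V. a w * b v * (\<integral>\<omega>. f w \<omega> * g v \<omega> \<partial>M))"
  proof -
    have "(\<integral>\<omega>. (\<Sum>w\<in>W. \<Sum>v\<in>V. a w * b v * (f w \<omega> * g v \<omega>)) \<partial>M) =
        (\<Sum>w\<in>W. \<integral>\<omega>. (\<Sum>v\<in>V. a w * b v * (f w \<omega> * g v \<omega>)) \<partial>M)"
      by (intro Bochner_Integration.integral_sum Bochner_Integration.integrable_sum i)
    also have "\<dots> = (\<Sum>w\<in>W. \<Sum>v\<in>V. \<integral>\<omega>. a w * b v * (f w \<omega> * g v \<omega>) \<partial>M)"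
      by (intro sum.cong refl Bochner_Integration.integral_sum i)
    finally show ?thesis unfolding e by simp
  qed
qed

text \<open>Let \<open>Q\<close> be the second moment on the left, \<open>K\<close> the number of colourings and \<open>V\<close> the sum over all
  colourings of the coloured Hermite products. Summing over colourings removes the colours
  from the matchings, so \<open>E G V = Q\<close> and \<open>E V\<^sup>2 = K Q\<close>. Then
  \<open>0 \<le> E (K G - V)\<^sup>2 = K\<^sup>2 E G\<^sup>2 - K Q\<close>.\<close>
lemma decoupling:
  fixes a :: "'w \<Rightarrow> real" and x :: "'w \<Rightarrow> 'u \<Rightarrow> 'i" and \<kappa> :: "'u \<Rightarrow> 'c"
  assumes fin: "finite W" "finite I" "finite C" "finite S"
    and x: "\<And>w. w \<in> W \<Longrightarrow> x w ` S \<subseteq> I" and \<kappa>: "\<kappa> ` S \<subseteq> C"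
  defines "G \<equiv> \<lambda>\<zeta>. \<Sum>w\<in>W. a w * (\<Prod>u\<in>S. \<zeta> (\<kappa> u, x w u))"
  shows "integrable (gauss (C \<times> I)) (\<lambda>\<zeta>. (G \<zeta>)\<^sup>2)"
    and "(\<integral>\<omega>. (\<Sum>w\<in>W. a w * hermite_prod I S (x w) \<omega>)\<^sup>2 \<partial>gauss I) \<le>
      real (card C) ^ card S * (\<integral>\<zeta>. (G \<zeta>)\<^sup>2 \<partial>gauss (C \<times> I))"
proof -
  let ?J = "C \<times> I" and ?K = "real (card C) ^ card S"
  have finJ: "finite ?J" using fin by auto
  have finX: "finite (S \<rightarrow>\<^sub>E C)" using fin by (intro finite_PiE) auto
  define Q where "Q = (\<Sum>w\<in>W. \<Sum>w'\<in>W. a w * a w' * matchings I S (x w) S (x w'))"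
  define H where "H = (\<lambda>(w, \<kappa>') \<zeta>. hermite_prod ?J S (\<lambda>u. (\<kappa>' u, x w u)) \<zeta>)"
  define V where "V \<zeta> = (\<Sum>v\<in>W \<times> (S \<rightarrow>\<^sub>E C). a (fst v) * H v \<zeta>)" for \<zeta>
  have sub: "(\<lambda>u. (\<kappa>' u, x w u)) ` S \<subseteq> ?J" if "w \<in> W" "\<kappa>' ` S \<subseteq> C" for w \<kappa>'
    using x[OF that(1)] that(2) by auto
  have subE: "\<kappa>' ` S \<subseteq> C" if "\<kappa>' \<in> S \<rightarrow>\<^sub>E C" for \<kappa>' using that by auto
  have U: "(\<integral>\<omega>. (\<Sum>w\<in>W. a w * hermite_prod I S (x w) \<omega>)\<^sup>2 \<partial>gauss I) = Q"
    unfolding power2_eq_square Q_def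
    by (subst integral_sum_times_sum) (simp_all add: gauss_hermite_hermite[OF fin(2)])
  have GG: "integrable (gauss ?J) (\<lambda>\<zeta>. G \<zeta> * G \<zeta>)"
    unfolding G_def
    by (intro integral_sum_times_sum(1) gauss_monomial_monomial_integrable finJ fin sub \<kappa>)
  then show "integrable (gauss (C \<times> I)) (\<lambda>\<zeta>. (G \<zeta>)\<^sup>2)" by (simp add: power2_eq_square)
  have iGV: "integrable (gauss ?J) (\<lambda>\<zeta>. (\<Prod>u\<in>S. \<zeta> (\<kappa> u, x w u)) * H v \<zeta>)"
    if "w \<in> W" "v \<in> W \<times> (S \<rightarrow>\<^sub>E C)" for w v
    using that unfolding H_def split_def
    by (intro gauss_monomial_hermite(1) finJ fin sub \<kappa> subE) auto
  have iVV: "integrable (gauss ?J) (\<lambda>\<zeta>. H v \<zeta> * H v' \<zeta>)" for v v'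
    unfolding H_def split_def by (rule gauss_hermite_hermite(1)[OF finJ])
  have GV: "(\<integral>\<zeta>. G \<zeta> * V \<zeta> \<partial>gauss ?J) = Q"
  proof -
    have "(\<integral>\<zeta>. G \<zeta> * V \<zeta> \<partial>gauss ?J) =
        (\<Sum>w\<in>W. \<Sum>v\<in>W \<times> (S \<rightarrow>\<^sub>E C). a w * a (fst v) *
          (\<integral>\<zeta>. (\<Prod>u\<in>S. \<zeta> (\<kappa> u, x w u)) * H v \<zeta> \<partial>gauss ?J))"
      unfolding G_def V_def by (rule integral_sum_times_sum(2)[OF iGV])
    also have "\<dots> = (\<Sum>w\<in>W. \<Sum>v\<in>W \<times> (S \<rightarrow>\<^sub>E C). a w * a (fst v) *
          matchings ?J S (\<lambda>u. (\<kappa> u, x w u)) S (\<lambda>u. (snd v u, x (fst v) u)))"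
      unfolding H_def split_def
      by (intro sum.cong refl arg_cong2[where f = times] gauss_monomial_hermite(2) finJ fin sub \<kappa> subE) auto
    also have "\<dots> = (\<Sum>w\<in>W. \<Sum>w'\<in>W. \<Sum>\<kappa>'\<in>S \<rightarrow>\<^sub>E C. a w * a w' *
          matchings ?J S (\<lambda>u. (\<kappa> u, x w u)) S (\<lambda>u. (\<kappa>' u, x w' u)))"
      by (simp only: sum_over_Times fst_conv snd_conv)
    also have "\<dots> = Q"
      unfolding Q_def
      by (simp add: sum_colourings_matchings[OF fin(2,3,4,4) x x \<kappa>] flip: sum_distrib_left)
    finally show ?thesis .
  qed
  have VV: "(\<integral>\<zeta>. V \<zeta> * V \<zeta> \<partial>gauss ?J) = ?K * Q"
  proof -
    have "(\<integral>\<zeta>. V \<zeta> * V \<zeta> \<partial>gauss ?J) =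
        (\<Sum>v\<in>W \<times> (S \<rightarrow>\<^sub>E C). \<Sum>v'\<in>W \<times> (S \<rightarrow>\<^sub>E C). a (fst v) * a (fst v') *
          (\<integral>\<zeta>. H v \<zeta> * H v' \<zeta> \<partial>gauss ?J))"
      unfolding V_def by (rule integral_sum_times_sum(2)[OF iVV])
    also have "\<dots> = (\<Sum>v\<in>W \<times> (S \<rightarrow>\<^sub>E C). \<Sum>v'\<in>W \<times> (S \<rightarrow>\<^sub>E C). a (fst v) * a (fst v') *
          matchings ?J S (\<lambda>u. (snd v u, x (fst v) u)) S (\<lambda>u. (snd v' u, x (fst v') u)))"
      unfolding H_def split_def gauss_hermite_hermite(2)[OF finJ] ..
    also have "\<dots> = (\<Sum>w\<in>W. \<Sum>\<kappa>\<in>S \<rightarrow>\<^sub>E C. \<Sum>w'\<in>W. \<Sum>\<kappa>'\<in>S \<rightarrow>\<^sub>E C. a w * a w' *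
          matchings ?J S (\<lambda>u. (\<kappa> u, x w u)) S (\<lambda>u. (\<kappa>' u, x w' u)))"
      by (simp only: sum_over_Times fst_conv snd_conv)
    also have "\<dots> = (\<Sum>w\<in>W. \<Sum>\<kappa>\<in>S \<rightarrow>\<^sub>E C. \<Sum>w'\<in>W. a w * a w' * matchings I S (x w) S (x w'))"
      by (intro sum.cong refl)
         (simp add: sum_colourings_matchings[OF fin(2,3,4,4) x x subE] flip: sum_distrib_left)
    also have "\<dots> = ?K * Q"
      unfolding Q_def using fin by (simp add: card_PiE prod_constant sum_distrib_left)
    finally show ?thesis .
  qed
  have K: "?K > 0"
  proof (cases "S = {}")
    case False
    then have "C \<noteq> {}" using \<kappa> by auto
    then show ?thesis using fin by (simp add: card_gt_0_iff)
  qed simp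
  have iGV': "integrable (gauss ?J) (\<lambda>\<zeta>. G \<zeta> * V \<zeta>)"
    unfolding G_def V_def by (rule integral_sum_times_sum(1)[OF iGV])
  have iVV': "integrable (gauss ?J) (\<lambda>\<zeta>. V \<zeta> * V \<zeta>)"
    unfolding V_def by (rule integral_sum_times_sum(1)[OF iVV])
  have "0 \<le> (\<integral>\<zeta>. (?K * G \<zeta> - V \<zeta>)\<^sup>2 \<partial>gauss ?J)" by (rule integral_nonneg_AE) simp
  also have "(\<lambda>\<zeta>. (?K * G \<zeta> - V \<zeta>)\<^sup>2) = (\<lambda>\<zeta>. ?K\<^sup>2 * (G \<zeta> * G \<zeta>) - 2 * ?K * (G \<zeta> * V \<zeta>) + V \<zeta> * V \<zeta>)"
    by (simp add: fun_eq_iff power2_eq_square algebra_simps)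
  also have "(\<integral>\<zeta>. ?K\<^sup>2 * (G \<zeta> * G \<zeta>) - 2 * ?K * (G \<zeta> * V \<zeta>) + V \<zeta> * V \<zeta> \<partial>gauss ?J) =
      ?K\<^sup>2 * (\<integral>\<zeta>. G \<zeta> * G \<zeta> \<partial>gauss ?J) - 2 * ?K * Q + ?K * Q"
    using GG iGV' iVV' by (simp add: GV VV)
  also have "\<dots> = ?K * (?K * (\<integral>\<zeta>. G \<zeta> * G \<zeta> \<partial>gauss ?J) - Q)"
    by (simp add: power2_eq_square algebra_simps)
  finally have "?K * (\<integral>\<zeta>. G \<zeta> * G \<zeta> \<partial>gauss ?J) - Q \<ge> 0"
    using K by (simp add: zero_le_mult_iff)
  then show "(\<integral>\<omega>. (\<Sum>w\<in>W. a w * hermite_prod I S (x w) \<omega>)\<^sup>2 \<partial>gauss I) \<le>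
      ?K * (\<integral>\<zeta>. (G \<zeta>)\<^sup>2 \<partial>gauss (C \<times> I))"
    unfolding U by (simp add: power2_eq_square)
qed

lemma sum_Pow_card:
  fixes f :: "nat \<Rightarrow> real"
  assumes "finite T"
  shows "(\<Sum>S\<in>Pow T. f (card S)) = (\<Sum>l\<le>card T. of_nat (card T choose l) * f l)"
proof -
  have "(\<Sum>S\<in>Pow T. f (card S)) = (\<Sum>l\<le>card T. \<Sum>S\<in>{S\<in>Pow T. card S = l}. f (card S))"
    using assms by (intro sum.group[symmetric]) (auto simp: card_mono)
  also have "\<dots> = (\<Sum>l\<le>card T. of_nat (card T choose l) * f l)"
  proof (rule sum.cong[OF refl])
    fix l
    have "card {S\<in>Pow T. card S = l} = card T choose l"
      using n_subsets[OF assms, of l] by (simp add: Pow_def)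
    then show "(\<Sum>S\<in>{S\<in>Pow T. card S = l}. f (card S)) = of_nat (card T choose l) * f l" by simp
  qed
  finally show ?thesis .
qed

text \<open>The binomial formula for Wick products: in each slot the factor \<open>a + \<omega>\<close> chooses one of its
  summands. It follows label by label from \<open>hermite_p_add\<close>, with the binomial coefficient counting
  the subsets of the slots that carry a label.\<close>
lemma hermite_prod_add:
  fixes a :: "'i \<Rightarrow> real"
  assumes "finite I" "finite T" "x ` T \<subseteq> I"
  shows "hermite_prod I T x (\<lambda>i. a i + \<omega> i) =
    (\<Sum>S\<in>Pow T. (\<Prod>u\<in>T - S. a (x u)) * hermite_prod I S x \<omega>)"
  using assms
proof (induction I arbitrary: T rule: finite_induct)
  case empty
  then show ?case by (simp add: hermite_prod_def)
next
  case (insert i I)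
  define T1 where "T1 = {u\<in>T. x u = i}"
  define T2 where "T2 = {u\<in>T. x u \<noteq> i}"
  have fin: "finite T1" "finite T2" and T: "T = T1 \<union> T2" "T1 \<inter> T2 = {}"
    using insert.prems by (auto simp: T1_def T2_def)
  have x2: "x ` T2 \<subseteq> I" using insert.prems by (auto simp: T2_def)
  have split: "hermite_prod (insert i I) S x v =
      poly (hermite_p (card (S \<inter> T1))) (v i) * hermite_prod I (S \<inter> T2) x v" if "S \<subseteq> T" for S and v :: "'i \<Rightarrow> real"
  proof -
    have "fibre_card S x i = card (S \<inter> T1)"
      unfolding fibre_card_def using that by (intro arg_cong[where f = card]) (auto simp: T1_def)
    moreover have "fibre_card S x i' = fibre_card (S \<inter> T2) x i'" if "i' \<in> I" for i'
      unfolding fibre_card_def using that \<open>S \<subseteq> T\<close> insert.hyps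
      by (intro arg_cong[where f = card]) (auto simp: T2_def)
    ultimately show ?thesis using insert.hyps by (simp add: hermite_prod_def)
  qed
  have "poly (hermite_p (card T1)) (a i + \<omega> i) =
      (\<Sum>S\<in>Pow T1. a i ^ (card T1 - card S) * poly (hermite_p (card S)) (\<omega> i))"
    by (subst sum_Pow_card[OF fin(1), of "\<lambda>l. a i ^ (card T1 - l) * poly (hermite_p l) (\<omega> i)"])
       (simp add: hermite_p_add mult.assoc)
  also have "\<dots> = (\<Sum>S\<in>Pow T1. (\<Prod>u\<in>T1 - S. a (x u)) * poly (hermite_p (card S)) (\<omega> i))"
  proof (rule sum.cong[OF refl])
    fix S assume S: "S \<in> Pow T1"
    then have "card (T1 - S) = card T1 - card S"
      using fin(1) by (intro card_Diff_subset) (auto intro: finite_subset)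
    moreover have "(\<Prod>u\<in>T1 - S. a (x u)) = (\<Prod>u\<in>T1 - S. a i)" by (rule prod.cong) (auto simp: T1_def)
    ultimately show "a i ^ (card T1 - card S) * poly (hermite_p (card S)) (\<omega> i) =
        (\<Prod>u\<in>T1 - S. a (x u)) * poly (hermite_p (card S)) (\<omega> i)" by simp
  qed
  finally have first: "poly (hermite_p (card T1)) (a i + \<omega> i) =
    (\<Sum>S\<in>Pow T1. (\<Prod>u\<in>T1 - S. a (x u)) * poly (hermite_p (card S)) (\<omega> i))" .
  have "hermite_prod (insert i I) T x (\<lambda>i. a i + \<omega> i) =
      poly (hermite_p (card T1)) (a i + \<omega> i) * hermite_prod I T2 x (\<lambda>i. a i + \<omega> i)"
    using split[OF order_refl] T by (simp add: Int_absorb1)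
  also have "\<dots> = (\<Sum>S\<in>Pow T1. (\<Prod>u\<in>T1 - S. a (x u)) * poly (hermite_p (card S)) (\<omega> i)) *
      (\<Sum>S\<in>Pow T2. (\<Prod>u\<in>T2 - S. a (x u)) * hermite_prod I S x \<omega>)"
    unfolding first insert.IH[OF fin(2) x2] ..
  also have "\<dots> = (\<Sum>(S1, S2)\<in>Pow T1 \<times> Pow T2. ((\<Prod>u\<in>T1 - S1. a (x u)) * (\<Prod>u\<in>T2 - S2. a (x u))) *
      (poly (hermite_p (card S1)) (\<omega> i) * hermite_prod I S2 x \<omega>))"
    unfolding sum_product sum.cartesian_product
    by (intro sum.cong refl) (auto simp: mult_ac)
  also have "\<dots> = (\<Sum>S\<in>Pow T. (\<Prod>u\<in>T - S. a (x u)) * hermite_prod (insert i I) S x \<omega>)"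
  proof (rule sum.reindex_bij_witness[of _ "\<lambda>S. (S \<inter> T1, S \<inter> T2)" "\<lambda>(S1, S2). S1 \<union> S2"], goal_cases)
    case (1 b) then show ?case using T by auto
  next
    case (2 b) then show ?case using T by auto
  next
    case (3 S) then show ?case using T by auto
  next
    case (4 S) then show ?case by auto
  next
    case (5 b)
    obtain S1 S2 where b: "b = (S1, S2)" by (cases b)
    have S: "S1 \<subseteq> T1" "S2 \<subseteq> T2" using 5 b by auto
    have i: "(S1 \<union> S2) \<inter> T1 = S1" "(S1 \<union> S2) \<inter> T2 = S2" using S T by auto
    have "T - (S1 \<union> S2) = (T1 - S1) \<union> (T2 - S2)" "(T1 - S1) \<inter> (T2 - S2) = {}" using S T by auto
    then have "(\<Prod>u\<in>T - (S1 \<union> S2). a (x u)) = (\<Prod>u\<in>T1 - S1. a (x u)) * (\<Prod>u\<in>T2 - S2. a (x u))"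
      using fin by (simp add: prod.union_disjoint)
    moreover have "hermite_prod (insert i I) (S1 \<union> S2) x \<omega> =
        poly (hermite_p (card S1)) (\<omega> i) * hermite_prod I S2 x \<omega>"
      using split[of "S1 \<union> S2" \<omega>] S T i by auto
    ultimately show ?case by (simp add: b)
  qed
  finally show ?case .
qed

section \<open>The statistic as a sum over noise patterns\<close>

text \<open>The pairs along the walk \<open>j\<^sub>0, i\<^sub>0, j\<^sub>1, i\<^sub>1, \<dots>, j\<^sub>0\<close> in the order in which they are
  traversed: slot \<open>2t\<close> is \<open>(i\<^sub>t, j\<^sub>t)\<close> and slot \<open>2t + 1\<close> is \<open>(i\<^sub>t, j\<^sub>t\<^sub>+\<^sub>1)\<close>.\<close>
definition slot :: "nat \<Rightarrow> (nat \<Rightarrow> nat) \<times> (nat \<Rightarrow> nat) \<Rightarrow> nat \<Rightarrow> nat \<times> nat" where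
  "slot k w u = (fst w (u div 2), if even u then snd w (u div 2) else snd w (Suc (u div 2) mod k))"

definition walks :: "nat \<Rightarrow> nat \<Rightarrow> nat \<Rightarrow> ((nat \<Rightarrow> nat) \<times> (nat \<Rightarrow> nat)) set" where
  "walks k p q = ({..<k} \<rightarrow>\<^sub>E {..<p}) \<times> ({..<k} \<rightarrow>\<^sub>E {..<q})"

lemma finite_walks: "finite (walks k p q)"
  unfolding walks_def by (intro finite_cartesian_product finite_PiE) auto

lemma slot_in_range:
  assumes "w \<in> walks k p q"
  shows "slot k w ` {..<2 * k} \<subseteq> {..<p} \<times> {..<q}"
proof
  fix y assume "y \<in> slot k w ` {..<2 * k}"
  then obtain u where u: "u < 2 * k" "y = slot k w u" by auto
  have t: "u div 2 < k" "Suc (u div 2) mod k < k" using u by auto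
  have "fst w \<in> {..<k} \<rightarrow>\<^sub>E {..<p}" "snd w \<in> {..<k} \<rightarrow>\<^sub>E {..<q}"
    using assms unfolding walks_def mem_Times_iff by blast+
  then have "fst w t < p" "snd w t < q" if "t < k" for t
    using that PiE_mem[of _ "{..<k}" _ t] by fastforce+
  then show "y \<in> {..<p} \<times> {..<q}" using t u by (auto simp: slot_def)
qed

lemma pair_count_eq_fibre_card:
  "pair_count k i j r s = fibre_card {..<2 * k} (slot k (i, j)) (r, s)"
proof -
  let ?E = "{t \<in> {..<k}. (i t, j t) = (r, s)}" and ?O = "{t \<in> {..<k}. (i t, j (Suc t mod k)) = (r, s)}"
  have "{u \<in> {..<2 * k}. slot k (i, j) u = (r, s)} = (\<lambda>t. 2 * t) ` ?E \<union> (\<lambda>t. 2 * t + 1) ` ?O"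
  proof (intro equalityI subsetI)
    fix u assume u: "u \<in> {u \<in> {..<2 * k}. slot k (i, j) u = (r, s)}"
    show "u \<in> (\<lambda>t. 2 * t) ` ?E \<union> (\<lambda>t. 2 * t + 1) ` ?O"
    proof (cases "even u")
      case True
      then show ?thesis using u by (auto simp: slot_def elim!: evenE intro!: imageI)
    next
      case False
      then obtain t where t: "u = 2 * t + 1" by (elim oddE)
      then have "t \<in> ?O" using u by (auto simp: slot_def)
      then show ?thesis using t by blast
    qed
  qed (auto simp: slot_def)
  then have "fibre_card {..<2 * k} (slot k (i, j)) (r, s) = card ((\<lambda>t. 2 * t) ` ?E \<union> (\<lambda>t. 2 * t + 1) ` ?O)"
    by (simp add: fibre_card_def)
  also have "\<dots> = card ((\<lambda>t. 2 * t) ` ?E) + card ((\<lambda>t. 2 * t + 1) ` ?O)"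
    by (rule card_Un_disjoint) (auto, presburger)
  also have "\<dots> = card ?E + card ?O"
    by (simp add: card_image inj_on_def)
  finally show ?thesis by (simp add: pair_count_def)
qed

text \<open>The part of the statistic with signal entries in the slots outside \<open>S\<close> and Wick-ordered noise in
  the slots of \<open>S\<close>.\<close>
definition noise_part :: "nat \<Rightarrow> nat \<Rightarrow> nat \<Rightarrow> real mat \<Rightarrow> nat set \<Rightarrow> (nat \<times> nat \<Rightarrow> real) \<Rightarrow> real" where
  "noise_part k p q A S \<omega> =
     (\<Sum>w\<in>walks k p q. (\<Prod>u\<in>{..<2 * k} - S. A $$ slot k w u) *
        hermite_prod ({..<p} \<times> {..<q}) S (slot k w) \<omega>)"

lemma U_stat_noise_parts:
  assumes A: "A \<in> carrier_mat p q"
  shows "U_stat k (A + mat p q \<omega>) = (\<Sum>S\<in>Pow {..<2 * k}. noise_part k p q A S \<omega>)"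
proof -
  let ?I = "{..<p} \<times> {..<q}"
  have "U_stat k (A + mat p q \<omega>) = (\<Sum>i \<in> {..<k} \<rightarrow>\<^sub>E {..<p}. \<Sum>j \<in> {..<k} \<rightarrow>\<^sub>E {..<q}.
      \<Prod>r<p. \<Prod>s<q. hermite (pair_count k i j r s) (A $$ (r, s) + \<omega> (r, s)))"
    using A by (auto simp: U_stat_def intro!: sum.cong prod.cong)
  also have "\<dots> = (\<Sum>i \<in> {..<k} \<rightarrow>\<^sub>E {..<p}. \<Sum>j \<in> {..<k} \<rightarrow>\<^sub>E {..<q}.
      hermite_prod ?I {..<2 * k} (slot k (i, j)) (\<lambda>rs. A $$ rs + \<omega> rs))"
  proof (intro sum.cong refl)
    fix i j
    have "(\<Prod>r<p. \<Prod>s<q. hermite (pair_count k i j r s) (A $$ (r, s) + \<omega> (r, s))) =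
        (\<Prod>(r, s)\<in>?I. hermite (pair_count k i j r s) (A $$ (r, s) + \<omega> (r, s)))"
      by (rule prod.cartesian_product)
    then show "(\<Prod>r<p. \<Prod>s<q. hermite (pair_count k i j r s) (A $$ (r, s) + \<omega> (r, s))) =
        hermite_prod ?I {..<2 * k} (slot k (i, j)) (\<lambda>rs. A $$ rs + \<omega> rs)"
      by (simp add: hermite_prod_def hermite_eq pair_count_eq_fibre_card split_def)
  qed
  also have "\<dots> = (\<Sum>w\<in>walks k p q. hermite_prod ?I {..<2 * k} (slot k w) (\<lambda>rs. A $$ rs + \<omega> rs))"
    by (simp only: walks_def sum_over_Times)
  also have "\<dots> = (\<Sum>w\<in>walks k p q. \<Sum>S\<in>Pow {..<2 * k}.
      (\<Prod>u\<in>{..<2 * k} - S. A $$ slot k w u) * hermite_prod ?I S (slot k w) \<omega>)"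
    by (intro sum.cong refl hermite_prod_add slot_in_range) auto
  also have "\<dots> = (\<Sum>S\<in>Pow {..<2 * k}. noise_part k p q A S \<omega>)"
    unfolding noise_part_def by (rule sum.swap)
  finally show ?thesis .
qed

lemma noise_part_product_integrable:
  "integrable (gauss ({..<p} \<times> {..<q})) (\<lambda>\<omega>. noise_part k p q A S \<omega> * noise_part k p q A T \<omega>)"
  unfolding noise_part_def by (intro integral_sum_times_sum(1) gauss_hermite_hermite(1)) auto

lemma noise_part_empty: "noise_part k p q A {} \<omega> = noise_part k p q A {} \<omega>'"
  by (simp add: noise_part_def hermite_prod_def fibre_card_def)

lemma noise_part_integrable:
  "integrable (gauss ({..<p} \<times> {..<q})) (noise_part k p q A S)"
proof -
  have "integrable (gauss ({..<p} \<times> {..<q})) (\<lambda>\<omega>. hermite_prod ({..<p} \<times> {..<q}) S x \<omega>)" for x :: "nat \<Rightarrow> nat \<times> nat"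
    unfolding hermite_prod_def by (rule integrable_gauss_poly_prod) simp
  then show ?thesis unfolding noise_part_def
    by (intro Bochner_Integration.integrable_sum integrable_mult_right) auto
qed

lemma (in prob_space) variance_le_second_moment:
  fixes X :: "'a \<Rightarrow> real"
  assumes X: "integrable M X" and X2: "integrable M (\<lambda>x. (X x - c)\<^sup>2)"
  shows "variance X \<le> expectation (\<lambda>x. (X x - c)\<^sup>2)"
proof -
  let ?m = "expectation X"
  have e: "(X x - ?m)\<^sup>2 = (X x - c)\<^sup>2 + (2 * (c - ?m) * X x + (?m\<^sup>2 - c\<^sup>2))" for x
    by (simp add: power2_eq_square algebra_simps)
  have "variance X = expectation (\<lambda>x. (X x - c)\<^sup>2) + expectation (\<lambda>x. 2 * (c - ?m) * X x + (?m\<^sup>2 - c\<^sup>2))"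
    unfolding e using X X2 by (intro Bochner_Integration.integral_add) auto
  also have "expectation (\<lambda>x. 2 * (c - ?m) * X x + (?m\<^sup>2 - c\<^sup>2)) = 2 * (c - ?m) * ?m + (?m\<^sup>2 - c\<^sup>2)"
    using X by (simp add: prob_space)
  also have "\<dots> = - (?m - c)\<^sup>2" by (simp add: power2_eq_square algebra_simps)
  finally show ?thesis by simp
qed

text \<open>The part with \<open>S\<close> empty is constant and does not affect the variance; Cauchy-Schwarz over the
  fewer than \<open>4\<^sup>k\<close> remaining parts.\<close>
lemma variance_le_noise_parts:
  assumes A: "A \<in> carrier_mat p q"
  shows "prob_space.variance (std_gaussian p q) (\<lambda>\<omega>. U_stat k (A + mat p q \<omega>)) \<le>
    4 ^ k * (\<Sum>S\<in>Pow {..<2 * k} - {{}}. \<integral>\<omega>. (noise_part k p q A S \<omega>)\<^sup>2 \<partial>gauss ({..<p} \<times> {..<q}))"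
proof -
  let ?N = "gauss ({..<p} \<times> {..<q})" and ?f = "noise_part k p q A" and ?P = "Pow {..<2 * k}"
  interpret G: prob_space ?N by (rule prob_space_gauss)
  define c where "c = ?f {} (\<lambda>_. 0)"
  have U: "U_stat k (A + mat p q \<omega>) = (\<Sum>S\<in>?P. ?f S \<omega>)" for \<omega>
    by (rule U_stat_noise_parts[OF A])
  have Uc: "U_stat k (A + mat p q \<omega>) - c = (\<Sum>S\<in>?P - {{}}. ?f S \<omega>)" for \<omega>
    unfolding U c_def noise_part_empty[of k p q A "\<lambda>_. 0" \<omega>]
    by (subst sum.remove[of ?P "{}"]) auto
  have iS: "integrable ?N (\<lambda>\<omega>. (?f S \<omega>)\<^sup>2)" for S
    using noise_part_product_integrable[of p q k A S S] by (simp add: power2_eq_square)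
  have i2: "integrable ?N (\<lambda>\<omega>. (U_stat k (A + mat p q \<omega>) - c)\<^sup>2)"
    unfolding Uc power2_eq_square sum_product
    by (intro Bochner_Integration.integrable_sum noise_part_product_integrable)
  have i1: "integrable ?N (\<lambda>\<omega>. U_stat k (A + mat p q \<omega>))"
    unfolding U by (intro Bochner_Integration.integrable_sum noise_part_integrable)
  have "prob_space.variance (std_gaussian p q) (\<lambda>\<omega>. U_stat k (A + mat p q \<omega>)) \<le>
      (\<integral>\<omega>. (U_stat k (A + mat p q \<omega>) - c)\<^sup>2 \<partial>?N)"
    unfolding std_gaussian_def by (rule G.variance_le_second_moment[OF i1 i2])
  also have "\<dots> \<le> (\<integral>\<omega>. 4 ^ k * (\<Sum>S\<in>?P - {{}}. (?f S \<omega>)\<^sup>2) \<partial>?N)"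
  proof (rule integral_mono[OF i2])
    show "integrable ?N (\<lambda>\<omega>. 4 ^ k * (\<Sum>S\<in>?P - {{}}. (?f S \<omega>)\<^sup>2))"
      by (intro integrable_mult_right Bochner_Integration.integrable_sum iS)
    fix \<omega>
    have "(\<Sum>S\<in>?P - {{}}. 1 * ?f S \<omega>)\<^sup>2 \<le> (\<Sum>S\<in>?P - {{}}. 1\<^sup>2) * (\<Sum>S\<in>?P - {{}}. (?f S \<omega>)\<^sup>2)"
      by (rule Cauchy_Schwarz_ineq_sum)
    also have "\<dots> \<le> 4 ^ k * (\<Sum>S\<in>?P - {{}}. (?f S \<omega>)\<^sup>2)"
    proof (rule mult_right_mono)
      have "card (?P - {{}}) \<le> card ?P" by (intro card_mono) auto
      also have "\<dots> = 4 ^ k" by (simp add: card_Pow power_mult)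
      finally have "real (card (?P - {{}})) \<le> real (4 ^ k)" by (rule of_nat_mono)
      then show "(\<Sum>S\<in>?P - {{}}. 1\<^sup>2) \<le> (4 ^ k :: real)" by simp
    qed (auto intro: sum_nonneg)
    finally show "(U_stat k (A + mat p q \<omega>) - c)\<^sup>2 \<le> 4 ^ k * (\<Sum>S\<in>?P - {{}}. (?f S \<omega>)\<^sup>2)"
      unfolding Uc by simp
  qed
  also have "\<dots> = 4 ^ k * (\<Sum>S\<in>?P - {{}}. \<integral>\<omega>. (?f S \<omega>)\<^sup>2 \<partial>?N)"
    using iS by (simp add: Bochner_Integration.integral_sum)
  finally show ?thesis .
qed

section \<open>Sums over closed walks as traces\<close>

definition list_prod :: "nat \<Rightarrow> (nat \<Rightarrow> real mat) \<Rightarrow> nat list \<Rightarrow> real mat" where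
  "list_prod q B ts = foldr (\<lambda>t M. B t * M) ts (1\<^sub>m q)"

lemma list_prod_carrier:
  "(\<And>t. t \<in> set ts \<Longrightarrow> B t \<in> carrier_mat q q) \<Longrightarrow> list_prod q B ts \<in> carrier_mat q q"
proof (induction ts)
  case (Cons t ts)
  then have "B t \<in> carrier_mat q q" "list_prod q B ts \<in> carrier_mat q q" by simp_all
  then have "B t * list_prod q B ts \<in> carrier_mat q q" by (rule mult_carrier_mat)
  then show ?case by (simp add: list_prod_def)
qed (simp add: list_prod_def)

lemma list_prod_append:
  assumes "\<And>t. t \<in> set (ts @ us) \<Longrightarrow> B t \<in> carrier_mat q q"
  shows "list_prod q B (ts @ us) = list_prod q B ts * list_prod q B us"
  using assms
proof (induction ts)
  case Nil
  have "list_prod q B us \<in> carrier_mat q q" using Nil by (intro list_prod_carrier) auto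
  then show ?case by (simp add: list_prod_def)
next
  case (Cons t ts)
  have "B t \<in> carrier_mat q q" "list_prod q B ts \<in> carrier_mat q q" "list_prod q B us \<in> carrier_mat q q"
    using Cons.prems by (auto intro!: list_prod_carrier)
  then have "B t * (list_prod q B ts * list_prod q B us) = B t * list_prod q B ts * list_prod q B us"
    by (simp add: assoc_mult_mat[of _ q q _ q _ q])
  then show ?case using Cons by (simp add: list_prod_def)
qed

lemma sum_PiE_lessThan_Suc:
  fixes F :: "(nat \<Rightarrow> nat) \<Rightarrow> real"
  shows "(\<Sum>j\<in>{..<Suc n} \<rightarrow>\<^sub>E {..<q}. F j) = (\<Sum>j\<in>{..<n} \<rightarrow>\<^sub>E {..<q}. \<Sum>s<q. F (j(n := s)))"
proof -
  have "(\<Sum>j\<in>{..<Suc n} \<rightarrow>\<^sub>E {..<q}. F j) = (\<Sum>b\<in>({..<n} \<rightarrow>\<^sub>E {..<q}) \<times> {..<q}. F ((fst b)(n := snd b)))"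
  proof (rule sum.reindex_bij_witness[where i = "\<lambda>b. (fst b)(n := snd b)" and j = "\<lambda>j. (j(n := undefined), j n)"])
    fix b assume b: "b \<in> ({..<n} \<rightarrow>\<^sub>E {..<q}) \<times> {..<q}"
    then have f: "fst b \<in> {..<n} \<rightarrow>\<^sub>E {..<q}" and g: "snd b \<in> {..<q}" by (simp_all only: mem_Times_iff)
    from f have "fst b n = undefined" by (rule PiE_arb) simp
    then have "(fst b)(n := undefined) = fst b" by (metis fun_upd_triv)
    then show "(((fst b)(n := snd b))(n := undefined), ((fst b)(n := snd b)) n) = b" by simp
    show "(fst b)(n := snd b) \<in> {..<Suc n} \<rightarrow>\<^sub>E {..<q}"
      unfolding lessThan_Suc by (rule PiE_fun_upd[OF g f])
  next
    fix j assume j: "j \<in> {..<Suc n} \<rightarrow>\<^sub>E {..<q}"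
    show "(fst (j(n := undefined), j n))(n := snd (j(n := undefined), j n)) = j" by simp
    show "(j(n := undefined), j n) \<in> ({..<n} \<rightarrow>\<^sub>E {..<q}) \<times> {..<q}"
      using j by (auto simp: PiE_iff extensional_def)
    show "F ((fst (j(n := undefined), j n))(n := snd (j(n := undefined), j n))) = F j" by simp
  qed
  then show ?thesis by (simp only: sum_over_Times fst_conv snd_conv)
qed

text \<open>The weight \<open>h\<close> of the two endpoints is arbitrary, so that the induction can absorb the last step
  of the walk into it.\<close>
lemma open_walk_sum:
  assumes "\<And>t. t < n \<Longrightarrow> B t \<in> carrier_mat q q"
  shows "(\<Sum>j\<in>{..<Suc n} \<rightarrow>\<^sub>E {..<q}. (\<Prod>t<n. B t $$ (j t, j (Suc t))) * h (j 0) (j n)) =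
    (\<Sum>s<q. \<Sum>s'<q. list_prod q B [0..<n] $$ (s, s') * h s s')"
  using assms
proof (induction n arbitrary: h)
  case 0
  have "(\<Sum>j\<in>{..<Suc 0} \<rightarrow>\<^sub>E {..<q}. (\<Prod>t<0. B t $$ (j t, j (Suc t))) * h (j 0) (j 0)) = (\<Sum>s<q. h s s)"
    unfolding sum_PiE_lessThan_Suc by simp
  also have "\<dots> = (\<Sum>s<q. \<Sum>s'<q. if s' = s then h s s else 0)" by simp
  also have "\<dots> = (\<Sum>s<q. \<Sum>s'<q. 1\<^sub>m q $$ (s, s') * h s s')"
    by (intro sum.cong refl) auto
  finally show ?case by (simp add: list_prod_def)
next
  case (Suc n)
  have c: "list_prod q B [0..<n] \<in> carrier_mat q q" "B n \<in> carrier_mat q q"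
    using Suc.prems by (auto intro!: list_prod_carrier)
  have "list_prod q B [0..<Suc n] = list_prod q B [0..<n] * list_prod q B [n]"
    using Suc.prems by (subst list_prod_append[symmetric]) auto
  also have "list_prod q B [n] = B n" using c by (simp add: list_prod_def)
  finally have l: "list_prod q B [0..<Suc n] = list_prod q B [0..<n] * B n" .
  have "(\<Sum>j\<in>{..<Suc (Suc n)} \<rightarrow>\<^sub>E {..<q}. (\<Prod>t<Suc n. B t $$ (j t, j (Suc t))) * h (j 0) (j (Suc n))) =
      (\<Sum>j\<in>{..<Suc n} \<rightarrow>\<^sub>E {..<q}. (\<Prod>t<n. B t $$ (j t, j (Suc t))) * (\<Sum>s<q. B n $$ (j n, s) * h (j 0) s))"
    unfolding sum_PiE_lessThan_Suc[of _ "Suc n"] sum_distrib_left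
    by (intro sum.cong refl) (simp add: mult.assoc)
  also have "\<dots> = (\<Sum>s<q. \<Sum>s'<q. list_prod q B [0..<n] $$ (s, s') * (\<Sum>s''<q. B n $$ (s', s'') * h s s''))"
    using Suc.prems by (intro Suc.IH) auto
  also have "\<dots> = (\<Sum>s<q. \<Sum>s''<q. \<Sum>s'<q. list_prod q B [0..<n] $$ (s, s') * (B n $$ (s', s'') * h s s''))"
    unfolding sum_distrib_left by (intro sum.cong refl sum.swap)
  also have "\<dots> = (\<Sum>s<q. \<Sum>s''<q. list_prod q B [0..<Suc n] $$ (s, s'') * h s s'')"
    unfolding l
    by (intro sum.cong refl) (simp add: index_mult_mat_sum[OF c] sum_distrib_right mult.assoc del: index_mult_mat(1))
  finally show ?case .
qed

text \<open>The last step, which returns to the start, is the weight of the endpoints of an open walk.\<close>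
lemma closed_walk_sum:
  assumes B: "\<And>t. t < k \<Longrightarrow> B t \<in> carrier_mat q q" and k: "k \<ge> 1"
  shows "(\<Sum>j\<in>{..<k} \<rightarrow>\<^sub>E {..<q}. \<Prod>t<k. B t $$ (j t, j (Suc t mod k))) = mtrace (list_prod q B [0..<k])"
proof -
  obtain n where n: "k = Suc n" using k by (cases k) auto
  have Bn: "B t \<in> carrier_mat q q" if "t \<le> n" for t
    using that n by (intro B) simp
  have c: "list_prod q B [0..<n] \<in> carrier_mat q q" "B n \<in> carrier_mat q q"
    by (rule list_prod_carrier, rule Bn, simp) (rule Bn, simp)
  have "list_prod q B [0..<Suc n] = list_prod q B [0..<n] * list_prod q B [n]"
  proof -
    have "list_prod q B ([0..<n] @ [n]) = list_prod q B [0..<n] * list_prod q B [n]"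
      by (rule list_prod_append) (rule Bn, auto)
    then show ?thesis by (simp add: upt_Suc_append)
  qed
  also have "list_prod q B [n] = B n" using c by (simp add: list_prod_def)
  finally have l: "list_prod q B [0..<Suc n] = list_prod q B [0..<n] * B n" .
  have "(\<Sum>j\<in>{..<k} \<rightarrow>\<^sub>E {..<q}. \<Prod>t<k. B t $$ (j t, j (Suc t mod k))) =
      (\<Sum>j\<in>{..<Suc n} \<rightarrow>\<^sub>E {..<q}. (\<Prod>t<n. B t $$ (j t, j (Suc t))) * B n $$ (j n, j 0))"
    unfolding n by (intro sum.cong refl) simp
  also have "\<dots> = (\<Sum>s<q. \<Sum>s'<q. list_prod q B [0..<n] $$ (s, s') * B n $$ (s', s))"
    by (rule open_walk_sum[where h = "\<lambda>s s'. B n $$ (s', s)"]) (rule Bn, simp)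
  also have "\<dots> = mtrace (list_prod q B [0..<n] * B n)"
    by (rule mtrace_mult[OF c, symmetric])
  finally show ?thesis by (simp only: l n)
qed

lemma prod_lessThan_double: "(\<Prod>u<2 * k. f u) = (\<Prod>t<k. f (2 * t) * f (Suc (2 * t)))"
  for f :: "nat \<Rightarrow> real"
  by (induction k) (simp_all add: mult.assoc)

text \<open>Summing over the row index \<open>i\<^sub>t\<close>, which occurs only in the slots \<open>2t\<close> and \<open>2t + 1\<close>, multiplies
  their matrices; the column indices then form a closed walk.\<close>
lemma walk_sum_trace:
  assumes L: "\<And>u. L u \<in> carrier_mat p q" and k: "k \<ge> 1"
  shows "(\<Sum>w\<in>walks k p q. \<Prod>u<2 * k. L u $$ slot k w u) =
    mtrace (list_prod q (\<lambda>t. (L (2 * t))\<^sup>T * L (Suc (2 * t))) [0..<k])"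
proof -
  let ?B = "\<lambda>t. (L (2 * t))\<^sup>T * L (Suc (2 * t))"
  have B: "?B t \<in> carrier_mat q q" for t using L by (intro mult_carrier_mat[of _ q p]) auto
  have "(\<Sum>w\<in>walks k p q. \<Prod>u<2 * k. L u $$ slot k w u) =
      (\<Sum>j\<in>{..<k} \<rightarrow>\<^sub>E {..<q}. \<Sum>i\<in>{..<k} \<rightarrow>\<^sub>E {..<p}. \<Prod>u<2 * k. L u $$ slot k (i, j) u)"
    unfolding walks_def sum_over_Times by (rule sum.swap)
  also have "\<dots> = (\<Sum>j\<in>{..<k} \<rightarrow>\<^sub>E {..<q}. \<Prod>t<k. ?B t $$ (j t, j (Suc t mod k)))"
  proof (rule sum.cong[OF refl])
    fix j assume j: "j \<in> {..<k} \<rightarrow>\<^sub>E {..<q}"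
    have "(\<Sum>i\<in>{..<k} \<rightarrow>\<^sub>E {..<p}. \<Prod>u<2 * k. L u $$ slot k (i, j) u) =
        (\<Sum>i\<in>{..<k} \<rightarrow>\<^sub>E {..<p}. \<Prod>t<k. L (2 * t) $$ (i t, j t) * L (Suc (2 * t)) $$ (i t, j (Suc t mod k)))"
      by (simp add: prod_lessThan_double slot_def)
    also have "\<dots> = (\<Prod>t<k. \<Sum>r<p. L (2 * t) $$ (r, j t) * L (Suc (2 * t)) $$ (r, j (Suc t mod k)))"
      by (rule prod_sum_PiE[symmetric]) auto
    also have "\<dots> = (\<Prod>t<k. ?B t $$ (j t, j (Suc t mod k)))"
    proof (rule prod.cong[OF refl])
      fix t assume t: "t \<in> {..<k}"
      have jt: "j t < q" "j (Suc t mod k) < q" using j t by (auto simp: PiE_iff)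
      have "?B t $$ (j t, j (Suc t mod k)) = (\<Sum>r<p. (L (2 * t))\<^sup>T $$ (j t, r) * L (Suc (2 * t)) $$ (r, j (Suc t mod k)))"
        using L jt by (intro index_mult_mat_sum[of _ q p _ q]) auto
      also have "\<dots> = (\<Sum>r<p. L (2 * t) $$ (r, j t) * L (Suc (2 * t)) $$ (r, j (Suc t mod k)))"
        using L[of "2 * t"] jt by (intro sum.cong) auto
      finally show "(\<Sum>r<p. L (2 * t) $$ (r, j t) * L (Suc (2 * t)) $$ (r, j (Suc t mod k))) =
          ?B t $$ (j t, j (Suc t mod k))" ..
    qed
    finally show "(\<Sum>i\<in>{..<k} \<rightarrow>\<^sub>E {..<p}. \<Prod>u<2 * k. L u $$ slot k (i, j) u) =
      (\<Prod>t<k. ?B t $$ (j t, j (Suc t mod k)))" .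
  qed
  also have "\<dots> = mtrace (list_prod q ?B [0..<k])"
    by (rule closed_walk_sum[OF B k])
  finally show ?thesis .
qed

section \<open>The second moment of a decoupled word\<close>

definition noise_mat :: "nat \<Rightarrow> nat \<Rightarrow> nat \<Rightarrow> (nat \<times> nat \<times> nat \<Rightarrow> real) \<Rightarrow> real mat" where
  "noise_mat p q c \<zeta> = mat p q (\<lambda>(r, s). \<zeta> (c, r, s))"

lemma noise_mat_carrier [simp]: "noise_mat p q c \<zeta> \<in> carrier_mat p q"
  by (simp add: noise_mat_def)

text \<open>Even slots are the transposed factors in \<open>walk_sum_trace\<close>, so colouring by parity makes the two
  noise factors in a pair independent. The colour \<open>2\<close> is used by one slot alone, so that the
  decoupled polynomial is linear in the noise of this colour.\<close>
definition slot_colour :: "nat \<Rightarrow> nat \<Rightarrow> nat" where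
  "slot_colour u\<^sub>0 u = (if u = u\<^sub>0 then 2 else u mod 2)"

definition decoupled_part ::
  "nat \<Rightarrow> nat \<Rightarrow> nat \<Rightarrow> real mat \<Rightarrow> nat set \<Rightarrow> nat \<Rightarrow> (nat \<times> nat \<times> nat \<Rightarrow> real) \<Rightarrow> real" where
  "decoupled_part k p q A S u\<^sub>0 \<zeta> =
     (\<Sum>w\<in>walks k p q. (\<Prod>u\<in>{..<2 * k} - S. A $$ slot k w u) *
        (\<Prod>u\<in>S. \<zeta> (slot_colour u\<^sub>0 u, slot k w u)))"

lemma list_prod_eq_gram_word:
  assumes "\<And>t. t \<in> set ts \<Longrightarrow> B t = (if f t then A else Z)\<^sup>T * (if g t then A else Z')"
  shows "list_prod q B ts = gram_word q A Z Z' (map (\<lambda>t. (f t, g t)) ts)"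
  using assms by (induction ts) (auto simp: list_prod_def)

text \<open>The cyclic trace is rotated so that the pair with the slot \<open>u\<^sub>0\<close> comes first. If \<open>u\<^sub>0\<close> is even,
  then its noise is the first, transposed letter, and the trace is its inner product with the rest. If
  \<open>u\<^sub>0\<close> is odd, then the trace is transposed first, which exchanges the two parities.\<close>
lemma decoupled_part_linear:
  assumes A: "A \<in> carrier_mat p q" and S: "S \<subseteq> {..<2 * k}" and u: "u\<^sub>0 \<in> S"
  shows "\<exists>b c c' xs. (c, c') \<in> {(0, Suc 0), (Suc 0, 0)} \<and> length xs = k - 1 \<and>
    (\<forall>\<zeta>. decoupled_part k p q A S u\<^sub>0 \<zeta> = frob_inner (noise_mat p q 2 \<zeta>)
      ((if b then A else noise_mat p q c' \<zeta>) * gram_word q A (noise_mat p q c \<zeta>) (noise_mat p q c' \<zeta>) xs))"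
proof -
  define \<tau> where "\<tau> = u\<^sub>0 div 2"
  have \<tau>: "\<tau> < k" and k: "k \<ge> 1" using u S by (auto simp: \<tau>_def)
  define ts where "ts = [Suc \<tau>..<k] @ [0..<\<tau>]"
  define xs where "xs = map (\<lambda>t. (2 * t \<notin> S, Suc (2 * t) \<notin> S)) ts"
  have len: "length xs = k - 1" using \<tau> by (simp add: xs_def ts_def)
  let ?N = "\<lambda>c \<zeta>. noise_mat p q c \<zeta>"
  define L where "L \<zeta> u = (if u \<in> S then ?N (slot_colour u\<^sub>0 u) \<zeta> else A)" for \<zeta> u
  have L: "L \<zeta> u \<in> carrier_mat p q" for \<zeta> u using A by (simp add: L_def)
  let ?B = "\<lambda>\<zeta> t. (L \<zeta> (2 * t))\<^sup>T * L \<zeta> (Suc (2 * t))"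
  have B: "?B \<zeta> t \<in> carrier_mat q q" for \<zeta> t using L by (intro mult_carrier_mat[of _ q p]) auto
  define G where "G \<zeta> = gram_word q A (?N 0 \<zeta>) (?N (Suc 0) \<zeta>) xs" for \<zeta>
  have G: "G \<zeta> \<in> carrier_mat q q" for \<zeta>
    unfolding G_def by (rule gram_word_carrier[OF A noise_mat_carrier noise_mat_carrier])
  have tr: "decoupled_part k p q A S u\<^sub>0 \<zeta> = mtrace (?B \<zeta> \<tau> * G \<zeta>)" for \<zeta>
  proof -
    have "decoupled_part k p q A S u\<^sub>0 \<zeta> = (\<Sum>w\<in>walks k p q. \<Prod>u<2 * k. L \<zeta> u $$ slot k w u)"
      unfolding decoupled_part_def
    proof (rule sum.cong[OF refl])
      fix w assume w: "w \<in> walks k p q"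
      have "(\<Prod>u\<in>S. \<zeta> (slot_colour u\<^sub>0 u, slot k w u)) = (\<Prod>u\<in>S. L \<zeta> u $$ slot k w u)"
      proof (rule prod.cong[OF refl])
        fix u assume us: "u \<in> S"
        then have "slot k w u \<in> {..<p} \<times> {..<q}" using slot_in_range[OF w] S by blast
        then show "\<zeta> (slot_colour u\<^sub>0 u, slot k w u) = L \<zeta> u $$ slot k w u"
          using us by (cases "slot k w u") (simp add: L_def noise_mat_def)
      qed
      moreover have "(\<Prod>u\<in>{..<2 * k} - S. A $$ slot k w u) = (\<Prod>u\<in>{..<2 * k} - S. L \<zeta> u $$ slot k w u)"
        by (rule prod.cong) (auto simp: L_def)
      ultimately show "(\<Prod>u\<in>{..<2 * k} - S. A $$ slot k w u) * (\<Prod>u\<in>S. \<zeta> (slot_colour u\<^sub>0 u, slot k w u)) =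
          (\<Prod>u<2 * k. L \<zeta> u $$ slot k w u)"
        using prod.subset_diff[OF S, of "\<lambda>u. L \<zeta> u $$ slot k w u"] by simp
    qed
    also have "\<dots> = mtrace (list_prod q (?B \<zeta>) [0..<k])"
      by (rule walk_sum_trace[OF L k])
    also have "[0..<k] = [0..<\<tau>] @ [\<tau>] @ [Suc \<tau>..<k]"
      using upt_add_eq_append[of 0 \<tau> "k - \<tau>"] upt_conv_Cons[OF \<tau>] \<tau> by simp
    also have "list_prod q (?B \<zeta>) ([0..<\<tau>] @ [\<tau>] @ [Suc \<tau>..<k]) =
        list_prod q (?B \<zeta>) [0..<\<tau>] * (?B \<zeta> \<tau> * list_prod q (?B \<zeta>) [Suc \<tau>..<k])"
      by (subst list_prod_append, rule B) (simp add: list_prod_def)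
    also have "mtrace \<dots> = mtrace (?B \<zeta> \<tau> * list_prod q (?B \<zeta>) [Suc \<tau>..<k] * list_prod q (?B \<zeta>) [0..<\<tau>])"
      by (rule mtrace_comm[of _ q q]; intro mult_carrier_mat[of _ q q] list_prod_carrier B)
    also have "?B \<zeta> \<tau> * list_prod q (?B \<zeta>) [Suc \<tau>..<k] * list_prod q (?B \<zeta>) [0..<\<tau>] =
        ?B \<zeta> \<tau> * list_prod q (?B \<zeta>) ts"
      unfolding ts_def list_prod_append[OF B, simplified]
      by (rule assoc_mult_mat[of _ q q _ q _ q]; intro list_prod_carrier B)
    also have "list_prod q (?B \<zeta>) ts = G \<zeta>"
      unfolding G_def xs_def
    proof (rule list_prod_eq_gram_word)
      fix t assume "t \<in> set ts"
      then have "t \<noteq> \<tau>" by (auto simp: ts_def)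
      then have "2 * t \<noteq> u\<^sub>0" "Suc (2 * t) \<noteq> u\<^sub>0" by (auto simp: \<tau>_def)
      then show "?B \<zeta> t = (if 2 * t \<notin> S then A else ?N 0 \<zeta>)\<^sup>T * (if Suc (2 * t) \<notin> S then A else ?N (Suc 0) \<zeta>)"
        by (simp add: L_def slot_colour_def)
    qed
    finally show ?thesis .
  qed
  show ?thesis
  proof (cases "even u\<^sub>0")
    case True
    then have u0: "2 * \<tau> = u\<^sub>0" by (auto simp: \<tau>_def)
    define b where "b = (Suc u\<^sub>0 \<notin> S)"
    have "decoupled_part k p q A S u\<^sub>0 \<zeta> = frob_inner (?N 2 \<zeta>) ((if b then A else ?N (Suc 0) \<zeta>) * G \<zeta>)" for \<zeta>
    proof -
      let ?L' = "if b then A else ?N (Suc 0) \<zeta>"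
      have L': "?L' \<in> carrier_mat p q" using A by simp
      have "L \<zeta> (2 * \<tau>) = ?N 2 \<zeta>" "L \<zeta> (Suc (2 * \<tau>)) = ?L'"
        using True u by (auto simp: u0 L_def b_def slot_colour_def)
      then have "?B \<zeta> \<tau> * G \<zeta> = (?N 2 \<zeta>)\<^sup>T * (?L' * G \<zeta>)"
        using assoc_mult_mat[of "(?N 2 \<zeta>)\<^sup>T" q p ?L' q "G \<zeta>" q] L' G by simp
      moreover have "frob_inner (?N 2 \<zeta>) (?L' * G \<zeta>) = mtrace ((?N 2 \<zeta>)\<^sup>T * (?L' * G \<zeta>))"
        using L' G by (intro frob_inner_mtrace[of _ p q] mult_carrier_mat[of _ p q]) simp_all
      ultimately show ?thesis unfolding tr by simp
    qed
    then show ?thesis unfolding G_def using len by blast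
  next
    case False
    then have u0: "Suc (2 * \<tau>) = u\<^sub>0" by (auto simp: \<tau>_def elim!: oddE)
    define b where "b = (2 * \<tau> \<notin> S)"
    define ys where "ys = rev (map prod.swap xs)"
    have "decoupled_part k p q A S u\<^sub>0 \<zeta> = frob_inner (?N 2 \<zeta>) ((if b then A else ?N 0 \<zeta>) *
        gram_word q A (?N (Suc 0) \<zeta>) (?N 0 \<zeta>) ys)" for \<zeta>
    proof -
      let ?L' = "if b then A else ?N 0 \<zeta>" and ?Z = "?N 2 \<zeta>"
      have L': "?L' \<in> carrier_mat p q" using A by simp
      have Z: "?Z \<in> carrier_mat p q" by simp
      note c = L' Z G[of \<zeta>]
      have GT: "(G \<zeta>)\<^sup>T = gram_word q A (?N (Suc 0) \<zeta>) (?N 0 \<zeta>) ys"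
        unfolding G_def ys_def by (rule gram_word_transpose[OF A]) simp_all
      have "2 * \<tau> \<noteq> u\<^sub>0" using u0 by auto
      then have "L \<zeta> (2 * \<tau>) = ?L'" "L \<zeta> (Suc (2 * \<tau>)) = ?Z"
        using u u0 by (auto simp: L_def b_def slot_colour_def)
      then have "decoupled_part k p q A S u\<^sub>0 \<zeta> = mtrace (?L'\<^sup>T * ?Z * G \<zeta>)"
        unfolding tr by simp
      also have "\<dots> = mtrace (?L'\<^sup>T * ?Z * G \<zeta>)\<^sup>T"
        using c by (intro mtrace_transpose[symmetric, of _ q]) (intro mult_carrier_mat[of _ q q] mult_carrier_mat[of _ q p]; simp)
      also have "(?L'\<^sup>T * ?Z * G \<zeta>)\<^sup>T = (G \<zeta>)\<^sup>T * (?Z\<^sup>T * ?L')"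
      proof -
        have "(?L'\<^sup>T * ?Z * G \<zeta>)\<^sup>T = (G \<zeta>)\<^sup>T * (?L'\<^sup>T * ?Z)\<^sup>T"
          using c by (intro transpose_mult[of _ q q _ q] mult_carrier_mat[of _ q p]) simp_all
        also have "(?L'\<^sup>T * ?Z)\<^sup>T = ?Z\<^sup>T * ?L'"
          using c by (subst transpose_mult[of _ q p _ q]) simp_all
        finally show ?thesis .
      qed
      also have "mtrace \<dots> = mtrace (?Z\<^sup>T * ?L' * (G \<zeta>)\<^sup>T)"
        using c by (intro mtrace_comm[of _ q q] mult_carrier_mat[of _ q p]) simp_all
      also have "?Z\<^sup>T * ?L' * (G \<zeta>)\<^sup>T = ?Z\<^sup>T * (?L' * (G \<zeta>)\<^sup>T)"
        using c by (intro assoc_mult_mat[of _ q p _ q _ q]) simp_all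
      also have "mtrace \<dots> = frob_inner ?Z (?L' * (G \<zeta>)\<^sup>T)"
        using c by (intro frob_inner_mtrace[of _ p q, symmetric] mult_carrier_mat[of _ p q]) simp_all
      finally show ?thesis unfolding GT .
    qed
    moreover have "length ys = k - 1" using len by (simp add: ys_def)
    ultimately show ?thesis by blast
  qed
qed

lemma noise_mat_merge:
  assumes "c \<in> C" "C \<inter> C' = {}"
  shows "noise_mat p q c (merge (C \<times> ({..<p} \<times> {..<q})) (C' \<times> ({..<p} \<times> {..<q})) (x, y)) = noise_mat p q c x"
    and "noise_mat p q c (merge (C' \<times> ({..<p} \<times> {..<q})) (C \<times> ({..<p} \<times> {..<q})) (x, y)) = noise_mat p q c y"
  using assms by (auto simp: noise_mat_def merge_def intro!: eq_matI)

text \<open>A linear form in the noise of colour \<open>2\<close>, with the other colours held fixed, has as its second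
  moment the sum of the squares of its coefficients.\<close>
lemma decoupled_part_second_moment:
  assumes A: "A \<in> carrier_mat p q" and S: "S \<subseteq> {..<2 * k}" and u: "u\<^sub>0 \<in> S"
  shows "\<exists>b c c' xs. (c, c') \<in> {(0, Suc 0), (Suc 0, 0)} \<and> length xs = k - 1 \<and>
    (\<integral>\<^sup>+\<zeta>. ennreal ((decoupled_part k p q A S u\<^sub>0 \<zeta>)\<^sup>2) \<partial>gauss ({0, Suc 0, 2} \<times> ({..<p} \<times> {..<q}))) =
    (\<integral>\<^sup>+\<zeta>. ennreal (frob_sq ((if b then A else noise_mat p q c' \<zeta>) *
        gram_word q A (noise_mat p q c \<zeta>) (noise_mat p q c' \<zeta>) xs)) \<partial>gauss ({0, Suc 0} \<times> ({..<p} \<times> {..<q})))"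
proof -
  obtain b c c' xs where cc: "(c, c') \<in> {(0, Suc 0), (Suc 0, 0)}" and len: "length xs = k - 1"
    and lin: "\<And>\<zeta>. decoupled_part k p q A S u\<^sub>0 \<zeta> = frob_inner (noise_mat p q 2 \<zeta>)
      ((if b then A else noise_mat p q c' \<zeta>) * gram_word q A (noise_mat p q c \<zeta>) (noise_mat p q c' \<zeta>) xs)"
    using decoupled_part_linear[OF A S u] by blast
  let ?I = "{..<p} \<times> {..<q}"
  let ?J = "{0, Suc 0} \<times> ?I" and ?K = "{2 :: nat} \<times> ?I"
  define D where "D \<zeta> = (if b then A else noise_mat p q c' \<zeta>) * gram_word q A (noise_mat p q c \<zeta>) (noise_mat p q c' \<zeta>) xs" for \<zeta>
  have D: "D \<zeta> \<in> carrier_mat p q" for \<zeta>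
    unfolding D_def using A
    by (intro mult_carrier_mat[of _ p q] gram_word_carrier[of _ p]) simp_all
  define F where "F \<zeta> = ennreal ((decoupled_part k p q A S u\<^sub>0 \<zeta>)\<^sup>2)" for \<zeta>
  have cin: "c \<in> {0, Suc 0}" "c' \<in> {0, Suc 0}" using cc by auto
  have JK: "{0, Suc 0, 2} \<times> ?I = ?J \<union> ?K" by auto
  have colour: "slot_colour u\<^sub>0 v \<in> {0, Suc 0, 2}" for v
    by (auto simp: slot_colour_def)
  have meas: "F \<in> borel_measurable (gauss (?J \<union> ?K))"
    unfolding F_def decoupled_part_def JK[symmetric]
  proof (intro measurable_compose[OF _ measurable_ennreal] borel_measurable_power borel_measurable_sum
      borel_measurable_times borel_measurable_const borel_measurable_prod measurable_gauss_component)
    fix w v assume w: "w \<in> walks k p q" and v: "v \<in> S"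
    have "slot k w v \<in> ?I" using slot_in_range[OF w] S v by blast
    then show "(slot_colour u\<^sub>0 v, slot k w v) \<in> {0, Suc 0, 2} \<times> ?I" using colour[of v] by blast
  qed
  have "(\<integral>\<^sup>+\<zeta>. F \<zeta> \<partial>gauss (?J \<union> ?K)) = (\<integral>\<^sup>+x. \<integral>\<^sup>+y. F (merge ?J ?K (x, y)) \<partial>gauss ?K \<partial>gauss ?J)"
    by (rule product_sigma_finite.product_nn_integral_fold[OF product_sigma_finite_stdN _ _ _ meas]) auto
  also have "\<dots> = (\<integral>\<^sup>+x. ennreal (frob_sq (D x)) \<partial>gauss ?J)"
  proof (rule nn_integral_cong)
    fix x :: "nat \<times> nat \<times> nat \<Rightarrow> real"
    have sK: "(\<Sum>j\<in>?K. f j) = (\<Sum>(r, s)\<in>?I. f (2, r, s))" for f :: "nat \<times> nat \<times> nat \<Rightarrow> real"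
      by (simp add: sum_over_Times[of f "{2}" ?I] split_def)
    have "F (merge ?J ?K (x, y)) = ennreal ((\<Sum>j\<in>?K. D x $$ (snd j) * y j) ^ (2 * 1))" for y
    proof -
      have "decoupled_part k p q A S u\<^sub>0 (merge ?J ?K (x, y)) = frob_inner (noise_mat p q 2 y) (D x)"
        unfolding lin D_def
        using noise_mat_merge(1)[OF cin(1), of "{2}" p q x y] noise_mat_merge(1)[OF cin(2), of "{2}" p q x y]
          noise_mat_merge(2)[of 2 "{2}" "{0, Suc 0}" p q x y] by simp
      also have "\<dots> = (\<Sum>j\<in>?K. D x $$ (snd j) * y j)"
        unfolding sK by (auto simp: frob_inner_def noise_mat_def mult.commute intro!: sum.cong)
      finally show ?thesis by (simp add: F_def)
    qed
    then have "(\<integral>\<^sup>+y. F (merge ?J ?K (x, y)) \<partial>gauss ?K) =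
        ennreal (normal_mom 1 * (\<Sum>j\<in>?K. (D x $$ (snd j))\<^sup>2) ^ 1)"
      by (simp only: gauss_linear_moment[of ?K "\<lambda>j. D x $$ (snd j)" 1] finite_cartesian_product finite_lessThan finite.intros)
    also have "normal_mom 1 * (\<Sum>j\<in>?K. (D x $$ (snd j))\<^sup>2) ^ 1 = frob_sq (D x)"
      unfolding sK using D[of x] by (simp add: normal_mom_def frob_sq_def)
    finally show "(\<integral>\<^sup>+y. F (merge ?J ?K (x, y)) \<partial>gauss ?K) = ennreal (frob_sq (D x))" .
  qed
  finally show ?thesis
    using cc len unfolding F_def JK D_def by blast
qed

section \<open>Expected size of an open word\<close>

lemma ennreal_normalised_le_1:
  fixes e :: ennreal
  assumes "e \<le> ennreal x" "x \<le> y" "y > 0"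
  shows "e * ennreal (1 / y) \<le> 1"
proof -
  have "e * ennreal (1 / y) \<le> ennreal y * ennreal (1 / y)"
    using assms by (intro mult_right_mono order_trans[OF assms(1) ennreal_leI]) auto
  also have "\<dots> = 1" using assms(3) by (subst ennreal_mult[symmetric]) auto
  finally show ?thesis .
qed

text \<open>The expectations of \<open>bilin_mom\<close> for the compressed noise, for the full noise matrix and
  for a product of two, in the units of \<open>operator_norm_from_bilin_mom\<close>. Each bound
  \<open>chi_mom \<le> 9\<^sup>M normal_mom\<close> contributes \<open>9\<close> and \<open>normal_mom \<le> (2M)\<^sup>M\<close> contributes \<open>2M\<close>; with two
  dimensions \<open>q\<close> that is \<open>9 \<sqdot> 9 \<sqdot> 2 M = 162 M\<close>. The same constant in \<open>P\<close> makes \<open>Q \<le> P\<close>.\<close>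
lemma moment_products_le:
  fixes p q M :: nat
  assumes q: "q \<le> M"
  defines "Q \<equiv> 162 * real M" and "P \<equiv> 162 * (real p + 2 * real M)"
  shows "normal_mom M * chi_mom q M * chi_mom q M \<le> (normal_mom M)\<^sup>2 * Q ^ M"
    and "normal_mom M * chi_mom p M * chi_mom q M \<le> (normal_mom M)\<^sup>2 * P ^ M"
    and "normal_mom M * chi_mom p M * chi_mom q M * chi_mom q M \<le> (normal_mom M)\<^sup>2 * (P * Q) ^ M"
proof -
  let ?g = "normal_mom M"
  have g: "?g \<ge> 0" using normal_mom_pos[of M] by simp
  have cq: "chi_mom q M \<le> 9 ^ M * ?g" by (rule chi_mom_le_normal_mom[OF q])
  have cp: "chi_mom p M \<le> (real p + 2 * real M) ^ M" by (rule chi_mom_le)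
  note nn = chi_mom_nonneg[of q M] chi_mom_nonneg[of p M]
  have qq: "chi_mom q M * chi_mom q M \<le> ?g * Q ^ M"
  proof -
    have "chi_mom q M * chi_mom q M \<le> (9 ^ M * ?g) * (9 ^ M * ?g)"
      using cq nn g by (intro mult_mono) auto
    also have "\<dots> = ?g * (81 ^ M * ?g)"
      by (simp add: mult_ac flip: power_mult_distrib)
    also have "\<dots> \<le> ?g * (81 ^ M * (2 * real M) ^ M)"
      using normal_mom_le[of M] g by (intro mult_left_mono) auto
    also have "81 ^ M * (2 * real M) ^ M = Q ^ M"
      unfolding Q_def power_mult_distrib[symmetric] mult.assoc[symmetric] by simp
    finally show ?thesis .
  qed
  have pP: "chi_mom p M \<le> P ^ M"
    by (rule order_trans[OF cp]) (auto simp: P_def intro!: power_mono)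
  show "?g * chi_mom q M * chi_mom q M \<le> ?g\<^sup>2 * Q ^ M"
    using mult_left_mono[OF qq g] by (simp add: power2_eq_square mult_ac)
  show "?g * chi_mom p M * chi_mom q M * chi_mom q M \<le> ?g\<^sup>2 * (P * Q) ^ M"
  proof -
    have "chi_mom p M * (chi_mom q M * chi_mom q M) \<le> P ^ M * (?g * Q ^ M)"
      by (intro mult_mono qq pP mult_nonneg_nonneg nn zero_le_power) (simp add: P_def)
    from mult_left_mono[OF this g] show ?thesis
      by (simp add: power2_eq_square power_mult_distrib mult_ac)
  qed
  show "?g * chi_mom p M * chi_mom q M \<le> ?g\<^sup>2 * P ^ M"
  proof -
    have "chi_mom p M * chi_mom q M \<le> (real p + 2 * real M) ^ M * (9 ^ M * ?g)"
      using cp cq nn by (intro mult_mono) auto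
    also have "\<dots> = ?g * (9 * (real p + 2 * real M)) ^ M"
      unfolding power_mult_distrib by (simp only: mult_ac)
    also have "\<dots> \<le> ?g * P ^ M"
      using g by (intro mult_left_mono power_mono) (auto simp: P_def)
    finally have "chi_mom p M * chi_mom q M \<le> ?g * P ^ M" .
    from mult_left_mono[OF this g] show ?thesis
      by (simp add: power2_eq_square mult_ac)
  qed
qed

text \<open>The two cases of \<open>frob_sq_open_word_le\<close> for operator norms governed by \<open>s = \<rho> t\<close> and
  \<open>c = P t\<close>: all dependence on the random size \<open>t\<close> is collected in one power of \<open>t\<close>.\<close>
lemma word_bound_real:
  fixes t \<rho> P Q T T' :: real and q k :: nat
  assumes "t \<ge> 1" "\<rho> \<ge> 0" "real q \<le> \<rho>" "k \<ge> 1" "T \<ge> 0" "T' \<ge> 0" "P \<ge> 0"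
    and PQ: "P * Q = \<rho>\<^sup>2" and qQ: "real q \<le> Q"
  defines "Bd \<equiv> (P * Q) ^ k + P * T + T'"
  shows "real q * (\<rho> * t) ^ (2 * k - 1) + T' \<le> t ^ (2 * k - 1) * Bd"
    and "P * t * (real q * (\<rho> * t) ^ (2 * k - 2) + T) \<le> t ^ (2 * k - 1) * Bd"
proof -
  let ?n = "2 * k - 1"
  have t: "t ^ ?n \<ge> 1" using assms(1) by simp
  have rk: "\<rho> ^ (2 * k) = (P * Q) ^ k" by (simp add: PQ power_mult)
  have PT: "P * T \<ge> 0" using assms by simp
  have "real q * \<rho> ^ ?n \<le> \<rho> * \<rho> ^ ?n" using assms by (intro mult_right_mono) auto
  also have "\<rho> * \<rho> ^ ?n = \<rho> ^ (2 * k)"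
    using assms(4) by (simp flip: power_Suc)
  finally have 1: "real q * \<rho> ^ ?n \<le> (P * Q) ^ k" by (simp add: rk)
  have "real q * (\<rho> * t) ^ ?n + T' = t ^ ?n * (real q * \<rho> ^ ?n) + 1 * T'"
    by (simp add: power_mult_distrib mult_ac)
  also have "\<dots> \<le> t ^ ?n * (P * Q) ^ k + t ^ ?n * T'"
    using 1 t assms by (intro add_mono mult_left_mono mult_right_mono) auto
  also have "\<dots> \<le> t ^ ?n * Bd"
    using t PT by (simp add: Bd_def ring_distribs)
  finally show "real q * (\<rho> * t) ^ ?n + T' \<le> t ^ ?n * Bd" .
  have "P * real q * \<rho> ^ (2 * k - 2) \<le> P * Q * \<rho> ^ (2 * k - 2)"
    using assms by (intro mult_right_mono mult_left_mono) auto
  also have "\<dots> = \<rho> ^ (2 + (2 * k - 2))"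
    unfolding PQ power_add ..
  also have "2 + (2 * k - 2) = 2 * k" using assms(4) by simp
  finally have 2: "P * real q * \<rho> ^ (2 * k - 2) \<le> (P * Q) ^ k" by (simp add: rk)
  have "?n = Suc (2 * k - 2)" using assms(4) by simp
  then have tn: "t * t ^ (2 * k - 2) = t ^ ?n" by (simp only: power_Suc)
  have tn': "t \<le> t ^ ?n"
    using assms(1,4) power_increasing[of 1 ?n t] by simp
  have "P * t * (real q * (\<rho> * t) ^ (2 * k - 2) + T) =
      (t * t ^ (2 * k - 2)) * (P * real q * \<rho> ^ (2 * k - 2)) + t * (P * T)"
    by (simp add: power_mult_distrib algebra_simps)
  also have "\<dots> \<le> t ^ ?n * (P * Q) ^ k + t ^ ?n * (P * T)"
    unfolding tn using 2 t tn' PT by (intro add_mono mult_left_mono mult_right_mono) auto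
  also have "\<dots> \<le> t ^ ?n * Bd"
    using t assms by (simp add: Bd_def ring_distribs)
  finally show "P * t * (real q * (\<rho> * t) ^ (2 * k - 2) + T) \<le> t ^ ?n * Bd" .
qed

text \<open>All operator norms in the word are controlled by one random variable \<open>\<Theta>\<close> with expectation at
  most \<open>6\<close>: the sum of \<open>1\<close> and of five averages \<open>bilin_mom\<close>, each divided by its expected size. With
  \<open>\<theta>\<close> its value and \<open>t\<^sup>M = \<theta>\<close>, the word is bounded by \<open>t\<^sup>2\<^sup>k\<^sup>-\<^sup>1 \<le> \<theta>\<close> times a
  constant. The choice \<open>M = q + 2k\<close> is large enough for this step and for \<open>chi_mom_le_normal_mom\<close> in
  dimension \<open>q\<close>, and it keeps \<open>Q\<close> of order \<open>q + k\<close>.\<close>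
lemma expected_word_bound:
  fixes p q k M :: nat
  assumes A: "A \<in> carrier_mat p q" and k: "k \<ge> 1" and cc: "(c, c') \<in> {(0, Suc 0), (Suc 0, 0)}"
    and len: "length xs = k - 1"
    and q: "q \<ge> 1" and M: "M = q + 2 * k"
  defines "Q \<equiv> 162 * real M" and "P \<equiv> 162 * (real p + 2 * real M)"
  defines "Bd \<equiv> (P * Q) ^ k + P * (\<Sum>i=1..q. singular_value i A ^ (4 * k - 4)) +
      (\<Sum>i=1..q. singular_value i A ^ (4 * k - 2))"
  shows "(\<integral>\<^sup>+\<zeta>. ennreal (frob_sq ((if b then A else noise_mat p q c' \<zeta>) *
      gram_word q A (noise_mat p q c \<zeta>) (noise_mat p q c' \<zeta>) xs))
      \<partial>gauss ({0, Suc 0} \<times> ({..<p} \<times> {..<q}))) \<le> ennreal (6 * Bd)"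
proof -
  let ?C = "{0, Suc 0}"
  let ?J = "?C \<times> ({..<p} \<times> {..<q})"
  interpret G: prob_space "gauss ?J" by (rule prob_space_gauss)
  obtain U where U: "U \<in> carrier_mat p q" "U * (U\<^sup>T * A) = A"
    "\<And>v::nat \<Rightarrow> real. (\<Sum>r<p. (\<Sum>l<q. U $$ (r, l) * v l)\<^sup>2) \<le> (\<Sum>l<q. (v l)\<^sup>2)"
    using column_space_isometry[OF A] by blast
  have M0: "M > 0" "q \<le> M" "2 * k - 1 \<le> M" using q M by auto
  have QP: "Q > 0" "P > 0" "Q \<le> P" "real q \<le> Q" using M0 by (auto simp: Q_def P_def)
  define \<rho> where "\<rho> = sqrt (P * Q)"
  have PQ: "P * Q = \<rho>\<^sup>2" and \<rho>0: "\<rho> > 0" using QP by (auto simp: \<rho>_def)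
  have Q\<rho>: "Q \<le> \<rho>"
  proof (rule power2_le_imp_le)
    have "Q\<^sup>2 \<le> P * Q" using QP by (auto simp: power2_eq_square)
    then show "Q\<^sup>2 \<le> \<rho>\<^sup>2" unfolding PQ .
  qed (use \<rho>0 in simp)
  define X where "X d \<zeta> = (\<lambda>l s. \<Sum>r<p. U $$ (r, l) * \<zeta> (d, r, s))" for d :: nat and \<zeta> :: "nat \<times> nat \<times> nat \<Rightarrow> real"
  define Y where "Y d \<zeta> = (\<lambda>i s. \<Sum>r<p. (if r = i then 1 else 0) * \<zeta> (d, r, s))" for d :: nat and \<zeta> :: "nat \<times> nat \<times> nat \<Rightarrow> real"
  define W where "W \<zeta> = (\<lambda>l s. \<Sum>r<p. \<zeta> (0, r, l) * \<zeta> (Suc 0, r, s))" for \<zeta> :: "nat \<times> nat \<times> nat \<Rightarrow> real"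
  define eX where "eX d \<zeta> = bilin_mom M {..<q} {..<q} (X d \<zeta>) * ennreal (1 / ((normal_mom M)\<^sup>2 * Q ^ M))" for d \<zeta>
  define eY where "eY d \<zeta> = bilin_mom M {..<p} {..<q} (Y d \<zeta>) * ennreal (1 / ((normal_mom M)\<^sup>2 * P ^ M))" for d \<zeta>
  define eW where "eW \<zeta> = bilin_mom M {..<q} {..<q} (W \<zeta>) * ennreal (1 / ((normal_mom M)\<^sup>2 * (P * Q) ^ M))" for \<zeta>
  define \<Theta> where "\<Theta> \<zeta> = 1 + eX 0 \<zeta> + eX (Suc 0) \<zeta> + eY 0 \<zeta> + eY (Suc 0) \<zeta> + eW \<zeta>" for \<zeta>
  have gM: "(normal_mom M)\<^sup>2 * R ^ M > 0" if "R > 0" for R using normal_mom_pos[of M] that by simp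
  have comp: "(\<lambda>\<zeta>. \<zeta> (d, r, s)) \<in> borel_measurable (gauss ?J)" if "d \<in> ?C" "r < p" "s < q" for d r s
    using that by (intro measurable_gauss_component) auto
  have mX: "(\<lambda>\<zeta>. bilin_mom M {..<q} {..<q} (X d \<zeta>)) \<in> borel_measurable (gauss ?J)" if "d \<in> ?C" for d
    unfolding X_def using that
    by (intro measurable_bilin_mom borel_measurable_sum borel_measurable_times borel_measurable_const comp) auto
  have mY: "(\<lambda>\<zeta>. bilin_mom M {..<p} {..<q} (Y d \<zeta>)) \<in> borel_measurable (gauss ?J)" if "d \<in> ?C" for d
    unfolding Y_def using that
    by (intro measurable_bilin_mom borel_measurable_sum borel_measurable_times borel_measurable_const comp) auto
  have mW: "(\<lambda>\<zeta>. bilin_mom M {..<q} {..<q} (W \<zeta>)) \<in> borel_measurable (gauss ?J)"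
    unfolding W_def
    by (intro measurable_bilin_mom borel_measurable_sum borel_measurable_times comp) auto
  have meX: "eX d \<in> borel_measurable (gauss ?J)" if "d \<in> ?C" for d
    unfolding eX_def by (intro borel_measurable_times_ennreal mX that) simp
  have meY: "eY d \<in> borel_measurable (gauss ?J)" if "d \<in> ?C" for d
    unfolding eY_def by (intro borel_measurable_times_ennreal mY that) simp
  have meW: "eW \<in> borel_measurable (gauss ?J)"
    unfolding eW_def by (intro borel_measurable_times_ennreal mW) simp
  have iX: "(\<integral>\<^sup>+\<zeta>. eX d \<zeta> \<partial>gauss ?J) \<le> 1" if d: "d \<in> ?C" for d
  proof -
    have "(\<integral>\<^sup>+\<zeta>. eX d \<zeta> \<partial>gauss ?J) = (\<integral>\<^sup>+\<zeta>. bilin_mom M {..<q} {..<q} (X d \<zeta>) \<partial>gauss ?J) *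
        ennreal (1 / ((normal_mom M)\<^sup>2 * Q ^ M))"
      unfolding eX_def by (rule nn_integral_multc[OF mX[OF d]])
    also have "\<dots> \<le> 1"
    proof (rule ennreal_normalised_le_1)
      show "(\<integral>\<^sup>+\<zeta>. bilin_mom M {..<q} {..<q} (X d \<zeta>) \<partial>gauss ?J) \<le> ennreal (normal_mom M * chi_mom q M * chi_mom q M)"
        unfolding X_def
        using bilin_mom_projected_noise[of ?C d "{..<q}" "\<lambda>r l. U $$ (r, l)" p q M] U(3) d by simp
      show "normal_mom M * chi_mom q M * chi_mom q M \<le> (normal_mom M)\<^sup>2 * Q ^ M"
        unfolding Q_def by (rule moment_products_le(1)[OF M0(2)])
    qed (rule gM[OF QP(1)])
    finally show ?thesis .
  qed
  have iY: "(\<integral>\<^sup>+\<zeta>. eY d \<zeta> \<partial>gauss ?J) \<le> 1" if d: "d \<in> ?C" for d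
  proof -
    have "(\<integral>\<^sup>+\<zeta>. eY d \<zeta> \<partial>gauss ?J) = (\<integral>\<^sup>+\<zeta>. bilin_mom M {..<p} {..<q} (Y d \<zeta>) \<partial>gauss ?J) *
        ennreal (1 / ((normal_mom M)\<^sup>2 * P ^ M))"
      unfolding eY_def by (rule nn_integral_multc[OF mY[OF d]])
    also have "\<dots> \<le> 1"
    proof (rule ennreal_normalised_le_1)
      have "(\<Sum>r<p. (\<Sum>i<p. (if r = i then 1 else 0) * g i)\<^sup>2) \<le> (\<Sum>i<p. (g i)\<^sup>2)" for g :: "nat \<Rightarrow> real"
        by (simp add: if_distrib[of "\<lambda>x. x * _"] cong: if_cong)
      then show "(\<integral>\<^sup>+\<zeta>. bilin_mom M {..<p} {..<q} (Y d \<zeta>) \<partial>gauss ?J) \<le> ennreal (normal_mom M * chi_mom p M * chi_mom q M)"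
        unfolding Y_def
        using bilin_mom_projected_noise[of ?C d "{..<p}" "\<lambda>r i. if r = i then 1 else 0" p q M] d by simp
      show "normal_mom M * chi_mom p M * chi_mom q M \<le> (normal_mom M)\<^sup>2 * P ^ M"
        unfolding P_def by (rule moment_products_le(2)[OF M0(2)])
    qed (rule gM[OF QP(2)])
    finally show ?thesis .
  qed
  have iW: "(\<integral>\<^sup>+\<zeta>. eW \<zeta> \<partial>gauss ?J) \<le> 1"
  proof -
    have "(\<integral>\<^sup>+\<zeta>. eW \<zeta> \<partial>gauss ?J) = (\<integral>\<^sup>+\<zeta>. bilin_mom M {..<q} {..<q} (W \<zeta>) \<partial>gauss ?J) *
        ennreal (1 / ((normal_mom M)\<^sup>2 * (P * Q) ^ M))"
      unfolding eW_def by (rule nn_integral_multc[OF mW])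
    also have "\<dots> \<le> 1"
    proof (rule ennreal_normalised_le_1)
      show "(\<integral>\<^sup>+\<zeta>. bilin_mom M {..<q} {..<q} (W \<zeta>) \<partial>gauss ?J) \<le>
          ennreal (normal_mom M * chi_mom p M * chi_mom q M * chi_mom q M)"
        unfolding W_def bilin_mom_product_of_noises by simp
      show "normal_mom M * chi_mom p M * chi_mom q M * chi_mom q M \<le> (normal_mom M)\<^sup>2 * (P * Q) ^ M"
        unfolding P_def Q_def by (rule moment_products_le(3)[OF M0(2)])
    qed (use QP in \<open>intro gM mult_pos_pos\<close>)
    finally show ?thesis .
  qed
  have i\<Theta>: "(\<integral>\<^sup>+\<zeta>. \<Theta> \<zeta> \<partial>gauss ?J) \<le> 6"
  proof -
    have "(\<integral>\<^sup>+\<zeta>. \<Theta> \<zeta> \<partial>gauss ?J) = 1 + (\<integral>\<^sup>+\<zeta>. eX 0 \<zeta> \<partial>gauss ?J) + (\<integral>\<^sup>+\<zeta>. eX (Suc 0) \<zeta> \<partial>gauss ?J) +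
        (\<integral>\<^sup>+\<zeta>. eY 0 \<zeta> \<partial>gauss ?J) + (\<integral>\<^sup>+\<zeta>. eY (Suc 0) \<zeta> \<partial>gauss ?J) + (\<integral>\<^sup>+\<zeta>. eW \<zeta> \<partial>gauss ?J)"
      unfolding \<Theta>_def using meX meY meW
      by (simp add: nn_integral_add G.emeasure_space_1)
    also have "\<dots> \<le> 1 + 1 + 1 + 1 + 1 + 1"
      by (intro add_mono order_refl iX iY iW) simp_all
    finally show ?thesis by simp
  qed
  have T0: "(\<Sum>i=1..q. singular_value i A ^ n) \<ge> 0" for n
    using singular_value_nonneg[OF A] by (intro sum_nonneg zero_le_power) auto
  have Bd0: "Bd > 0"
    unfolding Bd_def using QP T0[of "4 * k - 4"] T0[of "4 * k - 2"]
    by (intro add_pos_nonneg mult_nonneg_nonneg zero_less_power mult_pos_pos) auto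
  define D where "D \<zeta> = (if b then A else noise_mat p q c' \<zeta>) *
      gram_word q A (noise_mat p q c \<zeta>) (noise_mat p q c' \<zeta>) xs" for \<zeta>
  have pointwise: "ennreal (frob_sq (D \<zeta>)) \<le> \<Theta> \<zeta> * ennreal Bd" for \<zeta>
  proof (cases "\<Theta> \<zeta> = \<top>")
    case True
    then show ?thesis using Bd0 by (simp add: ennreal_top_mult)
  next
    case False
    define \<theta> where "\<theta> = enn2real (\<Theta> \<zeta>)"
    have \<theta>: "\<Theta> \<zeta> = ennreal \<theta>" using False by (simp add: \<theta>_def less_top)
    have "1 \<le> \<Theta> \<zeta>" unfolding \<Theta>_def by (simp add: add.assoc)
    then have \<theta>1: "\<theta> \<ge> 1" unfolding \<theta> by simp
    define t where "t = root M \<theta>"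
    have tM: "t ^ M = \<theta>" using M0 \<theta>1 by (simp add: t_def)
    have t1: "t \<ge> 1" using M0 \<theta>1 by (simp add: t_def real_root_ge_1_iff)
    have le: "eX 0 \<zeta> \<le> ennreal (t ^ M)" "eX (Suc 0) \<zeta> \<le> ennreal (t ^ M)" "eY 0 \<zeta> \<le> ennreal (t ^ M)"
        "eY (Suc 0) \<zeta> \<le> ennreal (t ^ M)" "eW \<zeta> \<le> ennreal (t ^ M)"
      unfolding tM \<theta>[symmetric] \<Theta>_def by (auto intro: add_increasing add_increasing2)
    let ?N = "\<lambda>d. noise_mat p q d \<zeta>"
    have t0: "t \<ge> 0" using t1 by simp
    have opX: "opnorm_sq_le q (\<rho> * t) (U\<^sup>T * ?N d)" if d: "d \<in> ?C" for d
    proof -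
      have "eX d \<zeta> \<le> ennreal (t ^ M)" using le d by auto
      then have "(\<Sum>i<q. (\<Sum>j<q. X d \<zeta> i j * v j)\<^sup>2) \<le> Q * t * (\<Sum>j<q. (v j)\<^sup>2)" for v
        unfolding eX_def using QP t0 M0
        by (intro operator_norm_from_bilin_mom[where M = M]) auto
      moreover have "(U\<^sup>T * ?N d) $$ (i, j) = X d \<zeta> i j" if "i < q" "j < q" for i j
        using U(1) that by (subst index_mult_mat_sum[of _ q p _ q]) (auto simp: X_def noise_mat_def)
      moreover have "U\<^sup>T * ?N d \<in> carrier_mat q q"
        using U(1) by (intro mult_carrier_mat[of _ q p]) auto
      ultimately have "opnorm_sq_le q (Q * t) (U\<^sup>T * ?N d)"
        using QP t0 by (intro opnorm_sq_leI) auto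
      then show ?thesis by (rule opnorm_sq_le_mono) (use Q\<rho> t0 in \<open>intro mult_right_mono\<close>)
    qed
    have opW: "opnorm_sq_le q ((\<rho> * t)\<^sup>2) ((?N 0)\<^sup>T * ?N (Suc 0))"
    proof -
      have "(\<Sum>i<q. (\<Sum>j<q. W \<zeta> i j * v j)\<^sup>2) \<le> P * Q * t * (\<Sum>j<q. (v j)\<^sup>2)" for v
        using le(5) QP t0 M0 unfolding eW_def
        by (intro operator_norm_from_bilin_mom[where M = M]) auto
      moreover have "((?N 0)\<^sup>T * ?N (Suc 0)) $$ (i, j) = W \<zeta> i j" if "i < q" "j < q" for i j
        using that by (subst index_mult_mat_sum[of _ q p _ q]) (auto simp: W_def noise_mat_def)
      moreover have "(?N 0)\<^sup>T * ?N (Suc 0) \<in> carrier_mat q q"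
        by (intro mult_carrier_mat[of _ q p]) auto
      ultimately have "opnorm_sq_le q (P * Q * t) ((?N 0)\<^sup>T * ?N (Suc 0))"
        using QP t0 by (intro opnorm_sq_leI) auto
      moreover have "P * Q * t \<le> (\<rho> * t)\<^sup>2"
        unfolding PQ power_mult_distrib using t1 by (intro mult_left_mono) (auto simp: power2_eq_square)
      ultimately show ?thesis by (rule opnorm_sq_le_mono)
    qed
    have opZ: "(\<Sum>i<p. (\<Sum>j<q. ?N d $$ (i, j) * v j)\<^sup>2) \<le> P * t * (\<Sum>j<q. (v j)\<^sup>2)" if d: "d \<in> ?C" for d v
    proof -
      have "eY d \<zeta> \<le> ennreal (t ^ M)" using le d by auto
      then have "(\<Sum>i<p. (\<Sum>j<q. Y d \<zeta> i j * v j)\<^sup>2) \<le> P * t * (\<Sum>j<q. (v j)\<^sup>2)"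
        unfolding eY_def using QP t0 M0
        by (intro operator_norm_from_bilin_mom[where M = M]) auto
      moreover have "Y d \<zeta> i j = ?N d $$ (i, j)" if "i < p" "j < q" for i j
        using that by (simp add: Y_def noise_mat_def if_distrib[of "\<lambda>x. x * _"] cong: if_cong)
      then have "(\<Sum>i<p. (\<Sum>j<q. ?N d $$ (i, j) * v j)\<^sup>2) = (\<Sum>i<p. (\<Sum>j<q. Y d \<zeta> i j * v j)\<^sup>2)"
        by (intro sum.cong refl arg_cong[where f = "\<lambda>z. z\<^sup>2"]) auto
      ultimately show ?thesis by (simp only:)
    qed
    have cin: "c \<in> ?C" "c' \<in> ?C" using cc by auto
    have opW': "opnorm_sq_le q ((\<rho> * t)\<^sup>2) ((?N c)\<^sup>T * ?N c')"
    proof -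
      have "((?N 0)\<^sup>T * ?N (Suc 0))\<^sup>T = (?N (Suc 0))\<^sup>T * ?N 0"
        by (subst transpose_mult[of _ q p _ q]) auto
      then show ?thesis using cc opW opnorm_sq_le_transpose[OF opW] by auto
    qed
    have arith: "2 * (k - 1) = 2 * k - 2" "2 * k - 2 + 1 = 2 * k - 1"
      "4 * (k - 1) = 4 * k - 4" "4 * k - 4 + 2 = 4 * k - 2" using k by auto
    have Pt: "P * t \<ge> 0" using QP t0 by simp
    note words = frob_sq_open_word_le[OF A noise_mat_carrier noise_mat_carrier U
        opX[OF cin(1)] opX[OF cin(2)] opW' Pt opZ[OF cin(2)] len, unfolded arith]
    have q\<rho>: "real q \<le> \<rho>" using QP(4) Q\<rho> by simp
    note bd = word_bound_real[OF t1 less_imp_le[OF \<rho>0] q\<rho> k T0[of "4 * k - 4"] T0[of "4 * k - 2"]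
        less_imp_le[OF QP(2)] PQ QP(4), folded Bd_def]
    have "frob_sq (D \<zeta>) \<le> t ^ (2 * k - 1) * Bd"
      using order_trans[OF words(1) bd(1)] order_trans[OF words(2) bd(2)]
      by (cases b) (simp_all add: D_def)
    also have "\<dots> \<le> \<theta> * Bd"
      unfolding tM[symmetric] using t1 M0 Bd0 by (intro mult_right_mono power_increasing) auto
    finally have "ennreal (frob_sq (D \<zeta>)) \<le> ennreal (\<theta> * Bd)" by (rule ennreal_leI)
    then show ?thesis unfolding \<theta> using \<theta>1 Bd0 by (subst ennreal_mult[symmetric]) auto
  qed
  have m\<Theta>: "\<Theta> \<in> borel_measurable (gauss ?J)"
    unfolding \<Theta>_def by (intro borel_measurable_add borel_measurable_const meX meY meW) simp_all
  have "(\<integral>\<^sup>+\<zeta>. ennreal (frob_sq (D \<zeta>)) \<partial>gauss ?J) \<le> (\<integral>\<^sup>+\<zeta>. \<Theta> \<zeta> * ennreal Bd \<partial>gauss ?J)"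
    by (intro nn_integral_mono pointwise)
  also have "\<dots> = (\<integral>\<^sup>+\<zeta>. \<Theta> \<zeta> \<partial>gauss ?J) * ennreal Bd" by (rule nn_integral_multc[OF m\<Theta>])
  also have "\<dots> \<le> 6 * ennreal Bd" by (rule mult_right_mono[OF i\<Theta>]) simp
  also have "\<dots> = ennreal (6 * Bd)" using Bd0 by (simp add: ennreal_mult)
  finally show ?thesis unfolding D_def .
qed

section \<open>The variance bound\<close>

text \<open>Any slot of \<open>S\<close> can be the distinguished one. The decoupling loss is at most
  \<open>3\<^sup>2\<^sup>k = 9\<^sup>k\<close>.\<close>
lemma noise_part_second_moment_le:
  fixes p q k M :: nat
  assumes A: "A \<in> carrier_mat p q" and k: "k \<ge> 1" and q: "q \<ge> 1" and M: "M = q + 2 * k"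
    and S: "S \<subseteq> {..<2 * k}" "S \<noteq> {}"
  defines "Q \<equiv> 162 * real M" and "P \<equiv> 162 * (real p + 2 * real M)"
  defines "Bd \<equiv> (P * Q) ^ k + P * (\<Sum>i=1..q. singular_value i A ^ (4 * k - 4)) +
      (\<Sum>i=1..q. singular_value i A ^ (4 * k - 2))"
  shows "(\<integral>\<omega>. (noise_part k p q A S \<omega>)\<^sup>2 \<partial>gauss ({..<p} \<times> {..<q})) \<le> 9 ^ k * (6 * Bd)"
proof -
  let ?I = "{..<p} \<times> {..<q}" and ?C = "{0, Suc 0, 2}"
  obtain u where u: "u \<in> S" using S by auto
  have finS: "finite S" using S(1) by (rule finite_subset) simp
  have cardS: "card S \<le> 2 * k" using card_mono[OF _ S(1)] by simp
  have col: "slot_colour u ` S \<subseteq> ?C" by (auto simp: slot_colour_def)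
  have sl: "slot k w ` S \<subseteq> ?I" if "w \<in> walks k p q" for w
    using slot_in_range[OF that] S(1) by blast
  note dec = decoupling[where a = "\<lambda>w. \<Prod>u\<in>{..<2 * k} - S. A $$ slot k w u" and x = "slot k"
      and \<kappa> = "slot_colour u" and C = ?C and I = ?I and W = "walks k p q" and S = S,
      OF finite_walks _ _ finS sl col, folded noise_part_def decoupled_part_def]
  let ?E = "\<integral>\<zeta>. (decoupled_part k p q A S u \<zeta>)\<^sup>2 \<partial>gauss (?C \<times> ?I)"
  have int: "integrable (gauss (?C \<times> ?I)) (\<lambda>\<zeta>. (decoupled_part k p q A S u \<zeta>)\<^sup>2)"
    by (rule dec(1)) auto
  have le: "(\<integral>\<omega>. (noise_part k p q A S \<omega>)\<^sup>2 \<partial>gauss ?I) \<le> real (card ?C) ^ card S * ?E"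
    by (rule dec(2)) auto
  have T0: "(\<Sum>i=1..q. singular_value i A ^ n) \<ge> 0" for n
    using singular_value_nonneg[OF A] by (intro sum_nonneg zero_le_power) auto
  have Bd0: "Bd \<ge> 0"
    unfolding Bd_def P_def Q_def using T0 by (intro add_nonneg_nonneg mult_nonneg_nonneg zero_le_power) auto
  have "ennreal ?E = (\<integral>\<^sup>+\<zeta>. ennreal ((decoupled_part k p q A S u \<zeta>)\<^sup>2) \<partial>gauss (?C \<times> ?I))"
    by (rule nn_integral_eq_integral[OF int, symmetric]) simp
  also have "\<dots> \<le> ennreal (6 * Bd)"
    using decoupled_part_second_moment[OF A S(1) u] expected_word_bound[OF A k _ _ q M, folded Q_def P_def, folded Bd_def]
    by fastforce
  finally have E: "?E \<le> 6 * Bd" using Bd0 by (subst (asm) ennreal_le_iff) auto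
  have E0: "?E \<ge> 0" by (rule integral_nonneg_AE) simp
  have "real (card ?C) ^ card S * ?E \<le> 3 ^ (2 * k) * ?E"
    using E0 cardS by (intro mult_right_mono power_increasing) auto
  also have "\<dots> = 9 ^ k * ?E" by (simp add: power_mult)
  also have "\<dots> \<le> 9 ^ k * (6 * Bd)" using E by (intro mult_left_mono) auto
  finally show ?thesis using le by linarith
qed

text \<open>Up to constants, \<open>P\<close> is at most \<open>max p k\<close> and \<open>Q\<close> at most \<open>max q k\<close>. The product of these to the
  power \<open>k\<close> is \<open>(p q)\<^sup>k\<close>, \<open>p\<^sup>k k\<^sup>k\<close> or \<open>k\<^sup>2\<^sup>k\<close>. In the term with \<open>T\<close>, \<open>max p k\<close> is at most \<open>p k\<close>, and
  the factor \<open>k\<close> is absorbed by \<open>2\<^sup>k\<close>. The constant is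
  \<open>4 \<sqdot> 4 \<sqdot> 9 \<sqdot> 6 \<sqdot> 600000\<close>, where \<open>1134 \<sqdot> 486 \<le> 600000\<close>.\<close>
lemma numerical_bound:
  fixes T T' :: real
  assumes pq: "q \<ge> 1" "p \<ge> q" and k: "k \<ge> 2" and T: "T \<ge> 0" "T' \<ge> 0" and M: "M = q + 2 * k"
  defines "Q \<equiv> 162 * real M" and "P \<equiv> 162 * (real p + 2 * real M)"
  shows "4 ^ k * (4 ^ k * (9 ^ k * (6 * ((P * Q) ^ k + P * T + T')))) \<le>
    518400000 ^ k * ((real p * real q) ^ k + real p * T + T' + real p ^ k * real k ^ (3 * k) + real k ^ (6 * k))"
proof -
  define a where "a = max p k"
  define b where "b = max q k"
  let ?K = "600000 :: real"
  have ab: "real p \<le> real a" "real k \<le> real a" "real q \<le> real b" "real k \<le> real b"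
    by (auto simp: a_def b_def)
  have "P \<le> 1134 * real a" using ab pq by (simp add: P_def M)
  moreover have "Q \<le> 486 * real b" using ab by (simp add: Q_def M)
  ultimately have "P * Q \<le> (1134 * real a) * (486 * real b)"
    by (intro mult_mono) (auto simp: Q_def)
  also have "\<dots> \<le> ?K * (real a * real b)" by simp
  finally have PQ: "P * Q \<le> ?K * (real a * real b)" .
  have k1: "real k \<ge> 1" using k by simp
  have "(real a * real b) ^ k \<le> (real p * real q) ^ k + real p ^ k * real k ^ (3 * k) + real k ^ (6 * k)"
  proof -
    have kk: "real k ^ k \<le> real k ^ (3 * k)" "real k ^ (2 * k) \<le> real k ^ (6 * k)"
      using k1 by (auto intro: power_increasing)
    have pk: "real p ^ k * real k ^ k \<le> real p ^ k * real k ^ (3 * k)"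
      using kk by (intro mult_left_mono) auto
    consider "a = p" "b = q" | "a = p" "b = k" | "a = k" "b = k"
      using pq unfolding a_def b_def by linarith
    then show ?thesis
    proof cases
      case 1 then show ?thesis by simp
    next
      case 2
      then have "(real a * real b) ^ k = real p ^ k * real k ^ k" by (simp add: power_mult_distrib)
      then show ?thesis using pk by (simp add: add_increasing add_increasing2)
    next
      case 3
      then have "(real a * real b) ^ k = real k ^ (2 * k)"
        by (simp add: power_mult power2_eq_square)
      then show ?thesis using kk by (simp add: add_increasing)
    qed
  qed
  then have 1: "(P * Q) ^ k \<le> ?K ^ k * ((real p * real q) ^ k + real p ^ k * real k ^ (3 * k) + real k ^ (6 * k))"
    using power_mono[OF PQ, of k] by (simp add: P_def Q_def power_mult_distrib mult_left_mono order_trans)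
  have "real k \<le> 2 ^ k" using less_exp[of k] by (simp add: less_imp_le of_nat_less_two_power)
  have "real a \<le> real p * real k"
    using pq k1 mult_right_mono[of 1 "real p" "real k"] mult_left_mono[of 1 "real k" "real p"]
    by (auto simp: a_def max_def)
  then have "P \<le> 1134 * (real p * real k)" using \<open>P \<le> 1134 * real a\<close> by simp
  also have "\<dots> \<le> 1134 * (real p * 2 ^ k)"
    using \<open>real k \<le> 2 ^ k\<close> by (intro mult_left_mono) auto
  also have "\<dots> \<le> ?K ^ k * real p"
  proof -
    have "1134 * 2 ^ k \<le> (300000 :: real) ^ k * 2 ^ k"
      using power_increasing[of 1 k "300000 :: real"] k by (intro mult_right_mono) auto
    also have "\<dots> = ?K ^ k" by (simp flip: power_mult_distrib)
    finally show ?thesis using mult_right_mono[of "1134 * 2 ^ k" "?K ^ k" "real p"] by (simp add: mult_ac)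
  qed
  finally have "P * T \<le> ?K ^ k * real p * T" using T by (intro mult_right_mono)
  moreover have "T' \<le> ?K ^ k * T'" using T mult_right_mono[of 1 "?K ^ k" T'] by simp
  ultimately have 2: "(P * Q) ^ k + P * T + T' \<le>
      ?K ^ k * ((real p * real q) ^ k + real p * T + T' + real p ^ k * real k ^ (3 * k) + real k ^ (6 * k))" (is "?X \<le> ?K ^ k * ?R")
    using 1 by (simp add: algebra_simps)
  have R: "?R \<ge> 0" using T by (intro add_nonneg_nonneg mult_nonneg_nonneg zero_le_power) auto
  have "(6 :: real) \<le> 6 ^ k" using power_increasing[of 1 k "6 :: real"] k by simp
  then have "4 ^ k * (4 ^ k * (9 ^ k * (6 * ?X))) \<le> 4 ^ k * (4 ^ k * (9 ^ k * (6 ^ k * (?K ^ k * ?R))))"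
    using 2 R T by (intro mult_left_mono mult_mono) (auto simp: P_def Q_def intro!: add_nonneg_nonneg mult_nonneg_nonneg)
  also have "\<dots> = (4 * (4 * (9 * (6 * ?K)))) ^ k * ?R" by (simp only: power_mult_distrib mult.assoc)
  finally show ?thesis by simp
qed

theorem theorem3p3:
  shows "\<exists>c::real. \<forall>(k::nat) (p::nat) (q::nat) (A::real mat).
    k \<ge> 2 \<longrightarrow> q \<ge> 1 \<longrightarrow> p \<ge> q \<longrightarrow> A \<in> carrier_mat p q \<longrightarrow>
    prob_space.variance (std_gaussian p q) (\<lambda>\<omega>. U_stat k (A + mat p q \<omega>)) \<le>
      c ^ k * ((real p * real q) ^ k
        + real p * schatten_norm (4 * k - 4) A ^ (4 * k - 4)
        + schatten_norm (4 * k - 2) A ^ (4 * k - 2)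
        + real p ^ k * real k ^ (3 * k)
        + real k ^ (6 * k))"
proof (intro exI[of _ "518400000 :: real"] allI impI)
  fix k p q :: nat and A :: "real mat"
  assume k: "k \<ge> 2" and q: "q \<ge> 1" and pq: "p \<ge> q" and A: "A \<in> carrier_mat p q"
  define M where "M = q + 2 * k"
  define Q where "Q = 162 * real M"
  define P where "P = 162 * (real p + 2 * real M)"
  define T where "T = schatten_norm (4 * k - 4) A ^ (4 * k - 4)"
  define T' where "T' = schatten_norm (4 * k - 2) A ^ (4 * k - 2)"
  have T: "T = (\<Sum>i=1..q. singular_value i A ^ (4 * k - 4))" "T' = (\<Sum>i=1..q. singular_value i A ^ (4 * k - 2))"
    unfolding T_def T'_def using k by (intro schatten_norm_power[OF A]; simp)+
  have T0: "T \<ge> 0" "T' \<ge> 0"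
    unfolding T using singular_value_nonneg[OF A] by (intro sum_nonneg zero_le_power; simp)+
  define Bd where "Bd = (P * Q) ^ k + P * T + T'"
  have Bd0: "Bd \<ge> 0" unfolding Bd_def using T0
    by (intro add_nonneg_nonneg mult_nonneg_nonneg zero_le_power) (auto simp: P_def Q_def)
  have "prob_space.variance (std_gaussian p q) (\<lambda>\<omega>. U_stat k (A + mat p q \<omega>)) \<le>
    4 ^ k * (\<Sum>S\<in>Pow {..<2 * k} - {{}}. \<integral>\<omega>. (noise_part k p q A S \<omega>)\<^sup>2 \<partial>gauss ({..<p} \<times> {..<q}))"
    by (rule variance_le_noise_parts[OF A])
  also have "\<dots> \<le> 4 ^ k * (\<Sum>S\<in>Pow {..<2 * k} - {{}}. 9 ^ k * (6 * Bd))"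
    unfolding Bd_def T P_def Q_def using k
    by (intro mult_left_mono sum_mono noise_part_second_moment_le[OF A _ q M_def]) auto
  also have "\<dots> \<le> 4 ^ k * (4 ^ k * (9 ^ k * (6 * Bd)))"
  proof -
    have "card (Pow {..<2 * k} - {{}}) \<le> card (Pow {..<2 * k})" by (intro card_mono) auto
    also have "\<dots> = 4 ^ k" by (simp add: card_Pow power_mult)
    finally have "real (card (Pow {..<2 * k} - {{}})) \<le> real (4 ^ k)" by (rule of_nat_mono)
    then show ?thesis using Bd0 by (simp add: mult_right_mono)
  qed
  also have "\<dots> \<le> 518400000 ^ k * ((real p * real q) ^ k + real p * T + T' +
      real p ^ k * real k ^ (3 * k) + real k ^ (6 * k))"
    unfolding Bd_def P_def Q_def by (rule numerical_bound[OF q pq k T0 M_def])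
  finally show "prob_space.variance (std_gaussian p q) (\<lambda>\<omega>. U_stat k (A + mat p q \<omega>)) \<le>
      518400000 ^ k * ((real p * real q) ^ k
        + real p * schatten_norm (4 * k - 4) A ^ (4 * k - 4)
        + schatten_norm (4 * k - 2) A ^ (4 * k - 2)
        + real p ^ k * real k ^ (3 * k)
        + real k ^ (6 * k))"
    unfolding T_def T'_def .
qed

end
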